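(* Let $\mu>0$ and $v\in X$. There exist constants $\mathcal{R}_1,\mathcal{R}_2,\mathcal{R}'>0$ and an integer threshold $m_0$, all depending only on $\mu,\gamma,\|f\|,L$ and $|v|_X$, such that if $m\ge m_0$ then every solution $w\in Y$ on $\mathbb{R}$ of $$iw_s+w_{xx}+|w|^2w+i\gamma w=f-i\mu\,[P_m w-v]$$ (with $L$-periodic boundary conditions) satisfies $$\sup_{s\in\mathbb{R}}\|w(s)\|\le \mathcal{R}_0:=\frac{\|f\|}{\sqrt{\gamma(\gamma+\mu)}}+\sqrt{\frac{\mu}{\gamma+\mu}}\,|v|_X+\sqrt{\frac{\mu}{\gamma+\mu}},$$ $$\sup_{s}\|w(s)\|_{H^1}\le\mathcal{R}_1,\qquad \sup_s\|w(s)\|_{H^2}\le \mathcal{R}_2,\qquad \sup_s\|w_s(s)\|\le\mathcal{R}'.$$ Moreover, for fixed $\gamma,\|f\|,L,|v|_X$, one has $\mathcal{R}_1=O(\mu^{1/2})$, $\mathcal{R}_2=O(\mu^2)$, $\mathcal{R}'=O(\mu^2)$ and one may take $m_0=O(\mu^4)$ as $\mu\to\infty$.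
   Context: Fix $0<L<\infty$, $\gamma>0$ and a time-independent $f\in L^2_{per}[0,L]$, $f\ne0$. $\|\cdot\|$ is the $L^2(0,L)$ norm, $\|w\|_{H^1}^2=\|w\|^2+\|w_x\|^2$, $\|w\|_{H^2}^2=\|w\|^2+\|w_{xx}\|^2$. $P_m$ is the $L^2$-orthogonal projection onto $H_m=\mathrm{span}\{e^{2\pi ikx/L}:|k|\le m\}$. $X=C^1_b(\mathbb{R},P_mH^2)$ is the space of continuously differentiable maps $v:\mathbb{R}\to P_mH^2_{per}$ with finite norm $|v|_X=\sup_{s}\|v(s)\|+\sup_s\|v_s(s)\|$; $Y=C_b(\mathbb{R},H^2)$ is the space of continuous maps $w:\mathbb{R}\to H^2_{per}$ with $|w|_Y=\sup_s\|w(s)\|_{H^2}<\infty$. *)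

theory Defs
  imports "HOL-Analysis.Analysis" "HOL-Library.Landau_Symbols"
begin

definition per :: "real \<Rightarrow> (real \<Rightarrow> complex) \<Rightarrow> bool" where
  "per L u \<longleftrightarrow> (\<forall>x. u (x + L) = u x)"

definition L2per :: "real \<Rightarrow> (real \<Rightarrow> complex) set" where
  "L2per L = {u. per L u \<and> u \<in> borel_measurable lborel \<and>
                 set_integrable lborel {0..L} (\<lambda>x. (cmod (u x))\<^sup>2)}"

definition l2norm :: "real \<Rightarrow> (real \<Rightarrow> complex) \<Rightarrow> real" where
  "l2norm L u = sqrt (LINT x:{0..L}|lborel. (cmod (u x))\<^sup>2)"

definition ek :: "real \<Rightarrow> int \<Rightarrow> real \<Rightarrow> complex" where
  "ek L k x = cis (2 * pi * real_of_int k * x / L)"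

definition fcoef :: "real \<Rightarrow> (real \<Rightarrow> complex) \<Rightarrow> int \<Rightarrow> complex" where
  "fcoef L u k = complex_of_real (1 / L) * (LINT x:{0..L}|lborel. u x * cnj (ek L k x))"

text \<open>g is the (periodic, weak) derivative of u: both in L2_per, and tested against the
  trigonometric test functions e_k (integration by parts), i.e. Fourier coefficients
  satisfy g_k = (2 pi i k / L) u_k.\<close>
definition wderiv :: "real \<Rightarrow> (real \<Rightarrow> complex) \<Rightarrow> (real \<Rightarrow> complex) \<Rightarrow> bool" where
  "wderiv L u g \<longleftrightarrow> u \<in> L2per L \<and> g \<in> L2per L \<and>
     (\<forall>k::int. fcoef L g k = \<i> * complex_of_real (2 * pi * real_of_int k / L) * fcoef L u k)"

definition H1per :: "real \<Rightarrow> (real \<Rightarrow> complex) set" where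
  "H1per L = {u. \<exists>g. wderiv L u g}"

definition H2per :: "real \<Rightarrow> (real \<Rightarrow> complex) set" where
  "H2per L = {u. \<exists>g h. wderiv L u g \<and> wderiv L g h}"

definition d1 :: "real \<Rightarrow> (real \<Rightarrow> complex) \<Rightarrow> (real \<Rightarrow> complex)" where
  "d1 L u = (SOME g. wderiv L u g)"

definition d2 :: "real \<Rightarrow> (real \<Rightarrow> complex) \<Rightarrow> (real \<Rightarrow> complex)" where
  "d2 L u = (SOME h. \<exists>g. wderiv L u g \<and> wderiv L g h)"

definition h1norm :: "real \<Rightarrow> (real \<Rightarrow> complex) \<Rightarrow> real" where
  "h1norm L u = sqrt ((l2norm L u)\<^sup>2 + (l2norm L (d1 L u))\<^sup>2)"

definition h2norm :: "real \<Rightarrow> (real \<Rightarrow> complex) \<Rightarrow> real" where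
  "h2norm L u = sqrt ((l2norm L u)\<^sup>2 + (l2norm L (d2 L u))\<^sup>2)"

definition Hm :: "real \<Rightarrow> nat \<Rightarrow> (real \<Rightarrow> complex) set" where
  "Hm L m = {u. \<exists>c. u = (\<lambda>x. \<Sum>k\<in>{-int m..int m}. c k * ek L k x)}"

definition Pm :: "real \<Rightarrow> nat \<Rightarrow> (real \<Rightarrow> complex) \<Rightarrow> (real \<Rightarrow> complex)" where
  "Pm L m u = (\<lambda>x. \<Sum>k\<in>{-int m..int m}. fcoef L u k * ek L k x)"

definition l2_has_deriv ::
  "real \<Rightarrow> (real \<Rightarrow> real \<Rightarrow> complex) \<Rightarrow> (real \<Rightarrow> complex) \<Rightarrow> real \<Rightarrow> bool" where
  "l2_has_deriv L u g s \<longleftrightarrow> g \<in> L2per L \<and>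
     ((\<lambda>h. l2norm L (\<lambda>x. (u (s + h) x - u s x) / complex_of_real h - g x)) \<longlongrightarrow> 0) (at 0)"

definition tderiv :: "real \<Rightarrow> (real \<Rightarrow> real \<Rightarrow> complex) \<Rightarrow> real \<Rightarrow> (real \<Rightarrow> complex)" where
  "tderiv L u s = (SOME g. l2_has_deriv L u g s)"

definition Xspace :: "real \<Rightarrow> nat \<Rightarrow> (real \<Rightarrow> real \<Rightarrow> complex) set" where
  "Xspace L m = {v. (\<forall>s. v s \<in> Hm L m) \<and>
     (\<exists>vs. (\<forall>s. l2_has_deriv L v (vs s) s) \<and>
           (\<forall>s. ((\<lambda>t. l2norm L (\<lambda>x. vs t x - vs s x)) \<longlongrightarrow> 0) (at s)) \<and>
           (\<exists>B. \<forall>s. l2norm L (v s) \<le> B \<and> l2norm L (vs s) \<le> B))}"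

definition Xnorm :: "real \<Rightarrow> (real \<Rightarrow> real \<Rightarrow> complex) \<Rightarrow> real" where
  "Xnorm L v = (SUP s. l2norm L (v s)) + (SUP s. l2norm L (tderiv L v s))"

definition Yspace :: "real \<Rightarrow> (real \<Rightarrow> real \<Rightarrow> complex) set" where
  "Yspace L = {w. (\<forall>s. w s \<in> H2per L) \<and>
     (\<forall>s. ((\<lambda>t. h2norm L (\<lambda>x. w t x - w s x)) \<longlongrightarrow> 0) (at s)) \<and>
     (\<exists>B. \<forall>s. h2norm L (w s) \<le> B)}"

definition is_sol :: "real \<Rightarrow> real \<Rightarrow> (real \<Rightarrow> complex) \<Rightarrow> real \<Rightarrow> nat \<Rightarrow>
    (real \<Rightarrow> real \<Rightarrow> complex) \<Rightarrow> (real \<Rightarrow> real \<Rightarrow> complex) \<Rightarrow> bool" where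
  "is_sol L \<gamma> f \<mu> m v w \<longleftrightarrow> w \<in> Yspace L \<and>
     (\<forall>s. \<exists>g. l2_has_deriv L w g s) \<and>
     (\<forall>s. AE x in lborel. x \<in> {0..L} \<longrightarrow>
        \<i> * tderiv L w s x + d2 L (w s) x + complex_of_real ((cmod (w s x))\<^sup>2) * w s x
          + \<i> * complex_of_real \<gamma> * w s x
        = f x - \<i> * complex_of_real \<mu> * (Pm L m (w s) x - v s x))"

end

(*
  The linear damping and the nudging term control the three energies of the equation
  one after the other.  Write A = w_xx + |w|^2 w and G = gamma w + mu P_m w + i f - mu v, so that
  w_s = i A - G.

  The L2 balance, in which mu |P_m w|^2 absorbs mu (v, P_m w), gives |w|^2 = O(mu) without any
  condition on m.  In the first order energy |w_x|^2 - |w|_4^4 / 2 + 2 Re(i w, i f - mu v) the forcing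
  appears in the derivative only through v_s, so no spatial derivative of f or v is needed; this
  bounds |w_x| by a power of mu.  For m of order mu^4 the high modes of w are then small, the L2
  balance improves to the radius R_0, and |w_x| = O(mu).

  The second order energy |w_s|^2 + |(rho)_x|^2 / 2 + 2 |w w_x|^2 - 4 |w|_6^6 / 3 with rho = |w|^2 is
  chosen such that the dangerous term Im(w^2, (w_s)^2) cancels; it gives |w_xx| = O(mu^4), hence
  small high modes of w_x.  Now mu |P_m w_x|^2 is as good as mu |w_x|^2, which improves the first
  order estimate to |w_x| = O(mu^(1/2)), and then the second order one to |w_xx| = O(mu^2).

  All estimates are differential inequalities F' <= C - k F for bounded functions on the whole real
  line, which force F <= C / k.  Since w_s is not differentiable in time, the derivative of |w_s|^2 is
  computed from difference quotients.
*)
theory Submission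
  imports Defs
begin

section \<open>Square integrable functions on a period\<close>

text \<open>Nudging damps only the low modes. At first the usable dissipation of the first order
  energy is therefore just \<gamma>, while its sources carry \<gamma> + \<mu>; the quotient \<theta>
  = (\<gamma> + \<mu>) / \<kappa> costs a factor \<mu> and forces two rounds. The rate \<kappa> =
  \<gamma> + \<mu>, hence \<theta> = 1, is available once the high modes of \<open>w1\<close> have
  norm at most 1. The high modes of a function are bounded by a multiple of the norm of its
  derivative divided by m, and the first-round bounds of \<open>w1\<close> and of \<open>w2\<close>
  are both of order (1 + \<mu>)^4: this is the exponent of the threshold. In the second order energy
  the rate stays \<gamma>. Its largest source is the square of the bound of |w|^2 times the sixth
  power of the bound of |w_x|, of order \<mu>^4 when |w_x| = O(\<mu>^(1/2)); its square root is the
  \<mu>^2 of the last two bounds. Membership in Y only makes the energies bounded; its bound enters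
  no constant. Weak derivatives are prescribed through Fourier coefficients, so integration by parts
  and the sup bound are proved for partial sums and extended by completeness of the
  exponentials.\<close>

locale period =
  fixes L :: real
  assumes L_pos: "0 < L"
begin

definition M :: "real measure" where
  "M = restrict_space lborel {0..L}"

text \<open>Periodicity is dropped and measurability is asked on one period only: all integrals see
  nothing but \<open>{0..L}\<close>, and the periodic classes enter through
  \<open>L2per_subset\<close>.\<close>

definition L2 :: "(real \<Rightarrow> complex) set" where
  "L2 = {u. u \<in> borel_measurable M \<and> integrable M (\<lambda>x. (cmod (u x))\<^sup>2)}"

definition cip :: "(real \<Rightarrow> complex) \<Rightarrow> (real \<Rightarrow> complex) \<Rightarrow> complex" where
  "cip u v = (\<integral>x. u x * cnj (v x) \<partial>M)"

text \<open>For this real inner product \<open>\<i> * u\<close> is orthogonal to \<open>u\<close>;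
  that is how the conservative terms of the equation drop out of the energy balances.\<close>

definition ip :: "(real \<Rightarrow> complex) \<Rightarrow> (real \<Rightarrow> complex) \<Rightarrow> real" where
  "ip u v = Re (cip u v)"

definition nrm :: "(real \<Rightarrow> complex) \<Rightarrow> real" where
  "nrm u = sqrt (\<integral>x. (cmod (u x))\<^sup>2 \<partial>M)"

lemma space_M [simp]: "space M = {0..L}"
  by (simp add: M_def space_restrict_space)

lemma emeasure_space_M: "emeasure M {0..L} = L"
  using L_pos by (simp add: M_def emeasure_restrict_space)

lemma measure_space_M: "measure M {0..L} = L"
  using L_pos by (simp add: measure_def emeasure_space_M)

sublocale M: finite_measure M
  by standard (simp add: emeasure_space_M)

lemma set_integral_M: "set_lebesgue_integral lborel {0..L} f = integral\<^sup>L M f"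
  for f :: "real \<Rightarrow> 'a::{banach, second_countable_topology}"
  by (simp add: M_def set_lebesgue_integral_def integral_restrict_space)

lemma set_integrable_M: "set_integrable lborel {0..L} f \<longleftrightarrow> integrable M f"
  for f :: "real \<Rightarrow> 'a::{banach, second_countable_topology}"
  by (simp add: M_def set_integrable_def integrable_restrict_space)

lemma AE_M: "(AE x in M. Q x) \<longleftrightarrow> (AE x in lborel. x \<in> {0..L} \<longrightarrow> Q x)"
  unfolding M_def by (subst AE_restrict_space_iff) auto

lemma borel_measurable_M: "f \<in> borel_measurable borel \<Longrightarrow> f \<in> borel_measurable M"
  by (simp add: M_def measurable_restrict_space1)

lemma l2norm_eq: "l2norm L u = nrm u"
  by (simp add: l2norm_def nrm_def set_integral_M)

lemma fcoef_eq: "fcoef L u k = cip u (ek L k) / L"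
  by (simp add: fcoef_def cip_def set_integral_M)

lemma L2per_subset: "L2per L \<subseteq> L2"
  by (auto simp: L2per_def L2_def set_integrable_M M_def measurable_restrict_space1)

named_theorems L2_intros

lemma L2_measurable [measurable_dest]: "u \<in> L2 \<Longrightarrow> u \<in> borel_measurable M"
  by (simp add: L2_def)

lemma L2_integrable_square: "u \<in> L2 \<Longrightarrow> integrable M (\<lambda>x. (cmod (u x))\<^sup>2)"
  by (simp add: L2_def)

lemma L2_mult_integrable [simp]:
  assumes "u \<in> L2" "v \<in> L2"
  shows "integrable M (\<lambda>x. u x * v x)"
proof (rule Bochner_Integration.integrable_bound)
  show "integrable M (\<lambda>x. (cmod (u x))\<^sup>2 + (cmod (v x))\<^sup>2)"
    using assms by (simp add: L2_integrable_square)
  show "(\<lambda>x. u x * v x) \<in> borel_measurable M" using assms by measurable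
  have "cmod (u x) * cmod (v x) \<le> (cmod (u x))\<^sup>2 + (cmod (v x))\<^sup>2" for x
    using sum_squares_bound[of "cmod (u x)" "cmod (v x)"]
      mult_nonneg_nonneg[OF norm_ge_zero[of "u x"] norm_ge_zero[of "v x"]]
    by linarith
  then show "AE x in M. norm (u x * v x) \<le> norm ((cmod (u x))\<^sup>2 + (cmod (v x))\<^sup>2)"
    by (simp add: norm_mult)
qed

lemma borel_measurable_cnj [measurable (raw)]:
  "u \<in> borel_measurable N \<Longrightarrow> (\<lambda>x. cnj (u x)) \<in> borel_measurable N"
  by (rule measurable_compose[OF _ borel_measurable_continuous_onI])
    (auto intro: continuous_intros)

lemma L2_cnj [L2_intros]: "u \<in> L2 \<Longrightarrow> (\<lambda>x. cnj (u x)) \<in> L2"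
  by (simp add: L2_def borel_measurable_cnj)

lemma L2_ip_integrable [simp]:
  "u \<in> L2 \<Longrightarrow> v \<in> L2 \<Longrightarrow> integrable M (\<lambda>x. u x * cnj (v x))"
  using L2_mult_integrable[OF _ L2_cnj] by blast

lemma L2_norm_mult_integrable [simp]:
  "u \<in> L2 \<Longrightarrow> v \<in> L2 \<Longrightarrow> integrable M (\<lambda>x. cmod (u x) * cmod (v x))"
  using integrable_norm[OF L2_mult_integrable] by (simp add: norm_mult)

lemma L2I_bound:
  assumes "u \<in> borel_measurable M" "v \<in> L2" "AE x in M. cmod (u x) \<le> B * cmod (v x)"
  shows "u \<in> L2"
proof -
  have "integrable M (\<lambda>x. (cmod (u x))\<^sup>2)"
  proof (rule Bochner_Integration.integrable_bound)
    show "integrable M (\<lambda>x. B\<^sup>2 * (cmod (v x))\<^sup>2)"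
      using assms by (simp add: L2_integrable_square)
    show "(\<lambda>x. (cmod (u x))\<^sup>2) \<in> borel_measurable M" using assms by measurable
    show "AE x in M. norm ((cmod (u x))\<^sup>2) \<le> norm (B\<^sup>2 * (cmod (v x))\<^sup>2)"
      using assms(3)
    proof eventually_elim
      case (elim x)
      then have "(cmod (u x))\<^sup>2 \<le> (B * cmod (v x))\<^sup>2" by (intro power_mono) auto
      then show ?case by (simp add: power_mult_distrib)
    qed
  qed
  with assms show ?thesis by (simp add: L2_def)
qed

lemma L2_cmult [L2_intros]: "u \<in> L2 \<Longrightarrow> (\<lambda>x. c * u x) \<in> L2"
  by (rule L2I_bound[where v = u and B = "cmod c"]) (auto simp: norm_mult)

lemma L2_minus [L2_intros]: "u \<in> L2 \<Longrightarrow> (\<lambda>x. - u x) \<in> L2"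
  using L2_cmult[of u "-1"] by simp

lemma L2_divide [L2_intros]: "u \<in> L2 \<Longrightarrow> (\<lambda>x. u x / c) \<in> L2"
  using L2_cmult[of u "inverse c"] by (simp add: divide_inverse mult.commute)

lemma L2_add [L2_intros]:
  assumes "u \<in> L2" "v \<in> L2"
  shows "(\<lambda>x. u x + v x) \<in> L2"
proof -
  have "integrable M (\<lambda>x. (cmod (u x + v x))\<^sup>2)"
  proof (rule Bochner_Integration.integrable_bound)
    show "integrable M (\<lambda>x. 2 * (cmod (u x))\<^sup>2 + 2 * (cmod (v x))\<^sup>2)"
      using assms by (simp add: L2_integrable_square)
    show "(\<lambda>x. (cmod (u x + v x))\<^sup>2) \<in> borel_measurable M" using assms by measurable
    have "(cmod (u x + v x))\<^sup>2 \<le> 2 * (cmod (u x))\<^sup>2 + 2 * (cmod (v x))\<^sup>2" for x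
    proof -
      have "(cmod (u x + v x))\<^sup>2 \<le> (cmod (u x) + cmod (v x))\<^sup>2"
        by (intro power_mono norm_triangle_ineq) auto
      also have "\<dots> \<le> 2 * (cmod (u x))\<^sup>2 + 2 * (cmod (v x))\<^sup>2"
        using sum_squares_bound[of "cmod (u x)" "cmod (v x)"] by (simp add: power2_sum)
      finally show ?thesis .
    qed
    then show "AE x in M. norm ((cmod (u x + v x))\<^sup>2) \<le> norm (2 * (cmod (u x))\<^sup>2 + 2 * (cmod (v x))\<^sup>2)"
      by simp
  qed
  moreover have "(\<lambda>x. u x + v x) \<in> borel_measurable M" using assms by measurable
  ultimately show ?thesis by (simp add: L2_def)
qed

lemma L2_diff [L2_intros]: "u \<in> L2 \<Longrightarrow> v \<in> L2 \<Longrightarrow> (\<lambda>x. u x - v x) \<in> L2"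
  using L2_add[of u "\<lambda>x. - v x"] L2_minus by auto

lemma L2_const [L2_intros]: "(\<lambda>x. c) \<in> L2"
  by (simp add: L2_def)

lemma L2_sum [L2_intros]: "(\<And>i. i \<in> A \<Longrightarrow> u i \<in> L2) \<Longrightarrow> (\<lambda>x. \<Sum>i\<in>A. u i x) \<in> L2"
  by (induction A rule: infinite_finite_induct) (auto intro: L2_intros)

lemma L2I_bounded:
  "u \<in> borel_measurable M \<Longrightarrow> (AE x in M. cmod (u x) \<le> B) \<Longrightarrow> u \<in> L2"
  by (rule L2I_bound[OF _ L2_const[of 1], of _ B]) auto

lemma cip_add_left: "u \<in> L2 \<Longrightarrow> v \<in> L2 \<Longrightarrow> y \<in> L2 \<Longrightarrow> cip (\<lambda>x. u x + v x) y = cip u y + cip v y"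
  by (simp add: cip_def ring_distribs)

lemma cip_diff_left: "u \<in> L2 \<Longrightarrow> v \<in> L2 \<Longrightarrow> y \<in> L2 \<Longrightarrow> cip (\<lambda>x. u x - v x) y = cip u y - cip v y"
  by (simp add: cip_def ring_distribs)

lemma cip_minus_left: "cip (\<lambda>x. - u x) y = - cip u y"
  by (simp add: cip_def)

lemma cip_cmult_left: "cip (\<lambda>x. c * u x) y = c * cip u y"
  by (simp add: cip_def mult.assoc)

lemma cip_commute: "cip u v = cnj (cip v u)"
proof -
  have "cip u v = (\<integral>x. cnj (v x * cnj (u x)) \<partial>M)"
    by (simp add: cip_def mult.commute)
  also have "\<dots> = cnj (cip v u)"
    unfolding cip_def by (rule Bochner_Integration.integral_cnj)
  finally show ?thesis .
qed

lemma cip_add_right: "u \<in> L2 \<Longrightarrow> v \<in> L2 \<Longrightarrow> y \<in> L2 \<Longrightarrow> cip y (\<lambda>x. u x + v x) = cip y u + cip y v"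
  by (simp add: cip_def ring_distribs)

lemma cip_diff_right: "u \<in> L2 \<Longrightarrow> v \<in> L2 \<Longrightarrow> y \<in> L2 \<Longrightarrow> cip y (\<lambda>x. u x - v x) = cip y u - cip y v"
  by (simp add: cip_def ring_distribs)

lemma cip_cmult_right: "cip y (\<lambda>x. c * u x) = cnj c * cip y u"
  by (subst cip_commute) (simp add: cip_cmult_left cip_commute[of u y])

lemma cip_sum_left:
  "(\<And>i. i \<in> A \<Longrightarrow> u i \<in> L2) \<Longrightarrow> y \<in> L2 \<Longrightarrow> cip (\<lambda>x. \<Sum>i\<in>A. u i x) y = (\<Sum>i\<in>A. cip (u i) y)"
proof (induction A rule: infinite_finite_induct)
  case (insert a A)
  then show ?case by (simp add: cip_add_left L2_sum)
qed (simp_all add: cip_def)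

lemma ip_eq: "u \<in> L2 \<Longrightarrow> v \<in> L2 \<Longrightarrow> ip u v = (\<integral>x. Re (u x * cnj (v x)) \<partial>M)"
  unfolding ip_def cip_def by (rule integral_Re[symmetric]) simp

lemma ip_integrable [simp]: "u \<in> L2 \<Longrightarrow> v \<in> L2 \<Longrightarrow> integrable M (\<lambda>x. Re (u x * cnj (v x)))"
  by (intro integrable_Re) simp

lemma ip_add_left: "u \<in> L2 \<Longrightarrow> v \<in> L2 \<Longrightarrow> y \<in> L2 \<Longrightarrow> ip (\<lambda>x. u x + v x) y = ip u y + ip v y"
  by (simp add: ip_def cip_add_left)

lemma ip_diff_left: "u \<in> L2 \<Longrightarrow> v \<in> L2 \<Longrightarrow> y \<in> L2 \<Longrightarrow> ip (\<lambda>x. u x - v x) y = ip u y - ip v y"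
  by (simp add: ip_def cip_diff_left)

lemma ip_add_right: "u \<in> L2 \<Longrightarrow> v \<in> L2 \<Longrightarrow> y \<in> L2 \<Longrightarrow> ip y (\<lambda>x. u x + v x) = ip y u + ip y v"
  by (simp add: ip_def cip_add_right)

lemma ip_diff_right: "u \<in> L2 \<Longrightarrow> v \<in> L2 \<Longrightarrow> y \<in> L2 \<Longrightarrow> ip y (\<lambda>x. u x - v x) = ip y u - ip y v"
  by (simp add: ip_def cip_diff_right)

lemma ip_minus_left: "ip (\<lambda>x. - u x) y = - ip u y"
  by (simp add: ip_def cip_minus_left)

lemma ip_cmult_left: "ip (\<lambda>x. complex_of_real c * u x) y = c * ip u y"
  by (simp add: ip_def cip_cmult_left)

lemma ip_cmult_right: "ip y (\<lambda>x. complex_of_real c * u x) = c * ip y u"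
  by (simp add: ip_def cip_cmult_right)

lemma ip_commute: "ip u v = ip v u"
  by (simp add: ip_def cip_commute[of u v])

lemma ip_ii: "ip (\<lambda>x. \<i> * u x) (\<lambda>x. \<i> * v x) = ip u v"
  by (simp add: ip_def cip_cmult_left cip_cmult_right)

lemma ip_i_left: "ip (\<lambda>x. \<i> * u x) v = - ip u (\<lambda>x. \<i> * v x)"
  by (simp add: ip_def cip_cmult_left cip_cmult_right)

lemma ip_i_self [simp]: "ip (\<lambda>x. \<i> * u x) u = 0" "ip u (\<lambda>x. \<i> * u x) = 0"
  using ip_i_left[of u u] by (simp_all add: ip_commute[of _ u])

lemma cip_cong_AE:
  assumes "AE x in M. u x = u' x" "AE x in M. v x = v' x" "u \<in> L2" "u' \<in> L2" "v \<in> L2" "v' \<in> L2"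
  shows "cip u v = cip u' v'"
  unfolding cip_def
  by (rule integral_cong_AE) (use assms in \<open>auto intro: borel_measurable_integrable\<close>)

lemma ip_cong_AE:
  assumes "AE x in M. u x = u' x" "AE x in M. v x = v' x" "u \<in> L2" "u' \<in> L2" "v \<in> L2" "v' \<in> L2"
  shows "ip u v = ip u' v'"
  unfolding ip_def by (simp add: cip_cong_AE[OF assms])

lemma nrm_square: "(nrm u)\<^sup>2 = (\<integral>x. (cmod (u x))\<^sup>2 \<partial>M)"
  by (simp add: nrm_def)

lemma cip_self: "cip u u = complex_of_real ((nrm u)\<^sup>2)"
  unfolding cip_def nrm_square complex_norm_square[symmetric]
  by (rule integral_complex_of_real)

lemma ip_self: "ip u u = (nrm u)\<^sup>2"
  by (simp add: ip_def cip_self)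

lemma nrm_ge0 [simp]: "0 \<le> nrm u"
  by (simp add: nrm_def)

lemma nrm_cong_AE: "(AE x in M. u x = v x) \<Longrightarrow> u \<in> L2 \<Longrightarrow> v \<in> L2 \<Longrightarrow> nrm u = nrm v"
  unfolding nrm_def by (subst integral_cong_AE[of _ M "\<lambda>x. (cmod (v x))\<^sup>2"])
    (auto dest: L2_integrable_square intro: borel_measurable_integrable)

lemma nrm_cmult: "nrm (\<lambda>x. c * u x) = cmod c * nrm u"
  by (simp add: nrm_def norm_mult power_mult_distrib real_sqrt_mult)

lemma nrm_divide: "nrm (\<lambda>x. u x / c) = nrm u / cmod c"
  using nrm_cmult[of "inverse c" u] by (simp add: divide_inverse norm_inverse mult.commute)

lemma nrm_minus: "nrm (\<lambda>x. - u x) = nrm u"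
  by (simp add: nrm_def)

lemma nrm_minus_commute: "nrm (\<lambda>x. u x - v x) = nrm (\<lambda>x. v x - u x)"
  by (simp add: nrm_def norm_minus_commute)

lemma nrm_zero [simp]: "nrm (\<lambda>x. 0) = 0"
  by (simp add: nrm_def)

lemma nrm_mono:
  assumes "u \<in> borel_measurable M" "v \<in> L2" "AE x in M. cmod (u x) \<le> cmod (v x)"
  shows "nrm u \<le> nrm v"
proof -
  have "u \<in> L2" using L2I_bound[of u v 1] assms by simp
  then show ?thesis
    unfolding nrm_def using assms
    by (intro real_sqrt_le_mono integral_mono_AE L2_integrable_square) (auto intro!: power_mono)
qed

lemma nrm_eq_0_AE: "u \<in> L2 \<Longrightarrow> nrm u = 0 \<Longrightarrow> AE x in M. u x = 0"
  by (simp add: nrm_def integral_nonneg_eq_0_iff_AE L2_integrable_square)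

text \<open>Young's inequality with weight \<open>t\<close> is integrated and used at the optimal
  weight, the quotient of the two norms. The shift by \<open>e\<close>, sent to 0 at the end, keeps
  this quotient meaningful when a norm vanishes.\<close>

lemma integral_norm_mult_le:
  assumes u: "u \<in> L2" and v: "v \<in> L2"
  shows "(\<integral>x. cmod (u x) * cmod (v x) \<partial>M) \<le> nrm u * nrm v"
proof -
  let ?I = "\<integral>x. cmod (u x) * cmod (v x) \<partial>M"
  have bound: "2 * ?I \<le> t * (nrm u)\<^sup>2 + (nrm v)\<^sup>2 / t" if "t > 0" for t
  proof -
    have "2 * ?I = (\<integral>x. 2 * (cmod (u x) * cmod (v x)) \<partial>M)" by simp
    also have "\<dots> \<le> (\<integral>x. t * (cmod (u x))\<^sup>2 + (cmod (v x))\<^sup>2 / t \<partial>M)"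
    proof (rule integral_mono)
      fix x
      have "0 \<le> (sqrt t * cmod (u x) - cmod (v x) / sqrt t)\<^sup>2" by simp
      also have "\<dots> = t * (cmod (u x))\<^sup>2 + (cmod (v x))\<^sup>2 / t - 2 * (cmod (u x) * cmod (v x))"
        using that by (simp add: power2_diff power_mult_distrib power_divide)
      finally show "2 * (cmod (u x) * cmod (v x)) \<le> t * (cmod (u x))\<^sup>2 + (cmod (v x))\<^sup>2 / t" by simp
    qed (use u v in \<open>auto intro!: Bochner_Integration.integrable_add integrable_mult_right integrable_divide L2_integrable_square\<close>)
    also have "\<dots> = t * (nrm u)\<^sup>2 + (nrm v)\<^sup>2 / t"
      using u v by (simp add: nrm_square L2_integrable_square)
    finally show ?thesis .
  qed
  have eps: "?I \<le> (nrm u + e) * (nrm v + e)" if "e > 0" for e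
  proof -
    have a: "nrm u + e > 0" "nrm v + e > 0" using that by (simp_all add: add_nonneg_pos)
    let ?a = "nrm u + e" and ?b = "nrm v + e"
    have "2 * ?I \<le> ?b / ?a * (nrm u)\<^sup>2 + (nrm v)\<^sup>2 / (?b / ?a)"
      using a by (intro bound) simp
    also have "\<dots> \<le> ?b / ?a * ?a\<^sup>2 + ?b\<^sup>2 / (?b / ?a)"
      using a that by (intro add_mono mult_left_mono divide_right_mono power_mono) auto
    also have "\<dots> = 2 * (?a * ?b)" using a by (simp add: power2_eq_square)
    finally show ?thesis by simp
  qed
  have "((\<lambda>e. (nrm u + e) * (nrm v + e)) \<longlongrightarrow> (nrm u + 0) * (nrm v + 0)) (at_right 0)"
    by (intro tendsto_intros)
  moreover have "\<forall>\<^sub>F e in at_right 0. ?I \<le> (nrm u + e) * (nrm v + e)"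
    using eps by (auto simp: eventually_at_right_field intro: exI[of _ 1])
  ultimately show ?thesis
    by (intro tendsto_lowerbound[where F = "at_right 0" and f = "\<lambda>e. (nrm u + e) * (nrm v + e)"]) auto
qed

lemma cmod_cip_le: "u \<in> L2 \<Longrightarrow> v \<in> L2 \<Longrightarrow> cmod (cip u v) \<le> nrm u * nrm v"
  unfolding cip_def
  by (rule order_trans[OF integral_norm_bound]) (simp add: norm_mult integral_norm_mult_le)

lemma abs_ip_le: "u \<in> L2 \<Longrightarrow> v \<in> L2 \<Longrightarrow> \<bar>ip u v\<bar> \<le> nrm u * nrm v"
  unfolding ip_def using cmod_cip_le[of u v] abs_Re_le_cmod[of "cip u v"] by linarith

lemma ip_le: "u \<in> L2 \<Longrightarrow> v \<in> L2 \<Longrightarrow> ip u v \<le> nrm u * nrm v"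
  using abs_ip_le[of u v] by linarith

lemma nrm_add_square:
  "u \<in> L2 \<Longrightarrow> v \<in> L2 \<Longrightarrow> (nrm (\<lambda>x. u x + v x))\<^sup>2 = (nrm u)\<^sup>2 + 2 * ip u v + (nrm v)\<^sup>2"
  by (simp flip: ip_self add: ip_add_left ip_add_right L2_intros ip_commute)

lemma nrm_diff_square:
  "u \<in> L2 \<Longrightarrow> v \<in> L2 \<Longrightarrow> (nrm (\<lambda>x. u x - v x))\<^sup>2 = (nrm u)\<^sup>2 - 2 * ip u v + (nrm v)\<^sup>2"
  by (simp flip: ip_self add: ip_diff_left ip_diff_right L2_intros ip_commute)

lemma nrm_triangle:
  assumes "u \<in> L2" "v \<in> L2"
  shows "nrm (\<lambda>x. u x + v x) \<le> nrm u + nrm v"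
proof -
  have "(nrm (\<lambda>x. u x + v x))\<^sup>2 \<le> (nrm u + nrm v)\<^sup>2"
    using assms abs_ip_le[OF assms] by (simp add: nrm_add_square power2_sum)
  then show ?thesis by (rule power2_le_imp_le) simp
qed

lemma nrm_triangle_diff:
  assumes "u \<in> L2" "v \<in> L2"
  shows "nrm (\<lambda>x. u x - v x) \<le> nrm u + nrm v"
  using nrm_triangle[OF assms(1) L2_minus[OF assms(2)]] by (simp add: nrm_minus)

lemma nrm_triangle_between:
  assumes "u \<in> L2" "v \<in> L2" "y \<in> L2"
  shows "nrm (\<lambda>x. u x - y x) \<le> nrm (\<lambda>x. u x - v x) + nrm (\<lambda>x. v x - y x)"
  using nrm_triangle[of "\<lambda>x. u x - v x" "\<lambda>x. v x - y x"] assms by (simp add: L2_intros)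

lemma nrm_diff_ge: "u \<in> L2 \<Longrightarrow> v \<in> L2 \<Longrightarrow> \<bar>nrm u - nrm v\<bar> \<le> nrm (\<lambda>x. u x - v x)"
  using nrm_triangle[of "\<lambda>x. u x - v x" v] nrm_triangle[of "\<lambda>x. v x - u x" u]
  by (simp add: L2_intros nrm_minus_commute[of v u])

lemma nrm_mult_le:
  assumes "u \<in> borel_measurable M" "AE x in M. cmod (u x) \<le> B" "v \<in> L2" "0 \<le> B"
  shows "nrm (\<lambda>x. u x * v x) \<le> B * nrm v"
proof -
  have "nrm (\<lambda>x. u x * v x) \<le> nrm (\<lambda>x. complex_of_real B * v x)"
  proof (rule nrm_mono)
    show "AE x in M. cmod (u x * v x) \<le> cmod (complex_of_real B * v x)"
      using assms(2) by eventually_elim (use assms(4) in \<open>simp add: norm_mult mult_right_mono\<close>)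
  qed (use assms in \<open>auto intro: L2_intros\<close>)
  then show ?thesis using assms(4) by (simp add: nrm_cmult)
qed

section \<open>Fourier series\<close>

abbreviation "e k \<equiv> ek L k"

abbreviation "P m \<equiv> Pm L m"

definition freq :: "int \<Rightarrow> real" where
  "freq k = 2 * pi * real_of_int k / L"

lemma ek_freq: "e k x = cis (freq k * x)"
  by (simp add: ek_def freq_def)

lemma norm_ek [simp]: "cmod (e k x) = 1"
  by (simp add: ek_def)

lemma cnj_ek: "cnj (e k x) = e (- k) x"
  by (simp add: ek_def cis_cnj)

lemma ek_add: "e (j + k) x = e j x * e k x"
  by (simp add: ek_def cis_mult add_divide_distrib ring_distribs)

lemma ek_has_vector_derivative:
  "(e k has_vector_derivative \<i> * complex_of_real (freq k) * e k x) (at x within S)"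
proof -
  have "((\<lambda>z. exp (\<i> * complex_of_real (freq k) * z)) has_field_derivative
      \<i> * complex_of_real (freq k) * exp (\<i> * complex_of_real (freq k) * complex_of_real x))
      (at (complex_of_real x))"
    by (auto intro!: derivative_eq_intros)
  from has_vector_derivative_real_field[OF this, of S] show ?thesis
    by (simp add: ek_freq[abs_def] cis_conv_exp mult.assoc)
qed

lemma continuous_on_ek [continuous_intros]: "continuous_on S (e k)"
  unfolding ek_def using L_pos by (intro continuous_intros) auto

lemma ek_measurable [measurable]: "e k \<in> borel_measurable M"
  by (intro borel_measurable_M borel_measurable_continuous_onI continuous_intros)

lemma L2_ek [L2_intros]: "e k \<in> L2"
  by (rule L2I_bounded[where B = 1]) auto

lemma ek_0 [simp]: "e 0 x = 1" and ek_L: "e k L = 1"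
  using L_pos by (simp_all add: ek_def cis_multiple_2pi)

lemma integral_ek: "(\<integral>x. e k x \<partial>M) = (if k = 0 then L else 0)"
proof (cases "k = 0")
  case False
  have "freq k \<noteq> 0" using False L_pos by (simp add: freq_def)
  have "(\<integral>x. \<i> * freq k * e k x \<partial>M) = e k L - e k 0"
    unfolding set_integral_M[symmetric] set_lebesgue_integral_def
    by (intro integral_FTC_Icc ek_has_vector_derivative continuous_intros) (use L_pos in auto)
  also have "\<dots> = 0" by (simp add: ek_L) (simp add: ek_def)
  finally have "\<i> * freq k * (\<integral>x. e k x \<partial>M) = 0"
    by simp
  with \<open>freq k \<noteq> 0\<close> show ?thesis using False by simp
qed (simp add: measure_space_M scaleR_conv_of_real)

lemma cip_ek: "cip (e j) (e k) = (if j = k then L else 0)"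
  using integral_ek[of "j - k"] by (simp add: cip_def cnj_ek ek_add flip: ek_add)

lemma fcoef_add: "u \<in> L2 \<Longrightarrow> v \<in> L2 \<Longrightarrow> fcoef L (\<lambda>x. u x + v x) k = fcoef L u k + fcoef L v k"
  by (simp add: fcoef_eq cip_add_left L2_intros add_divide_distrib)

lemma fcoef_diff: "u \<in> L2 \<Longrightarrow> v \<in> L2 \<Longrightarrow> fcoef L (\<lambda>x. u x - v x) k = fcoef L u k - fcoef L v k"
  by (simp add: fcoef_eq cip_diff_left L2_intros diff_divide_distrib)

lemma fcoef_cmult: "fcoef L (\<lambda>x. c * u x) k = c * fcoef L u k"
  by (simp add: fcoef_eq cip_cmult_left)

lemma fcoef_ek: "fcoef L (e j) k = (if j = k then 1 else 0)"
  using L_pos by (simp add: fcoef_eq cip_ek)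

lemma fcoef_cnj: "fcoef L (\<lambda>x. cnj (u x)) k = cnj (fcoef L u (- k))"
proof -
  have "cip (\<lambda>x. cnj (u x)) (e k) = (\<integral>x. cnj (u x * cnj (e (- k) x)) \<partial>M)"
    by (simp add: cip_def cnj_ek)
  then show ?thesis
    by (simp add: fcoef_eq cip_def del: complex_cnj_mult)
qed

lemma fcoef_mult_ek: "fcoef L (\<lambda>x. u x * e j x) k = fcoef L u (k - j)"
proof -
  have "e j x * cnj (e k x) = cnj (e (k - j) x)" for x
    by (simp add: cnj_ek flip: ek_add)
  then show ?thesis by (simp add: fcoef_eq cip_def mult.assoc)
qed

lemma cip_ek_right: "cip u (e k) = L * fcoef L u k"
  using L_pos by (simp add: fcoef_eq)

lemma cip_ek_left: "cip (e k) u = L * cnj (fcoef L u k)"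
  using L_pos by (subst cip_commute) (simp add: cip_ek_right)

lemma L2_P [L2_intros]: "P m u \<in> L2"
  unfolding Pm_def by (intro L2_intros)

lemma cip_P_left:
  "v \<in> L2 \<Longrightarrow> cip (P m u) v = L * (\<Sum>k\<in>{-int m..int m}. fcoef L u k * cnj (fcoef L v k))"
  unfolding Pm_def
  by (subst cip_sum_left) (auto intro: L2_intros simp: cip_cmult_left cip_ek_left sum_distrib_left mult.left_commute)

lemma fcoef_P: "fcoef L (P m u) k = (if \<bar>k\<bar> \<le> int m then fcoef L u k else 0)"
proof -
  have "cip (P m u) (e k) = L * (\<Sum>j\<in>{-int m..int m}. if j = k then fcoef L u k else 0)"
    by (subst cip_P_left) (auto intro!: L2_intros arg_cong2[where f = "(*)"] sum.cong simp: fcoef_ek simp del: sum.delta sum.delta')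
  also have "\<dots> = L * (if \<bar>k\<bar> \<le> int m then fcoef L u k else 0)"
    by (subst sum.delta) auto
  finally show ?thesis using L_pos by (simp add: fcoef_eq split: if_splits)
qed

lemma P_add: "u \<in> L2 \<Longrightarrow> v \<in> L2 \<Longrightarrow> P m (\<lambda>x. u x + v x) = (\<lambda>x. P m u x + P m v x)"
  by (simp add: Pm_def fcoef_add ring_distribs sum.distrib fun_eq_iff)

lemma P_diff: "u \<in> L2 \<Longrightarrow> v \<in> L2 \<Longrightarrow> P m (\<lambda>x. u x - v x) = (\<lambda>x. P m u x - P m v x)"
  by (simp add: Pm_def fcoef_diff ring_distribs sum_subtractf fun_eq_iff)

lemma P_cmult: "P m (\<lambda>x. c * u x) = (\<lambda>x. c * P m u x)"
  by (simp add: Pm_def fcoef_cmult sum_distrib_left mult.assoc fun_eq_iff)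

lemma P_Hm: "u \<in> Hm L m \<Longrightarrow> P m u = u"
proof
  fix x assume "u \<in> Hm L m"
  then obtain c where u: "u = (\<lambda>x. \<Sum>k\<in>{-int m..int m}. c k * e k x)"
    by (auto simp: Hm_def)
  have "fcoef L u k = c k" if "k \<in> {-int m..int m}" for k
  proof -
    have "cip u (e k) = (\<Sum>j\<in>{-int m..int m}. if j = k then L * c k else 0)"
      unfolding u by (subst cip_sum_left)
        (auto intro!: L2_intros sum.cong simp: cip_cmult_left cip_ek simp del: sum.delta sum.delta')
    also have "\<dots> = L * c k" using that by (subst sum.delta) auto
    finally show ?thesis using L_pos by (simp add: fcoef_eq)
  qed
  then show "P m u x = u x" unfolding Pm_def by (subst (2) u) (intro sum.cong, auto)
qed

lemma cip_P_P: "u \<in> L2 \<Longrightarrow> v \<in> L2 \<Longrightarrow> cip (P m u) (P m v) = cip (P m u) v"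
  by (auto simp: cip_P_left L2_P fcoef_P intro!: sum.cong)

lemma ip_P_left: "u \<in> L2 \<Longrightarrow> v \<in> L2 \<Longrightarrow> ip (P m u) v = ip (P m u) (P m v)"
  by (simp add: ip_def cip_P_P)

lemma ip_P_right: "u \<in> L2 \<Longrightarrow> v \<in> L2 \<Longrightarrow> ip u (P m v) = ip (P m u) (P m v)"
  by (metis ip_P_left ip_commute)

lemma ip_P_self: "u \<in> L2 \<Longrightarrow> ip u (P m u) = (nrm (P m u))\<^sup>2"
  by (simp add: ip_P_right ip_self)

lemma nrm_P_square: "u \<in> L2 \<Longrightarrow> (nrm u)\<^sup>2 = (nrm (P m u))\<^sup>2 + (nrm (\<lambda>x. u x - P m u x))\<^sup>2"
  by (simp add: nrm_diff_square L2_P ip_P_self)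

lemma nrm_P_le: "u \<in> L2 \<Longrightarrow> nrm (P m u) \<le> nrm u"
  by (rule power2_le_imp_le) (simp_all add: nrm_P_square[of u m])

subsection \<open>Completeness of the trigonometric system\<close>

text \<open>Completeness is proved by enlarging what is known to lie in this closed subspace:
  exponentials, continuous functions on the circle, bounded functions, and finally all of
  \<open>L2\<close>.\<close>

definition conv :: "(real \<Rightarrow> complex) set" where
  "conv = {u \<in> L2. (\<lambda>N. nrm (\<lambda>x. P N u x - u x)) \<longlonglongrightarrow> 0}"

lemma conv_add: "u \<in> conv \<Longrightarrow> v \<in> conv \<Longrightarrow> (\<lambda>x. u x + v x) \<in> conv"
proof -
  assume a: "u \<in> conv" "v \<in> conv"
  have "nrm (\<lambda>x. P N (\<lambda>x. u x + v x) x - (u x + v x))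
      \<le> nrm (\<lambda>x. P N u x - u x) + nrm (\<lambda>x. P N v x - v x)" for N
    using nrm_triangle[of "\<lambda>x. P N u x - u x" "\<lambda>x. P N v x - v x"] a
    by (simp add: P_add conv_def L2_intros add_diff_add)
  moreover have "(\<lambda>N. nrm (\<lambda>x. P N u x - u x) + nrm (\<lambda>x. P N v x - v x)) \<longlonglongrightarrow> 0"
    using a by (auto simp: conv_def intro!: tendsto_add_zero)
  ultimately show ?thesis using a
    by (auto simp: conv_def L2_add intro!: tendsto_sandwich[OF _ _ tendsto_const, where h = "\<lambda>N. nrm (\<lambda>x. P N u x - u x) + nrm (\<lambda>x. P N v x - v x)"])
qed

lemma conv_cmult: "u \<in> conv \<Longrightarrow> (\<lambda>x. c * u x) \<in> conv"
  by (auto simp: conv_def L2_intros P_cmult nrm_cmult tendsto_mult_right_zero simp flip: right_diff_distrib)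

lemma conv_ek: "e k \<in> conv"
proof -
  have "P N (e k) = e k" if "N \<ge> nat \<bar>k\<bar>" for N
  proof (rule P_Hm)
    have "e k = (\<lambda>x. \<Sum>j\<in>{-int N..int N}. (if j = k then 1 else 0) * e j x)"
    proof
      fix x
      have k: "k \<in> {-int N..int N}" using that by auto
      have "(\<Sum>j\<in>{-int N..int N}. (if j = k then 1 else 0) * e j x) = (\<Sum>j\<in>{-int N..int N}. if j = k then e k x else 0)"
        by (intro sum.cong) auto
      then show "e k x = (\<Sum>j\<in>{-int N..int N}. (if j = k then 1 else 0) * e j x)"
        using k by (simp add: sum.delta)
    qed
    then show "e k \<in> Hm L N" by (auto simp: Hm_def intro!: exI[of _ "\<lambda>j. if j = k then 1 else 0"])
  qed
  then have "\<forall>\<^sub>F N in sequentially. nrm (\<lambda>x. P N (e k) x - e k x) = 0"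
    by (intro eventually_sequentiallyI[of "nat \<bar>k\<bar>"]) simp
  then show ?thesis by (simp add: conv_def L2_ek tendsto_eventually)
qed

text \<open>Since \<open>P N\<close> does not increase the norm, an approximation of
  \<open>u\<close> is projected with the same error for every \<open>N\<close>, and three thirds of
  the tolerance suffice.\<close>

lemma conv_closed:
  assumes u: "u \<in> L2" and "\<And>\<epsilon>. \<epsilon> > 0 \<Longrightarrow> \<exists>v\<in>conv. nrm (\<lambda>x. u x - v x) < \<epsilon>"
  shows "u \<in> conv"
proof -
  have "(\<lambda>N. nrm (\<lambda>x. P N u x - u x)) \<longlonglongrightarrow> 0"
  proof (rule LIMSEQ_I)
    fix r :: real assume "0 < r"
    then obtain v where v: "v \<in> conv" and uv: "nrm (\<lambda>x. u x - v x) < r / 3"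
      using assms(2)[of "r/3"] by auto
    then have "v \<in> L2" by (simp add: conv_def)
    have "(\<lambda>N. nrm (\<lambda>x. P N v x - v x)) \<longlonglongrightarrow> 0" using v by (simp add: conv_def)
    then obtain N0 where N0: "\<And>N. N \<ge> N0 \<Longrightarrow> nrm (\<lambda>x. P N v x - v x) < r / 3"
      using \<open>0 < r\<close> LIMSEQ_D[of _ 0 "r/3"] by fastforce
    have "norm (nrm (\<lambda>x. P N u x - u x) - 0) < r" if "N \<ge> N0" for N
    proof -
      have "nrm (\<lambda>x. P N u x - P N v x) \<le> nrm (\<lambda>x. u x - v x)"
        using nrm_P_le[of "\<lambda>x. u x - v x" N] u \<open>v \<in> L2\<close> by (simp add: P_diff L2_intros)
      moreover have "nrm (\<lambda>x. P N u x - u x)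
          \<le> nrm (\<lambda>x. P N u x - P N v x) + (nrm (\<lambda>x. P N v x - v x) + nrm (\<lambda>x. v x - u x))"
        using nrm_triangle_between[of "P N u" "P N v" u] nrm_triangle_between[of "P N v" v u]
          u \<open>v \<in> L2\<close> by (simp add: L2_intros)
      ultimately show ?thesis
        using N0[OF that] uv by (simp add: nrm_minus_commute[of v u])
    qed
    then show "\<exists>no. \<forall>n\<ge>no. norm (nrm (\<lambda>x. P n u x - u x) - 0) < r" by blast
  qed
  then show ?thesis using u by (simp add: conv_def)
qed

lemma conv_sequentially_closed:
  assumes "u \<in> L2" "\<And>n. v n \<in> conv" "(\<lambda>n. nrm (\<lambda>x. u x - v n x)) \<longlonglongrightarrow> 0"
  shows "u \<in> conv"
proof (rule conv_closed[OF assms(1)])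
  fix \<epsilon> :: real assume "\<epsilon> > 0"
  then show "\<exists>v\<in>conv. nrm (\<lambda>x. u x - v x) < \<epsilon>"
    using LIMSEQ_D[OF assms(3), of \<epsilon>] assms(2) by fastforce
qed

section \<open>Density of the trigonometric polynomials\<close>

inductive_set trig :: "(real \<Rightarrow> complex) set" where
  trig_ek: "e k \<in> trig"
| trig_add: "u \<in> trig \<Longrightarrow> v \<in> trig \<Longrightarrow> (\<lambda>x. u x + v x) \<in> trig"
| trig_cmult: "u \<in> trig \<Longrightarrow> (\<lambda>x. c * u x) \<in> trig"

lemma trig_conv: "u \<in> trig \<Longrightarrow> u \<in> conv"
  by (induction rule: trig.induct) (auto intro: conv_add conv_cmult conv_ek)

lemma trig_mult:
  assumes "u \<in> trig" "v \<in> trig"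
  shows "(\<lambda>x. u x * v x) \<in> trig"
  using assms(1)
proof (induction rule: trig.induct)
  case (trig_ek j)
  show ?case using assms(2)
  proof (induction rule: trig.induct)
    case (trig_ek k)
    then show ?case using trig.trig_ek[of "j + k"] by (simp add: ek_add[abs_def])
  next
    case (trig_add u v)
    then show ?case using trig.trig_add by (simp add: ring_distribs)
  next
    case (trig_cmult u c)
    then show ?case using trig.trig_cmult[of _ c] by (simp add: mult.left_commute)
  qed
next
  case (trig_add u v)
  then show ?case using trig.trig_add by (simp add: ring_distribs)
next
  case (trig_cmult u c)
  then show ?case using trig.trig_cmult[of _ c] by (simp add: mult.assoc)
qed

lemma trig_const: "(\<lambda>x. c) \<in> trig"
  using trig_cmult[OF trig_ek[of 0], of c] by simp

text \<open>Stone-Weierstrass on the circle supplies polynomials in the real and imaginary part of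
  z. On the circle both parts are combinations of \<open>e 1\<close> and its conjugate
  \<open>e (-1)\<close>.\<close>

lemma trig_real_polynomial:
  assumes "real_polynomial_function p"
  shows "(\<lambda>x. complex_of_real (p (e 1 x))) \<in> trig"
  using assms
proof (induction rule: real_polynomial_function.induct)
  case (linear f)
  then interpret bounded_linear f .
  have eq: "f z = Re z * f 1 + Im z * f \<i>" for z
  proof -
    have "f z = f (Re z *\<^sub>R 1 + Im z *\<^sub>R \<i>)" by (rule arg_cong[of _ _ f]) (simp add: complex_eq_iff)
    then show ?thesis by (simp add: add scaleR)
  qed
  have "(\<lambda>x. complex_of_real (f (e 1 x))) =
    (\<lambda>x. (f 1 - \<i> * f \<i>) / 2 * e 1 x + (f 1 + \<i> * f \<i>) / 2 * e (-1) x)"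
  proof
    fix x
    have "complex_of_real (Re z * a + Im z * b) = (a - \<i> * b) / 2 * z + (a + \<i> * b) / 2 * cnj z" for z a b
      by (simp add: complex_eq_iff field_simps)
    then show "complex_of_real (f (e 1 x)) = (f 1 - \<i> * f \<i>) / 2 * e 1 x + (f 1 + \<i> * f \<i>) / 2 * e (-1) x"
      by (simp only: eq[of "e 1 x"] cnj_ek)
  qed
  then show ?case by (simp only:) (intro trig_add trig_cmult trig_ek)
qed (auto intro: trig_const trig_add trig_mult)

lemma conv_continuous_circle:
  fixes g :: "complex \<Rightarrow> complex"
  assumes g: "continuous_on (sphere 0 1) g"
  shows "(\<lambda>x. g (e 1 x)) \<in> conv"
proof (rule conv_closed)
  have c: "continuous_on UNIV (\<lambda>x. g (e 1 x))"
    by (rule continuous_on_compose2[OF g continuous_on_ek]) auto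
  then have meas: "(\<lambda>x. g (e 1 x)) \<in> borel_measurable M"
    by (intro borel_measurable_M borel_measurable_continuous_onI)
  have "compact (g ` sphere 0 1)" using g by (intro compact_continuous_image) auto
  then obtain B where "\<And>z. z \<in> sphere 0 1 \<Longrightarrow> cmod (g z) \<le> B"
    by (meson bounded_iff compact_imp_bounded imageI)
  then show L2: "(\<lambda>x. g (e 1 x)) \<in> L2"
    by (intro L2I_bounded[OF meas, of B]) auto
  fix \<epsilon> :: real assume "\<epsilon> > 0"
  define d where "d = \<epsilon> / (2 * sqrt L)"
  have "d > 0" using \<open>\<epsilon> > 0\<close> L_pos by (simp add: d_def)
  then obtain p where p: "polynomial_function p" "\<And>z. z \<in> sphere 0 1 \<Longrightarrow> cmod (g z - p z) < d"
    using Stone_Weierstrass_polynomial_function[OF _ g, of d] by auto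
  have "real_polynomial_function (\<lambda>z. Re (p z))" "real_polynomial_function (\<lambda>z. Im (p z))"
    using p(1) bounded_linear_Re bounded_linear_Im by (auto simp: polynomial_function_def o_def)
  then have "(\<lambda>x. complex_of_real (Re (p (e 1 x))) + \<i> * complex_of_real (Im (p (e 1 x)))) \<in> trig"
    by (intro trig_add trig_cmult trig_real_polynomial)
  then have tr: "(\<lambda>x. p (e 1 x)) \<in> conv"
    using trig_conv by (simp flip: complex_eq)
  have "nrm (\<lambda>x. g (e 1 x) - p (e 1 x)) \<le> nrm (\<lambda>x. complex_of_real d)"
    using p(2) \<open>d > 0\<close> L2 tr
    by (intro nrm_mono) (auto intro!: L2_intros L2_measurable simp: conv_def less_imp_le)
  also have "\<dots> = d * sqrt L"
    using \<open>d > 0\<close> by (simp add: nrm_def measure_space_M real_sqrt_mult)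
  also have "\<dots> < \<epsilon>" using \<open>\<epsilon> > 0\<close> L_pos by (simp add: d_def)
  finally show "\<exists>v\<in>conv. nrm (\<lambda>x. g (e 1 x) - v x) < \<epsilon>" by (rule bexI[OF _ tr])
qed

lemma nrm_tendsto_dominated:
  assumes meas: "\<And>n. v n \<in> borel_measurable M" and u: "u \<in> L2" and b: "b \<in> L2"
    and lim: "AE x in M. (\<lambda>n. v n x) \<longlonglongrightarrow> u x"
    and bound: "\<And>n. AE x in M. cmod (u x - v n x) \<le> cmod (b x)"
  shows "(\<lambda>n. nrm (\<lambda>x. u x - v n x)) \<longlonglongrightarrow> 0"
proof -
  have "(\<lambda>n. \<integral>x. (cmod (u x - v n x))\<^sup>2 \<partial>M) \<longlonglongrightarrow> (\<integral>x. 0 \<partial>M)"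
  proof (rule integral_dominated_convergence)
    show "integrable M (\<lambda>x. (cmod (b x))\<^sup>2)" by (rule L2_integrable_square[OF b])
    show "AE x in M. (\<lambda>n. (cmod (u x - v n x))\<^sup>2) \<longlonglongrightarrow> 0"
      using lim
    proof eventually_elim
      case (elim x)
      then have "(\<lambda>n. (cmod (u x - v n x))\<^sup>2) \<longlonglongrightarrow> (cmod (u x - u x))\<^sup>2"
        by (intro tendsto_intros)
      then show ?case by simp
    qed
    show "AE x in M. norm ((cmod (u x - v n x))\<^sup>2) \<le> (cmod (b x))\<^sup>2" for n
      using bound[of n] by eventually_elim (auto intro: power_mono)
  qed (use meas u in measurable)
  then have "(\<lambda>n. sqrt (\<integral>x. (cmod (u x - v n x))\<^sup>2 \<partial>M)) \<longlonglongrightarrow> sqrt 0"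
    by (intro tendsto_real_sqrt) simp
  then show ?thesis by (simp add: nrm_def)
qed

text \<open>\<open>measurable_on\<close> presents \<open>u\<close> as an almost everywhere limit of
  continuous functions on the line. They are made bounded, carried to the circle and flattened where
  the circle is cut, so that \<open>conv_continuous_circle\<close> applies and dominated convergence
  gives the limit in \<open>L2\<close>.\<close>

lemma conv_bounded:
  assumes u: "u \<in> borel_measurable M" and B: "\<And>x. cmod (u x) \<le> B" "B > 0"
  shows "u \<in> conv"
proof -
  define u' where "u' x = (if x \<in> {0..L} then u x else 0)" for x
  have "u' \<in> borel_measurable lborel"
  proof -
    have "(\<lambda>x. indicat_real {0..L} x *\<^sub>R u x) = u'" by (auto simp: u'_def indicator_def)
    then show ?thesis using u unfolding M_def by (subst (asm) borel_measurable_restrict_space_iff) auto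
  qed
  then have "u' \<in> borel_measurable lebesgue" by (simp add: measurable_completion)
  then have "u' measurable_on UNIV" by (simp add: lebesgue_measurable_imp_measurable_on)
  then obtain N g where N: "negligible N" and g: "\<And>n. continuous_on UNIV (g n)"
    and lim: "\<And>x. x \<notin> N \<Longrightarrow> (\<lambda>n. g n x) \<longlonglongrightarrow> u' x"
    unfolding measurable_on_def by auto
  \<comment> \<open>The radial retraction onto the ball of radius \<open>B\<close>: it fixes the
    values of \<open>u\<close> and gives the approximants a common bound for the domination.\<close>
  define cl where "cl z = z / complex_of_real (max 1 (cmod z / B))" for z
  have cl_cont: "continuous_on UNIV cl"
    unfolding cl_def by (intro continuous_intros) (use B(2) in \<open>auto simp: max_def\<close>)
  have cl_le: "cmod (cl z) \<le> B" for z
  proof -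
    have "cmod z \<le> B * max 1 (cmod z / B)" using B(2) by (simp add: max_def field_simps)
    then show ?thesis by (simp add: cl_def norm_divide divide_le_eq)
  qed
  have cl_id: "cl z = z" if "cmod z \<le> B" for z
    using that B(2) by (simp add: cl_def max_def)
  \<comment> \<open>\<open>Arg2pi\<close> jumps at 1, the image of both endpoints of the period. The
    factor \<open>min 1 (real n * cmod (z - 1))\<close> vanishes there and tends to 1 at every other
    point.\<close>
  define h where "h n z = cl (g n (L * Arg2pi z / (2 * pi))) * complex_of_real (min 1 (real n * cmod (z - 1)))" for n z
  have h_le: "cmod (h n z) \<le> B * min 1 (real n * cmod (z - 1))" for n z
    unfolding h_def by (simp add: norm_mult mult_right_mono cl_le)
  have "continuous_on (sphere 0 1) (h n)" for n
  proof (rule continuous_at_imp_continuous_on, safe)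
    fix z :: complex assume z: "z \<in> sphere 0 1"
    show "isCont (h n) z"
    proof (cases "z = 1")
      case True
      have "((\<lambda>z. B * min 1 (real n * cmod (z - 1))) \<longlongrightarrow> B * min 1 (real n * cmod (1 - 1))) (at 1)"
        by (intro tendsto_intros)
      then have "((\<lambda>z. B * min 1 (real n * cmod (z - 1))) \<longlongrightarrow> 0) (at 1)" by simp
      then have "(h n \<longlongrightarrow> 0) (at 1)"
        by (rule Lim_null_comparison[rotated]) (simp add: h_le)
      then show ?thesis using True by (simp add: isCont_def h_def)
    next
      case False
      have "z \<notin> \<real>\<^sub>\<ge>\<^sub>0"
        using z False by (auto simp: complex_nonneg_Reals_iff cmod_def complex_eq_iff power2_eq_1_iff)
      then have "isCont Arg2pi z" by (rule continuous_at_Arg2pi)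
      have cont: "isCont (g n) y" "isCont cl y'" for y y'
        using g[of n] cl_cont by (simp_all add: continuous_on_eq_continuous_at)
      have "isCont (\<lambda>z. L * Arg2pi z / (2 * pi)) z"
        using \<open>isCont Arg2pi z\<close> by (intro isCont_divide isCont_mult) auto
      then have "isCont (\<lambda>z. cl (g n (L * Arg2pi z / (2 * pi)))) z"
        by (rule isCont_o2[OF isCont_o2[OF _ cont(1)] cont(2)])
      then show ?thesis
        unfolding h_def by (intro isCont_mult) (auto intro!: continuous_intros)
    qed
  qed
  then have hc: "(\<lambda>x. h n (e 1 x)) \<in> conv" for n by (rule conv_continuous_circle)
  have uL2: "u \<in> L2" using u B by (intro L2I_bounded) auto
  have "(\<lambda>n. nrm (\<lambda>x. u x - h n (e 1 x))) \<longlonglongrightarrow> 0"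
  proof (rule nrm_tendsto_dominated)
    show "(\<lambda>x. h n (e 1 x)) \<in> borel_measurable M" for n
      using hc[of n] by (auto simp: conv_def)
    show "(\<lambda>x. complex_of_real (2 * B)) \<in> L2" by (rule L2_const)
    show "AE x in M. cmod (u x - h n (e 1 x)) \<le> cmod (complex_of_real (2 * B))" for n
    proof (rule AE_I2)
      fix x
      have "cmod (h n (e 1 x)) \<le> B * 1"
        using B(2) by (intro order_trans[OF h_le] mult_left_mono) auto
      then show "cmod (u x - h n (e 1 x)) \<le> cmod (complex_of_real (2 * B))"
        using norm_triangle_ineq4[of "u x" "h n (e 1 x)"] B(1)[of x] B(2) by simp
    qed
    have "N \<in> null_sets lebesgue" using N by (simp add: negligible_iff_null_sets)
    then have "AE x in lborel. x \<notin> N"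
      using AE_not_in AE_completion_iff by blast
    moreover have "AE x in lborel. x \<noteq> 0" "AE x in lborel. x \<noteq> L"
      by (rule AE_lborel_singleton)+
    ultimately have "AE x in lborel. x \<in> {0..L} \<longrightarrow> (\<lambda>n. h n (e 1 x)) \<longlonglongrightarrow> u x"
    proof (eventually_elim, safe)
      fix x assume x: "x \<notin> N" "x \<noteq> 0" "x \<noteq> L" "x \<in> {0..L}"
      have "Arg2pi (e 1 x) = 2 * pi * x / L"
        unfolding ek_def using x L_pos by (intro Arg2pi_unique[of 1]) (auto simp: cis_conv_exp field_simps)
      then have A: "L * Arg2pi (e 1 x) / (2 * pi) = x" using L_pos by simp
      have "e 1 x \<noteq> 1"
      proof
        assume "e 1 x = 1"
        then have "2 * pi * x / L = 0" using \<open>Arg2pi (e 1 x) = 2 * pi * x / L\<close> Arg2pi_of_real[of 1] by simp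
        then show False using x L_pos by auto
      qed
      have "(\<lambda>n. g n x) \<longlonglongrightarrow> u x" using lim[of x] x by (simp add: u'_def)
      then have "(\<lambda>n. cl (g n x)) \<longlonglongrightarrow> cl (u x)"
        using cl_cont by (intro isCont_tendsto_compose[of _ cl]) (simp_all add: continuous_on_eq_continuous_at)
      moreover have "filterlim (\<lambda>n. real n * cmod (e 1 x - 1)) at_top sequentially"
        using \<open>e 1 x \<noteq> 1\<close> filterlim_tendsto_pos_mult_at_top[OF tendsto_const _ filterlim_real_sequentially,
            of "cmod (e 1 x - 1)"] by (simp add: mult.commute)
      then have "\<forall>\<^sub>F n in sequentially. 1 \<le> real n * cmod (e 1 x - 1)"
        by (simp add: filterlim_at_top)
      then have "(\<lambda>n. complex_of_real (min 1 (real n * cmod (e 1 x - 1)))) \<longlonglongrightarrow> 1"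
        by (intro tendsto_eventually, elim eventually_mono) simp
      ultimately have "(\<lambda>n. h n (e 1 x)) \<longlonglongrightarrow> cl (u x) * 1"
        unfolding h_def A by (intro tendsto_mult)
      then show "(\<lambda>n. h n (e 1 x)) \<longlonglongrightarrow> u x" using B by (simp add: cl_id)
    qed
    then show "AE x in M. (\<lambda>n. h n (e 1 x)) \<longlonglongrightarrow> u x" by (simp add: AE_M)
  qed (rule uL2)
  then show ?thesis by (rule conv_sequentially_closed[OF uL2 hc])
qed

theorem P_tendsto:
  assumes u: "u \<in> L2"
  shows "(\<lambda>N. nrm (\<lambda>x. P N u x - u x)) \<longlonglongrightarrow> 0"
proof -
  \<comment> \<open>Truncation in height reduces the claim to bounded functions, with an error
    dominated by \<open>u\<close> itself. The bound passed on below is n + 1 because it has to be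
    positive for n = 0 too.\<close>
  define v where "v n x = (if cmod (u x) \<le> real n then u x else 0)" for n x
  have meas: "v n \<in> borel_measurable M" for n
    unfolding v_def using u by measurable
  have "v n \<in> conv" for n
    by (rule conv_bounded[OF meas, where B = "real n + 1"]) (auto simp: v_def)
  moreover have "(\<lambda>n. nrm (\<lambda>x. u x - v n x)) \<longlonglongrightarrow> 0"
  proof (rule nrm_tendsto_dominated[OF meas u u])
    show "AE x in M. (\<lambda>n. v n x) \<longlonglongrightarrow> u x"
    proof (rule AE_I2)
      fix x
      obtain n0 :: nat where "cmod (u x) \<le> real n0" using real_arch_simple by blast
      then show "(\<lambda>n. v n x) \<longlonglongrightarrow> u x"
        by (intro tendsto_eventually eventually_sequentiallyI[of n0]) (auto simp: v_def)
    qed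
  qed (auto simp: v_def)
  ultimately have "u \<in> conv" by (intro conv_sequentially_closed[OF u])
  then show ?thesis by (simp add: conv_def)
qed

lemma cip_P_tendsto:
  assumes "u \<in> L2" "v \<in> L2"
  shows "(\<lambda>N. cip (P N u) v) \<longlonglongrightarrow> cip u v"
proof -
  have "cmod (cip (P N u) v - cip u v) \<le> nrm (\<lambda>x. P N u x - u x) * nrm v" for N
    using cmod_cip_le[of "\<lambda>x. P N u x - u x" v] assms by (simp add: cip_diff_left L2_intros)
  moreover have "(\<lambda>N. nrm (\<lambda>x. P N u x - u x) * nrm v) \<longlonglongrightarrow> 0"
    using P_tendsto[OF assms(1)] by (rule tendsto_mult_left_zero)
  ultimately have "(\<lambda>N. cip (P N u) v - cip u v) \<longlonglongrightarrow> 0"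
    by (rule Lim_null_comparison[OF always_eventually, OF allI])
  then show ?thesis by (simp add: LIM_zero_iff)
qed

lemma fcoef_eqD:
  assumes "u \<in> L2" "v \<in> L2" "\<And>k. fcoef L u k = fcoef L v k"
  shows "AE x in M. u x = v x"
proof -
  have "P N (\<lambda>x. u x - v x) = (\<lambda>x. 0)" for N
    using assms by (simp add: Pm_def fcoef_diff)
  then have "nrm (\<lambda>x. u x - v x) = 0"
    using P_tendsto[of "\<lambda>x. u x - v x"] assms by (simp add: L2_intros nrm_minus_commute[of v u] LIMSEQ_const_iff)
  then have "AE x in M. u x - v x = 0" using assms by (intro nrm_eq_0_AE L2_intros)
  then show ?thesis by simp
qed

section \<open>Weak derivatives\<close>

definition wd :: "(real \<Rightarrow> complex) \<Rightarrow> (real \<Rightarrow> complex) \<Rightarrow> bool" where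
  "wd u g \<longleftrightarrow> u \<in> L2 \<and> g \<in> L2 \<and> (\<forall>k. fcoef L g k = \<i> * complex_of_real (freq k) * fcoef L u k)"

lemma wd_L2: "wd u g \<Longrightarrow> u \<in> L2" "wd u g \<Longrightarrow> g \<in> L2"
  by (simp_all add: wd_def)

lemma wderiv_imp_wd: "wderiv L u g \<Longrightarrow> wd u g"
  using L2per_subset by (auto simp: wderiv_def wd_def freq_def)

lemma wd_add: "wd u g \<Longrightarrow> wd v h \<Longrightarrow> wd (\<lambda>x. u x + v x) (\<lambda>x. g x + h x)"
  by (simp add: wd_def L2_intros fcoef_add ring_distribs)

lemma wd_diff: "wd u g \<Longrightarrow> wd v h \<Longrightarrow> wd (\<lambda>x. u x - v x) (\<lambda>x. g x - h x)"
  by (simp add: wd_def L2_intros fcoef_diff ring_distribs)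

lemma wd_cmult: "wd u g \<Longrightarrow> wd (\<lambda>x. c * u x) (\<lambda>x. c * g x)"
  by (simp add: wd_def L2_intros fcoef_cmult)

lemma wd_cnj: "wd u g \<Longrightarrow> wd (\<lambda>x. cnj (u x)) (\<lambda>x. cnj (g x))"
  by (simp add: wd_def L2_intros fcoef_cnj freq_def)

lemma wd_P: "wd u g \<Longrightarrow> wd (P m u) (P m g)"
  by (simp add: wd_def L2_intros fcoef_P)

lemma L2_mult_ek [L2_intros]: "u \<in> L2 \<Longrightarrow> (\<lambda>x. u x * e k x) \<in> L2"
  by (rule L2I_bound[where v = u and B = 1]) (auto simp: norm_mult)

lemma freq_diff: "freq (j - k) = freq j - freq k"
  by (simp add: freq_def ring_distribs diff_divide_distrib)

lemma wd_mult_ek: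
  assumes "wd u g"
  shows "wd (\<lambda>x. u x * e k x) (\<lambda>x. g x * e k x + \<i> * freq k * (u x * e k x))"
proof -
  have [simp]: "u \<in> L2" "g \<in> L2" using assms by (auto simp: wd_def)
  have "fcoef L (\<lambda>x. g x * e k x + \<i> * freq k * (u x * e k x)) j
      = fcoef L (\<lambda>x. g x * e k x) j + fcoef L (\<lambda>x. \<i> * freq k * (u x * e k x)) j" for j
    by (rule fcoef_add) (intro L2_intros; simp)+
  then show ?thesis using assms unfolding fcoef_cmult
    by (auto simp add: wd_def fcoef_mult_ek freq_diff ring_distribs intro!: L2_intros)
qed

text \<open>For partial sums this is an identity of coefficients: the factor
  \<open>\<i> * freq k\<close> moves to the other side and changes sign under conjugation.
  Completeness carries it to the limit.\<close>

lemma cip_by_parts: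
  assumes "wd u u'" "wd v v'"
  shows "cip u' v = - cip u v'"
proof -
  have "cip (P N u') v = - cip (P N u) v'" for N
    using assms by (simp add: wd_def cip_P_left mult_ac sum_negf)
  moreover have "(\<lambda>N. cip (P N u') v) \<longlonglongrightarrow> cip u' v" "(\<lambda>N. - cip (P N u) v') \<longlonglongrightarrow> - cip u v'"
    using assms by (auto simp: wd_def intro!: tendsto_minus cip_P_tendsto)
  ultimately show ?thesis using LIMSEQ_unique by auto
qed

lemma ip_by_parts: "wd u u' \<Longrightarrow> wd v v' \<Longrightarrow> ip u' v = - ip u v'"
  by (simp add: ip_def cip_by_parts[of u u' v v'])

text \<open>To test with \<open>e k\<close>, the conjugate of \<open>v\<close> times
  \<open>e k\<close> is taken as second factor in \<open>cip_by_parts\<close>; differentiating its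
  exponential contributes the required factor \<open>\<i> * freq k\<close>. Square integrability of
  the products is a hypothesis here and is supplied in \<open>wd_mult_Bd\<close> by the sup
  bound.\<close>

lemma wd_mult:
  assumes u: "wd u u'" and v: "wd v v'"
    and uv: "(\<lambda>x. u x * v x) \<in> L2" and uv': "(\<lambda>x. u' x * v x + u x * v' x) \<in> L2"
  shows "wd (\<lambda>x. u x * v x) (\<lambda>x. u' x * v x + u x * v' x)"
  unfolding wd_def
proof (intro conjI allI uv uv')
  fix k
  note [simp] = wd_L2[OF u] wd_L2[OF v]
  define y where "y x = cnj (v x) * e k x" for x
  define y' where "y' x = cnj (v' x) * e k x" for x
  have [simp]: "y \<in> L2" "y' \<in> L2" unfolding y_def y'_def by (intro L2_mult_ek L2_cnj; simp)+
  have "wd y (\<lambda>x. y' x + \<i> * freq k * y x)"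
    unfolding y_def y'_def by (intro wd_mult_ek wd_cnj v)
  then have "cip u' y = - cip u (\<lambda>x. y' x + \<i> * freq k * y x)"
    by (rule cip_by_parts[OF u])
  also have "\<dots> = - cip u y' + \<i> * freq k * cip u y"
    by (simp add: cip_add_right L2_intros cip_cmult_right)
  finally have "cip u' y + cip u y' = \<i> * freq k * cip u y" by simp
  moreover have "cip (\<lambda>x. u' x * v x + u x * v' x) (e k) = (\<integral>x. u' x * cnj (y x) + u x * cnj (y' x) \<partial>M)"
    by (simp add: cip_def y_def y'_def algebra_simps)
  then have "cip (\<lambda>x. u' x * v x + u x * v' x) (e k) = cip u' y + cip u y'"
    by (simp add: cip_def)
  moreover have "cip u y = cip (\<lambda>x. u x * v x) (e k)"
    by (simp add: cip_def y_def mult.assoc)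
  ultimately show "fcoef L (\<lambda>x. u' x * v x + u x * v' x) k = \<i> * freq k * fcoef L (\<lambda>x. u x * v x) k"
    by (simp add: fcoef_eq)
qed

lemma nrm_P_tendsto:
  assumes "u \<in> L2"
  shows "(\<lambda>N. nrm (P N u)) \<longlonglongrightarrow> nrm u"
proof -
  have "norm (nrm (P N u) - nrm u) \<le> nrm (\<lambda>x. P N u x - u x)" for N
    using nrm_diff_ge[OF L2_P[of N u] assms] by simp
  then have "(\<lambda>N. nrm (P N u) - nrm u) \<longlonglongrightarrow> 0"
    using P_tendsto[OF assms] by (rule Lim_null_comparison[OF always_eventually, OF allI])
  then show ?thesis by (simp add: LIM_zero_iff)
qed

lemma nrm_P_eq: "u \<in> L2 \<Longrightarrow> (nrm (P N u))\<^sup>2 = L * (\<Sum>k\<in>{-int N..int N}. (cmod (fcoef L u k))\<^sup>2)"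
proof -
  assume u: "u \<in> L2"
  have "complex_of_real ((nrm (P N u))\<^sup>2) = cip (P N u) u"
    using u by (simp add: cip_P_P[symmetric] cip_self)
  also have "\<dots> = complex_of_real (L * (\<Sum>k\<in>{-int N..int N}. (cmod (fcoef L u k))\<^sup>2))"
    using u by (simp add: cip_P_left flip: complex_norm_square)
  finally show ?thesis by (simp only: of_real_eq_iff)
qed

text \<open>Only frequencies with |k| > m survive in the tail, and for them \<open>freq k\<close> is
  at least 2 \<pi> m / L in modulus. The inequality thus holds coefficient by coefficient, and then
  for the norms of all partial sums.\<close>

lemma nrm_tail_le:
  assumes "wd u g"
  shows "2 * pi * real m / L * nrm (\<lambda>x. u x - P m u x) \<le> nrm g"
proof -
  define q where "q x = u x - P m u x" for x
  have [simp]: "u \<in> L2" "g \<in> L2" using assms by (auto simp: wd_def)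
  have [simp]: "q \<in> L2" unfolding q_def by (simp add: L2_intros)
  define c where "c = 2 * pi * real m / L"
  have c: "c \<ge> 0" using L_pos by (simp add: c_def)
  have coef: "(c * cmod (fcoef L q k))\<^sup>2 \<le> (cmod (fcoef L g k))\<^sup>2" for k
  proof (cases "\<bar>k\<bar> \<le> int m")
    case True
    then show ?thesis by (simp add: q_def[abs_def] fcoef_diff L2_P fcoef_P)
  next
    case False
    then have "c \<le> \<bar>freq k\<bar>"
      using L_pos by (auto simp: c_def freq_def abs_mult intro!: divide_right_mono mult_left_mono)
    then show ?thesis using False assms c
      by (auto simp: q_def[abs_def] fcoef_diff L2_P fcoef_P wd_def norm_mult intro!: power_mono mult_right_mono)
  qed
  have "c * nrm (P N q) \<le> nrm g" for N
  proof -
    have "(c * nrm (P N q))\<^sup>2 = L * (\<Sum>k\<in>{-int N..int N}. (c * cmod (fcoef L q k))\<^sup>2)"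
      by (simp add: nrm_P_eq power_mult_distrib sum_distrib_left mult.left_commute)
    also have "\<dots> \<le> L * (\<Sum>k\<in>{-int N..int N}. (cmod (fcoef L g k))\<^sup>2)"
      using L_pos by (intro mult_left_mono sum_mono coef) auto
    also have "\<dots> = (nrm (P N g))\<^sup>2" by (simp add: nrm_P_eq)
    also have "\<dots> \<le> (nrm g)\<^sup>2" by (intro power_mono nrm_P_le) auto
    finally show ?thesis by (rule power2_le_imp_le) simp
  qed
  moreover have "(\<lambda>N. c * nrm (P N q)) \<longlonglongrightarrow> c * nrm q"
    by (intro tendsto_mult_left nrm_P_tendsto) simp
  ultimately have "c * nrm q \<le> nrm g" by (intro LIMSEQ_le_const2) auto
  then show ?thesis by (simp add: c_def q_def[abs_def])
qed

subsection \<open>The one-dimensional Sobolev inequality\<close>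

lemma P_has_vector_derivative:
  assumes "wd u g"
  shows "(P N u has_vector_derivative P N g x) (at x within S)"
proof -
  have "((\<lambda>x. \<Sum>k\<in>{-int N..int N}. fcoef L u k * e k x) has_vector_derivative
     (\<Sum>k\<in>{-int N..int N}. fcoef L u k * (\<i> * freq k * e k x))) (at x within S)"
    by (intro has_vector_derivative_sum has_vector_derivative_mult_right ek_has_vector_derivative)
  moreover have "(\<Sum>k\<in>{-int N..int N}. fcoef L u k * (\<i> * freq k * e k x)) = P N g x"
    using assms by (simp add: Pm_def wd_def mult_ac)
  ultimately show ?thesis by (simp add: Pm_def[abs_def])
qed

lemma continuous_on_P [continuous_intros]: "continuous_on S (P N u)"
  unfolding Pm_def by (intro continuous_intros)

lemma P_oscillation:
  assumes wd: "wd u g" and x: "0 \<le> a" "a \<le> b" "b \<le> L"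
  shows "\<bar>(cmod (P N u b))\<^sup>2 - (cmod (P N u a))\<^sup>2\<bar> \<le> 2 * nrm (P N u) * nrm (P N g)"
proof -
  let ?p = "P N u" and ?p' = "P N g"
  let ?f = "\<lambda>t. 2 * Re (?p' t * cnj (?p t))"
  have "((\<lambda>t. (cmod (?p t))\<^sup>2) has_vector_derivative ?f t) (at t within {a..b})" for t
  proof -
    have "((\<lambda>t. Re (?p t * cnj (?p t))) has_vector_derivative
        Re (?p t * cnj (?p' t) + ?p' t * cnj (?p t))) (at t within {a..b})"
      by (intro bounded_linear.has_vector_derivative[OF bounded_linear_Re] has_vector_derivative_mult
          P_has_vector_derivative[OF wd] bounded_linear.has_vector_derivative[OF bounded_linear_cnj])
    then show ?thesis by (simp add: cmod_power2 power2_eq_square[of "Re _"] power2_eq_square[of "Im _"] algebra_simps)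
  qed
  then have "(cmod (?p b))\<^sup>2 - (cmod (?p a))\<^sup>2 = (\<integral>t. indicator {a..b} t *\<^sub>R ?f t \<partial>lborel)"
    using x by (intro integral_FTC_Icc[symmetric]) (auto intro!: continuous_intros)
  then have "\<bar>(cmod (?p b))\<^sup>2 - (cmod (?p a))\<^sup>2\<bar> \<le> (\<integral>t. \<bar>indicator {a..b} t *\<^sub>R ?f t\<bar> \<partial>lborel)"
    using integral_norm_bound[of lborel "\<lambda>t. indicator {a..b} t *\<^sub>R ?f t"] by simp
  also have "\<dots> \<le> (\<integral>t. indicator {0..L} t *\<^sub>R (2 * (cmod (?p' t) * cmod (?p t))) \<partial>lborel)"
  proof (rule integral_mono)
    have "integrable lborel (\<lambda>t. indicator {a..b} t *\<^sub>R ?f t)"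
      by (rule borel_integrable_compact) (auto intro!: continuous_intros)
    then show "integrable lborel (\<lambda>t. \<bar>indicator {a..b} t *\<^sub>R ?f t\<bar>)" by (rule integrable_abs)
    show "integrable lborel (\<lambda>t. indicator {0..L} t *\<^sub>R (2 * (cmod (?p' t) * cmod (?p t))))"
      by (rule borel_integrable_compact) (auto intro!: continuous_intros)
    show "\<bar>indicat_real {a..b} t *\<^sub>R ?f t\<bar> \<le> indicat_real {0..L} t *\<^sub>R (2 * (cmod (?p' t) * cmod (?p t)))" for t
      using x abs_Re_le_cmod[of "?p' t * cnj (?p t)"]
      by (auto simp: indicator_def norm_mult)
  qed
  also have "\<dots> = (\<integral>t. 2 * (cmod (?p' t) * cmod (?p t)) \<partial>M)"
    using set_integral_M[of "\<lambda>t. 2 * (cmod (?p' t) * cmod (?p t))"]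
    by (simp only: set_lebesgue_integral_def)
  also have "\<dots> = 2 * (\<integral>t. cmod (?p' t) * cmod (?p t) \<partial>M)" by simp
  also have "\<dots> \<le> 2 * (nrm ?p' * nrm ?p)"
    by (intro mult_left_mono integral_norm_mult_le L2_P) auto
  finally show ?thesis by (simp add: mult_ac)
qed

text \<open>The value at \<open>x\<close> exceeds the value at any other point by at most the
  oscillation; integrating over that point replaces its value by the mean over the period.\<close>

lemma P_sup_bound:
  assumes wd: "wd u g" and x: "x \<in> {0..L}"
  shows "(cmod (P N u x))\<^sup>2 \<le> (nrm (P N u))\<^sup>2 / L + 2 * nrm (P N u) * nrm (P N g)"
proof -
  let ?K = "2 * nrm (P N u) * nrm (P N g)"
  have "(cmod (P N u x))\<^sup>2 \<le> (cmod (P N u y))\<^sup>2 + ?K" if "y \<in> {0..L}" for y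
    using P_oscillation[OF wd, of x y N] P_oscillation[OF wd, of y x N] x that
    by (cases "x \<le> y") auto
  then have "(\<integral>y. (cmod (P N u x))\<^sup>2 \<partial>M) \<le> (\<integral>y. (cmod (P N u y))\<^sup>2 + ?K \<partial>M)"
    by (intro integral_mono_AE AE_I2) (auto intro!: L2_integrable_square L2_P)
  then have "L * (cmod (P N u x))\<^sup>2 \<le> (nrm (P N u))\<^sup>2 + L * ?K"
    by (simp add: measure_space_M nrm_square L2_integrable_square L2_P)
  then show ?thesis using L_pos by (simp add: field_simps)
qed

text \<open>Projections do not increase norms, so \<open>P_sup_bound\<close> holds for all partial
  sums with the norms of \<open>u\<close> and \<open>g\<close>. On the finite measure
  \<open>M\<close> convergence in L2 implies convergence in L1, so a subsequence converges almost
  everywhere and hands the bound to \<open>u\<close>.\<close>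

theorem agmon:
  assumes wd: "wd u g"
  shows "AE x in M. (cmod (u x))\<^sup>2 \<le> (nrm u)\<^sup>2 / L + 2 * nrm u * nrm g"
proof -
  have [simp]: "u \<in> L2" "g \<in> L2" using wd by (auto simp: wd_def)
  let ?d = "\<lambda>n x. P n u x - u x"
  have d: "?d n \<in> L2" for n by (simp add: L2_intros)
  have "norm (\<integral>x. norm (?d n x) \<partial>M) \<le> nrm (?d n) * nrm (\<lambda>x. 1)" for n
    using integral_norm_mult_le[OF d[of n] L2_const[of 1]] by simp
  moreover have "(\<lambda>n. nrm (?d n) * nrm (\<lambda>x. 1)) \<longlonglongrightarrow> 0"
    by (intro tendsto_mult_left_zero P_tendsto) simp
  ultimately have "(\<lambda>n. \<integral>x. norm (?d n x) \<partial>M) \<longlonglongrightarrow> 0"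
    by (rule Lim_null_comparison[OF always_eventually, OF allI])
  moreover have "integrable M (?d n)" for n
    using L2_mult_integrable[OF d[of n] L2_const[of 1]] by simp
  ultimately obtain r where r: "strict_mono r" "AE x in M. (\<lambda>n. ?d (r n) x) \<longlonglongrightarrow> 0"
    using tendsto_L1_AE_subseq[of M ?d] by auto
  have bound: "(cmod (P n u x))\<^sup>2 \<le> (nrm u)\<^sup>2 / L + 2 * nrm u * nrm g" if "x \<in> {0..L}" for n x
  proof -
    have "(nrm (P n u))\<^sup>2 / L + 2 * nrm (P n u) * nrm (P n g) \<le> (nrm u)\<^sup>2 / L + 2 * nrm u * nrm g"
      using L_pos by (intro add_mono divide_right_mono power_mono mult_mono nrm_P_le) auto
    with P_sup_bound[OF wd that] show ?thesis by (rule order_trans)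
  qed
  have "AE x in M. x \<in> {0..L}" by (rule AE_I2) simp
  with r(2) show ?thesis
  proof eventually_elim
    case (elim x)
    then have "(\<lambda>n. ?d (r n) x + u x) \<longlonglongrightarrow> 0 + u x" by (intro tendsto_add tendsto_const) auto
    then have "(\<lambda>n. (cmod (P (r n) u x))\<^sup>2) \<longlonglongrightarrow> (cmod (u x))\<^sup>2"
      by (intro tendsto_power tendsto_norm) simp
    then show ?case by (rule LIMSEQ_le_const2) (use bound elim in auto)
  qed
qed

end

section \<open>Two facts about real functions\<close>

text \<open>The weighted excess \<open>(F t - C / \<kappa>) * exp (\<kappa> * t)\<close> is
  nonincreasing, so a positive excess at \<open>s\<close> would grow exponentially towards the past,
  against the upper bound \<open>B\<close>. As \<open>B\<close> is absent from the conclusion, mere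
  boundedness is turned into an explicit bound.\<close>

lemma bounded_ancient_le:
  fixes F :: "real \<Rightarrow> real"
  assumes deriv: "\<And>s. (F has_real_derivative F' s) (at s)"
    and le: "\<And>s. F' s \<le> C - \<kappa> * F s" and \<kappa>: "0 < \<kappa>" and bd: "\<And>s. F s \<le> B"
  shows "F s \<le> C / \<kappa>"
proof (rule ccontr)
  assume "\<not> F s \<le> C / \<kappa>"
  define \<epsilon> where "\<epsilon> = F s - C / \<kappa>"
  have "\<epsilon> > 0" using \<open>\<not> F s \<le> C / \<kappa>\<close> by (simp add: \<epsilon>_def)
  define g where "g t = (F t - C / \<kappa>) * exp (\<kappa> * t)" for t
  have "(g has_real_derivative (F' t + \<kappa> * F t - C) * exp (\<kappa> * t)) (at t)" for t
    unfolding g_def using \<kappa> by (auto intro!: derivative_eq_intros deriv simp: field_simps)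
  moreover have "(F' t + \<kappa> * F t - C) * exp (\<kappa> * t) \<le> 0" for t
    using le[of t] by (simp add: mult_nonpos_nonneg)
  ultimately have "g s \<le> g t" if "t \<le> s" for t
    using that by (intro DERIV_nonpos_imp_nonincreasing[of t s g]) blast+
  then have lower: "\<epsilon> * exp (\<kappa> * (s - t)) \<le> F t - C / \<kappa>" if "t \<le> s" for t
    using that by (simp add: g_def \<epsilon>_def right_diff_distrib exp_diff pos_divide_le_eq)
  have "filterlim (\<lambda>x. \<epsilon> * exp (\<kappa> * x)) at_top at_top"
    using \<open>\<epsilon> > 0\<close> \<kappa>
    by (intro filterlim_tendsto_pos_mult_at_top[OF tendsto_const] filterlim_compose[OF exp_at_top]
        filterlim_ident) auto
  then have "\<forall>\<^sub>F x in at_top. B - C / \<kappa> + 1 \<le> \<epsilon> * exp (\<kappa> * x)"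
    by (simp add: filterlim_at_top)
  then obtain x0 where "\<And>x. x \<ge> x0 \<Longrightarrow> B - C / \<kappa> + 1 \<le> \<epsilon> * exp (\<kappa> * x)"
    by (auto simp: eventually_at_top_linorder)
  from this[of "max x0 0"] lower[of "s - max x0 0"] bd[of "s - max x0 0"] show False by simp
qed

text \<open>The derivatives converge jointly in \<open>(s, h)\<close>, that is, uniformly for
  \<open>s\<close> near \<open>s0\<close> and small \<open>h\<close>. The mean value inequality for
  \<open>F h s - D * s\<close> is then uniform in \<open>h\<close> and survives the pointwise
  limit.\<close>

lemma has_real_derivative_limit:
  fixes F :: "real \<Rightarrow> real \<Rightarrow> real"
  assumes lim: "\<And>s. ((\<lambda>h. F h s) \<longlongrightarrow> F0 s) (at 0)"
    and deriv: "\<And>h s. h \<noteq> 0 \<Longrightarrow> (F h has_real_derivative F' h s) (at s)"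
    and lim': "((\<lambda>(s, h). F' h s) \<longlongrightarrow> D) (nhds s0 \<times>\<^sub>F at 0)"
  shows "(F0 has_real_derivative D) (at s0)"
proof -
  have "((\<lambda>s. (F0 s - F0 s0) / (s - s0)) \<longlongrightarrow> D) (at s0)"
  proof (rule tendstoI)
    fix r :: real assume "0 < r"
    \<comment> \<open>Half of \<open>r\<close>, because the limit in \<open>h\<close> leaves only a
      weak inequality.\<close>
    define \<epsilon> where "\<epsilon> = r / 2"
    have \<epsilon>: "0 < \<epsilon>" "\<epsilon> < r" using \<open>0 < r\<close> by (auto simp: \<epsilon>_def)
    have "\<forall>\<^sub>F p in nhds s0 \<times>\<^sub>F at 0. dist (case p of (s, h) \<Rightarrow> F' h s) D < \<epsilon>"
      by (rule tendstoD[OF lim' \<epsilon>(1)])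
    then obtain P Q where P: "eventually P (nhds s0)" and Q: "eventually Q (at 0)"
      and PQ: "\<And>s h. P s \<Longrightarrow> Q h \<Longrightarrow> dist (F' h s) D < \<epsilon>"
      unfolding eventually_prod_filter by force
    obtain d where d: "d > 0" "\<And>s. dist s s0 < d \<Longrightarrow> P s"
      using P by (auto simp: eventually_nhds_metric)
    have *: "\<bar>F0 s - F0 s0 - D * (s - s0)\<bar> \<le> \<epsilon> * \<bar>s - s0\<bar>" if s: "dist s s0 < d" for s
    proof -
      have "\<bar>F h s - F h s0 - D * (s - s0)\<bar> \<le> \<epsilon> * \<bar>s - s0\<bar>" if h: "Q h" "h \<noteq> 0" for h
      proof -
        have dF: "((\<lambda>s. F h s - D * s) has_real_derivative F' h t - D) (at t)" for t
          by (auto intro!: derivative_eq_intros deriv h)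
        have cl: "norm (F' h t - D) \<le> \<epsilon>" if "t \<in> ball s0 d" for t
          using PQ[OF d(2)[of t] h(1)] that by (simp add: dist_commute dist_real_def)
        have "norm ((F h s - D * s) - (F h s0 - D * s0)) \<le> \<epsilon> * norm (s - s0)"
          using s d(1) by (intro field_differentiable_bound[of "ball s0 d" "\<lambda>s. F h s - D * s" "\<lambda>t. F' h t - D"]
              DERIV_subset[OF dF] cl) (auto simp: dist_commute)
        then show ?thesis by (simp add: algebra_simps)
      qed
      moreover have "\<forall>\<^sub>F h in at 0. Q h \<and> h \<noteq> (0::real)"
        using Q by (simp add: eventually_conj_iff eventually_at_filter)
      ultimately have "\<forall>\<^sub>F h in at 0. \<bar>F h s - F h s0 - D * (s - s0)\<bar> \<le> \<epsilon> * \<bar>s - s0\<bar>"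
        by (auto elim: eventually_mono)
      moreover have "((\<lambda>h. \<bar>F h s - F h s0 - D * (s - s0)\<bar>) \<longlongrightarrow> \<bar>F0 s - F0 s0 - D * (s - s0)\<bar>) (at 0)"
        by (intro tendsto_intros lim)
      ultimately show ?thesis by (intro tendsto_upperbound) auto
    qed
    have "dist ((F0 s - F0 s0) / (s - s0)) D < r" if s: "dist s s0 < d" "s \<noteq> s0" for s
    proof -
      have "\<bar>(F0 s - F0 s0) / (s - s0) - D\<bar> = \<bar>F0 s - F0 s0 - D * (s - s0)\<bar> / \<bar>s - s0\<bar>"
        using s(2) by (simp add: field_simps flip: abs_divide)
      also have "\<dots> \<le> \<epsilon>" using *[OF s(1)] s(2) by (simp add: divide_le_eq)
      finally show ?thesis using \<epsilon>(2) by (simp add: dist_real_def)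
    qed
    then show "\<forall>\<^sub>F s in at s0. dist ((F0 s - F0 s0) / (s - s0)) D < r"
      using d(1) by (auto simp: eventually_at)
  qed
  then show ?thesis by (simp add: has_field_derivative_iff)
qed

context period
begin

section \<open>Convergence of bounded and of square integrable functions\<close>

definition Bd :: "(real \<Rightarrow> complex) \<Rightarrow> bool" where
  "Bd u \<longleftrightarrow> u \<in> borel_measurable M \<and> (\<exists>B. AE x in M. cmod (u x) \<le> B)"

lemma BdE:
  assumes "Bd u"
  obtains B where "u \<in> borel_measurable M" "0 \<le> B" "AE x in M. cmod (u x) \<le> B"
proof -
  from assms obtain B where B: "u \<in> borel_measurable M" "AE x in M. cmod (u x) \<le> B" by (auto simp: Bd_def)
  have "AE x in M. cmod (u x) \<le> max 0 B" using B(2) by eventually_elim simp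
  with B(1) show ?thesis by (intro that[of "max 0 B"]) auto
qed

lemma BdI: "u \<in> borel_measurable M \<Longrightarrow> (AE x in M. cmod (u x) \<le> B) \<Longrightarrow> Bd u"
  by (auto simp: Bd_def)

named_theorems Bd_intros

lemma Bd_const [Bd_intros]: "Bd (\<lambda>x. c)"
  by (rule BdI[of _ "cmod c"]) auto

lemma Bd_add [Bd_intros]:
  assumes "Bd u" "Bd v" shows "Bd (\<lambda>x. u x + v x)"
proof -
  obtain B C where B: "u \<in> borel_measurable M" "AE x in M. cmod (u x) \<le> B"
    and C: "v \<in> borel_measurable M" "AE x in M. cmod (v x) \<le> C"
    using assms by (auto simp: Bd_def)
  have "AE x in M. cmod (u x + v x) \<le> B + C"
    using B(2) C(2) by eventually_elim (rule norm_triangle_mono)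
  then show ?thesis using B C by (intro BdI) auto
qed

lemma Bd_mult [Bd_intros]:
  assumes "Bd u" "Bd v" shows "Bd (\<lambda>x. u x * v x)"
proof -
  obtain B C where B: "u \<in> borel_measurable M" "0 \<le> B" "AE x in M. cmod (u x) \<le> B"
    and C: "v \<in> borel_measurable M" "0 \<le> C" "AE x in M. cmod (v x) \<le> C"
    using assms by (metis BdE)
  have "AE x in M. cmod (u x * v x) \<le> B * C"
    using B(3) C(3) by eventually_elim (use B(2) in \<open>auto simp: norm_mult intro!: mult_mono\<close>)
  then show ?thesis using B C by (intro BdI) auto
qed

lemma Bd_cnj [Bd_intros]: "Bd u \<Longrightarrow> Bd (\<lambda>x. cnj (u x))"
  by (auto simp: Bd_def)

lemma Bd_minus [Bd_intros]: "Bd u \<Longrightarrow> Bd (\<lambda>x. - u x)"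
  by (auto simp: Bd_def)

lemma Bd_diff [Bd_intros]: "Bd u \<Longrightarrow> Bd v \<Longrightarrow> Bd (\<lambda>x. u x - v x)"
  using Bd_add[OF _ Bd_minus, of u v] by simp

lemma Bd_L2: "Bd u \<Longrightarrow> u \<in> L2"
  by (auto simp: Bd_def intro: L2I_bounded)

lemma L2_Bd_mult [L2_intros]: "Bd u \<Longrightarrow> v \<in> L2 \<Longrightarrow> (\<lambda>x. u x * v x) \<in> L2"
proof -
  assume "Bd u" and v: "v \<in> L2"
  then obtain B where B: "u \<in> borel_measurable M" "AE x in M. cmod (u x) \<le> B" by (auto simp: Bd_def)
  have "AE x in M. cmod (u x * v x) \<le> B * cmod (v x)"
    using B(2) by eventually_elim (simp add: norm_mult mult_right_mono)
  then show ?thesis using B v by (intro L2I_bound[OF _ v]) auto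
qed

lemma L2_mult_Bd [L2_intros]: "v \<in> L2 \<Longrightarrow> Bd u \<Longrightarrow> (\<lambda>x. v x * u x) \<in> L2"
  using L2_Bd_mult[of u v] by (simp add: mult.commute)

lemma wd_Bd: "wd u g \<Longrightarrow> Bd u"
proof (rule BdI)
  assume "wd u g"
  then show "u \<in> borel_measurable M" by (auto simp: wd_def)
  show "AE x in M. cmod (u x) \<le> sqrt ((nrm u)\<^sup>2 / L + 2 * nrm u * nrm g)"
    using agmon[OF \<open>wd u g\<close>] by eventually_elim (rule real_le_rsqrt)
qed

lemma wd_mult_Bd:
  assumes "wd u u'" "wd v v'"
  shows "wd (\<lambda>x. u x * v x) (\<lambda>x. u' x * v x + u x * v' x)"
  using assms wd_Bd[OF assms(1)] wd_Bd[OF assms(2)] wd_L2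
  by (intro wd_mult L2_intros) auto

section \<open>Convergence in the mean and uniform convergence along a filter\<close>

definition cvL2 :: "'a filter \<Rightarrow> ('a \<Rightarrow> real \<Rightarrow> complex) \<Rightarrow> (real \<Rightarrow> complex) \<Rightarrow> bool" where
  "cvL2 F u u0 \<longleftrightarrow> (\<forall>t. u t \<in> L2) \<and> u0 \<in> L2 \<and> ((\<lambda>t. nrm (\<lambda>x. u t x - u0 x)) \<longlongrightarrow> 0) F"

text \<open>Uniform convergence up to null sets, with a majorant \<epsilon> in place of the
  essential supremum. The filter is arbitrary because the same rules serve \<open>at s\<close>,
  \<open>nhds s\<close> and the product filter of time and step.\<close>

definition cvB :: "'a filter \<Rightarrow> ('a \<Rightarrow> real \<Rightarrow> complex) \<Rightarrow> (real \<Rightarrow> complex) \<Rightarrow> bool" where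
  "cvB F u u0 \<longleftrightarrow> (\<forall>t. Bd (u t)) \<and> Bd u0 \<and>
    (\<exists>\<epsilon>. (\<epsilon> \<longlongrightarrow> 0) F \<and> (\<forall>t. 0 \<le> \<epsilon> t \<and> (AE x in M. cmod (u t x - u0 x) \<le> \<epsilon> t)))"

lemma cvL2_bound:
  assumes "\<And>t. u t \<in> L2" "u0 \<in> L2" "\<And>t. nrm (\<lambda>x. u t x - u0 x) \<le> b t" "(b \<longlongrightarrow> 0) F"
  shows "cvL2 F u u0"
  unfolding cvL2_def using assms
  by (auto intro!: Lim_null_comparison[OF always_eventually, OF allI, of _ b])

named_theorems cv_intros

lemma cvL2_const [cv_intros]: "u \<in> L2 \<Longrightarrow> cvL2 F (\<lambda>t. u) u"
  by (simp add: cvL2_def)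

lemma cvB_const [cv_intros]: "Bd u \<Longrightarrow> cvB F (\<lambda>t. u) u"
  by (auto simp: cvB_def intro!: exI[of _ "\<lambda>t. 0"])

lemma cvL2_add [cv_intros]:
  assumes "cvL2 F u u0" "cvL2 F v v0"
  shows "cvL2 F (\<lambda>t x. u t x + v t x) (\<lambda>x. u0 x + v0 x)"
proof (rule cvL2_bound)
  show "nrm (\<lambda>x. u t x + v t x - (u0 x + v0 x)) \<le> nrm (\<lambda>x. u t x - u0 x) + nrm (\<lambda>x. v t x - v0 x)" for t
    using nrm_triangle[of "\<lambda>x. u t x - u0 x" "\<lambda>x. v t x - v0 x"] assms
    by (simp add: cvL2_def L2_intros add_diff_add)
qed (use assms in \<open>auto simp: cvL2_def L2_intros intro!: tendsto_add_zero\<close>)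

lemma cvL2_cmult [cv_intros]:
  assumes "cvL2 F u u0"
  shows "cvL2 F (\<lambda>t x. c * u t x) (\<lambda>x. c * u0 x)"
  using assms
  by (auto simp: cvL2_def L2_intros nrm_cmult tendsto_mult_right_zero simp flip: right_diff_distrib)

lemma cvL2_minus [cv_intros]: "cvL2 F u u0 \<Longrightarrow> cvL2 F (\<lambda>t x. - u t x) (\<lambda>x. - u0 x)"
  using cvL2_cmult[of F u u0 "-1"] by simp

lemma cvL2_diff [cv_intros]:
  "cvL2 F u u0 \<Longrightarrow> cvL2 F v v0 \<Longrightarrow> cvL2 F (\<lambda>t x. u t x - v t x) (\<lambda>x. u0 x - v0 x)"
  using cvL2_add[OF _ cvL2_minus, of F u u0 v v0] by simp

lemma cvL2_cnj [cv_intros]: "cvL2 F u u0 \<Longrightarrow> cvL2 F (\<lambda>t x. cnj (u t x)) (\<lambda>x. cnj (u0 x))"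
proof -
  have "nrm (\<lambda>x. cnj (u t x) - cnj (u0 x)) = nrm (\<lambda>x. u t x - u0 x)" for t
    unfolding nrm_def by (simp flip: complex_cnj_diff)
  then show "cvL2 F u u0 \<Longrightarrow> cvL2 F (\<lambda>t x. cnj (u t x)) (\<lambda>x. cnj (u0 x))"
    by (simp add: cvL2_def L2_intros)
qed

lemma cvL2_P [cv_intros]:
  assumes "cvL2 F u u0"
  shows "cvL2 F (\<lambda>t. P m (u t)) (P m u0)"
proof (rule cvL2_bound)
  show "nrm (\<lambda>x. P m (u t) x - P m u0 x) \<le> nrm (\<lambda>x. u t x - u0 x)" for t
    using nrm_P_le[of "\<lambda>x. u t x - u0 x" m] assms by (simp add: cvL2_def P_diff L2_diff)
  show "((\<lambda>t. nrm (\<lambda>x. u t x - u0 x)) \<longlongrightarrow> 0) F"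
    using assms by (simp add: cvL2_def)
qed (rule L2_P)+

lemma cvBD:
  assumes "cvB F u u0"
  shows "\<exists>\<epsilon> B. (\<forall>t. Bd (u t)) \<and> Bd u0 \<and> (\<epsilon> \<longlongrightarrow> 0) F \<and> (\<forall>t. 0 \<le> \<epsilon> t) \<and>
    (\<forall>t. AE x in M. cmod (u t x - u0 x) \<le> \<epsilon> t) \<and> 0 \<le> B \<and> (AE x in M. cmod (u0 x) \<le> B)"
proof -
  from assms have "Bd u0" by (simp add: cvB_def)
  then obtain B where "u0 \<in> borel_measurable M" "0 \<le> B" "AE x in M. cmod (u0 x) \<le> B"
    by (rule BdE)
  with assms show ?thesis unfolding cvB_def by blast
qed

lemma cvB_add [cv_intros]:
  assumes "cvB F u u0" "cvB F v v0"
  shows "cvB F (\<lambda>t x. u t x + v t x) (\<lambda>x. u0 x + v0 x)"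
proof -
  obtain \<epsilon> where e: "\<And>t. Bd (u t)" "Bd u0" "(\<epsilon> \<longlongrightarrow> 0) F" "\<And>t. 0 \<le> \<epsilon> t"
    "\<And>t. AE x in M. cmod (u t x - u0 x) \<le> \<epsilon> t" using assms(1) by (auto simp: cvB_def)
  obtain \<delta> where d: "\<And>t. Bd (v t)" "Bd v0" "(\<delta> \<longlongrightarrow> 0) F" "\<And>t. 0 \<le> \<delta> t"
    "\<And>t. AE x in M. cmod (v t x - v0 x) \<le> \<delta> t" using assms(2) by (auto simp: cvB_def)
  have "AE x in M. cmod (u t x + v t x - (u0 x + v0 x)) \<le> \<epsilon> t + \<delta> t" for t
    using e(5)[of t] d(5)[of t]
    by eventually_elim (metis add_diff_add norm_triangle_mono)
  then show ?thesis
    unfolding cvB_def using e d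
    by (auto intro!: Bd_intros exI[of _ "\<lambda>t. \<epsilon> t + \<delta> t"] tendsto_add_zero)
qed

lemma cvB_mult [cv_intros]:
  assumes "cvB F u u0" "cvB F v v0"
  shows "cvB F (\<lambda>t x. u t x * v t x) (\<lambda>x. u0 x * v0 x)"
proof -
  obtain \<epsilon> B where e: "\<And>t. Bd (u t)" "Bd u0" "(\<epsilon> \<longlongrightarrow> 0) F" "\<And>t. 0 \<le> \<epsilon> t"
    "\<And>t. AE x in M. cmod (u t x - u0 x) \<le> \<epsilon> t" "0 \<le> B" "AE x in M. cmod (u0 x) \<le> B"
    using cvBD[OF assms(1)] by auto
  obtain \<delta> C where d: "\<And>t. Bd (v t)" "Bd v0" "(\<delta> \<longlongrightarrow> 0) F" "\<And>t. 0 \<le> \<delta> t"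
    "\<And>t. AE x in M. cmod (v t x - v0 x) \<le> \<delta> t" "0 \<le> C" "AE x in M. cmod (v0 x) \<le> C"
    using cvBD[OF assms(2)] by auto
  have "AE x in M. cmod (u t x * v t x - u0 x * v0 x) \<le> \<epsilon> t * \<delta> t + \<epsilon> t * C + B * \<delta> t" for t
    using e(5)[of t] d(5)[of t] e(7) d(7)
  proof eventually_elim
    case (elim x)
    have "cmod (u t x * v t x - u0 x * v0 x)
        = cmod ((u t x - u0 x) * (v t x - v0 x) + (u t x - u0 x) * v0 x + u0 x * (v t x - v0 x))"
      by (simp add: algebra_simps)
    also have "\<dots> \<le> \<epsilon> t * \<delta> t + \<epsilon> t * C + B * \<delta> t"
      using elim e(4)[of t] e(6)
      by (intro norm_triangle_mono) (auto simp: norm_mult intro!: mult_mono)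
    finally show ?case .
  qed
  moreover have "((\<lambda>t. \<epsilon> t * \<delta> t + \<epsilon> t * C + B * \<delta> t) \<longlongrightarrow> 0 * 0 + 0 * C + B * 0) F"
    by (intro tendsto_intros e d)
  moreover have "0 \<le> \<epsilon> t * \<delta> t + \<epsilon> t * C + B * \<delta> t" for t
    by (intro add_nonneg_nonneg mult_nonneg_nonneg e d)
  ultimately show ?thesis
    unfolding cvB_def
    by (intro conjI allI Bd_intros e(1,2) d(1,2) exI[of _ "\<lambda>t. \<epsilon> t * \<delta> t + \<epsilon> t * C + B * \<delta> t"]) auto
qed

lemma cvB_cnj [cv_intros]: "cvB F u u0 \<Longrightarrow> cvB F (\<lambda>t x. cnj (u t x)) (\<lambda>x. cnj (u0 x))"
  by (simp add: cvB_def Bd_cnj flip: complex_cnj_diff)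

lemma cvL2_Bd_mult [cv_intros]:
  assumes "cvB F u u0" "cvL2 F v v0"
  shows "cvL2 F (\<lambda>t x. u t x * v t x) (\<lambda>x. u0 x * v0 x)"
proof -
  obtain \<epsilon> B where e: "\<And>t. Bd (u t)" "Bd u0" "(\<epsilon> \<longlongrightarrow> 0) F" "\<And>t. 0 \<le> \<epsilon> t"
    "\<And>t. AE x in M. cmod (u t x - u0 x) \<le> \<epsilon> t" "0 \<le> B" "AE x in M. cmod (u0 x) \<le> B"
    using cvBD[OF assms(1)] by auto
  have v [simp]: "v t \<in> L2" "v0 \<in> L2" for t using assms(2) by (auto simp: cvL2_def)
  have vd: "(\<lambda>x. v t x - v0 x) \<in> L2" for t by (intro L2_intros v)
  have ud: "Bd (\<lambda>x. u t x - u0 x)" for t by (intro Bd_intros e)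
  have "nrm (\<lambda>x. u t x * v t x - u0 x * v0 x)
      \<le> \<epsilon> t * nrm (\<lambda>x. v t x - v0 x) + \<epsilon> t * nrm v0 + B * nrm (\<lambda>x. v t x - v0 x)" for t
  proof -
    have "nrm (\<lambda>x. u t x * v t x - u0 x * v0 x)
        = nrm (\<lambda>x. ((u t x - u0 x) * (v t x - v0 x) + (u t x - u0 x) * v0 x) + u0 x * (v t x - v0 x))"
      by (simp add: algebra_simps)
    also have "\<dots> \<le> (nrm (\<lambda>x. (u t x - u0 x) * (v t x - v0 x)) + nrm (\<lambda>x. (u t x - u0 x) * v0 x))
        + nrm (\<lambda>x. u0 x * (v t x - v0 x))"
      by (intro order_trans[OF nrm_triangle] add_right_mono nrm_triangle L2_intros ud vd e v)
    also have "\<dots> \<le> (\<epsilon> t * nrm (\<lambda>x. v t x - v0 x) + \<epsilon> t * nrm v0) + B * nrm (\<lambda>x. v t x - v0 x)"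
    proof -
      have m: "(\<lambda>x. u t x - u0 x) \<in> borel_measurable M" "u0 \<in> borel_measurable M"
        using ud[of t] e(2) by (simp_all only: Bd_def)
      show ?thesis
        by (intro add_mono nrm_mult_le[OF m(1) e(5) vd e(4)] nrm_mult_le[OF m(1) e(5) v(2) e(4)]
            nrm_mult_le[OF m(2) e(7) vd e(6)])
    qed
    finally show ?thesis .
  qed
  moreover have "((\<lambda>t. \<epsilon> t * nrm (\<lambda>x. v t x - v0 x) + \<epsilon> t * nrm v0 + B * nrm (\<lambda>x. v t x - v0 x)) \<longlongrightarrow>
      0 * 0 + 0 * nrm v0 + B * 0) F"
    using assms(2) by (intro tendsto_add tendsto_mult tendsto_const e) (simp_all add: cvL2_def)
  then have "((\<lambda>t. \<epsilon> t * nrm (\<lambda>x. v t x - v0 x) + \<epsilon> t * nrm v0 + B * nrm (\<lambda>x. v t x - v0 x)) \<longlongrightarrow> 0) F"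
    by simp
  ultimately show ?thesis
    by (intro cvL2_bound L2_Bd_mult e v)
qed

lemma cvL2_mult_Bd [cv_intros]:
  "cvL2 F v v0 \<Longrightarrow> cvB F u u0 \<Longrightarrow> cvL2 F (\<lambda>t x. v t x * u t x) (\<lambda>x. v0 x * u0 x)"
  using cvL2_Bd_mult[of F u u0 v v0] by (simp add: mult.commute)

lemma cvB_imp_cvL2: "cvB F u u0 \<Longrightarrow> cvL2 F u u0"
  using cvL2_mult_Bd[OF cvL2_const[OF L2_const[of 1]], of F u u0] by simp

lemma cvL2_ip:
  assumes "cvL2 F u u0" "cvL2 F v v0"
  shows "((\<lambda>t. ip (u t) (v t)) \<longlongrightarrow> ip u0 v0) F"
proof -
  have [simp]: "u t \<in> L2" "v t \<in> L2" "u0 \<in> L2" "v0 \<in> L2" for t using assms by (auto simp: cvL2_def)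
  let ?a = "\<lambda>t. nrm (\<lambda>x. u t x - u0 x)" and ?b = "\<lambda>t. nrm (\<lambda>x. v t x - v0 x)"
  have "norm (ip (u t) (v t) - ip u0 v0) \<le> ?a t * ?b t + ?a t * nrm v0 + nrm u0 * ?b t" for t
  proof -
    have "norm (ip (u t) (v t) - ip u0 v0) = norm (ip (\<lambda>x. u t x - u0 x) (\<lambda>x. v t x - v0 x)
        + ip (\<lambda>x. u t x - u0 x) v0 + ip u0 (\<lambda>x. v t x - v0 x))"
      by (simp add: ip_diff_left ip_diff_right L2_intros)
    also have "\<dots> \<le> ?a t * ?b t + ?a t * nrm v0 + nrm u0 * ?b t"
      by (intro norm_triangle_mono) (auto intro!: abs_ip_le L2_intros)
    finally show ?thesis .
  qed
  moreover have "((\<lambda>t. ?a t * ?b t + ?a t * nrm v0 + nrm u0 * ?b t) \<longlongrightarrow> 0 * 0 + 0 * nrm v0 + nrm u0 * 0) F"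
    using assms by (intro tendsto_add tendsto_mult tendsto_const) (simp_all add: cvL2_def)
  then have "((\<lambda>t. ?a t * ?b t + ?a t * nrm v0 + nrm u0 * ?b t) \<longlongrightarrow> 0) F" by simp
  ultimately have "((\<lambda>t. ip (u t) (v t) - ip u0 v0) \<longlongrightarrow> 0) F"
    by (rule Lim_null_comparison[OF always_eventually, OF allI])
  then show ?thesis by (simp add: LIM_zero_iff)
qed

lemma cvL2_cong_AE:
  assumes "cvL2 F u u0" "\<And>t. u' t \<in> L2" "u0' \<in> L2"
    "\<And>t. AE x in M. u' t x = u t x" "AE x in M. u0' x = u0 x"
  shows "cvL2 F u' u0'"
proof -
  have "nrm (\<lambda>x. u' t x - u0' x) = nrm (\<lambda>x. u t x - u0 x)" for t
  proof (rule nrm_cong_AE)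
    show "AE x in M. u' t x - u0' x = u t x - u0 x"
      using assms(4)[of t] assms(5) by eventually_elim simp
  qed (use assms in \<open>auto simp: cvL2_def L2_intros\<close>)
  then show ?thesis using assms by (simp add: cvL2_def)
qed

lemma cvL2_compose: "cvL2 F u u0 \<Longrightarrow> filterlim p F G \<Longrightarrow> cvL2 G (\<lambda>t. u (p t)) u0"
  by (auto simp: cvL2_def intro: filterlim_compose[of _ "nhds 0" F])

lemma cvL2_nhds: "cvL2 (at s) w (w s) \<Longrightarrow> cvL2 (nhds s) w (w s)"
  using tendsto_at_iff_tendsto_nhds[of "\<lambda>t. nrm (\<lambda>x. w t x - w s x)" s] by (simp add: cvL2_def)

text \<open>The sup bound \<open>agmon\<close>, applied to differences, upgrades convergence of a
  function and its derivative in the mean to uniform convergence.\<close>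

lemma cvB_wd:
  assumes wd: "\<And>t. wd (u t) (g t)" "wd u0 g0" and cv: "cvL2 F u u0" "cvL2 F g g0"
  shows "cvB F u u0"
proof -
  let ?a = "\<lambda>t. nrm (\<lambda>x. u t x - u0 x)" and ?b = "\<lambda>t. nrm (\<lambda>x. g t x - g0 x)"
  let ?\<epsilon> = "\<lambda>t. sqrt ((?a t)\<^sup>2 / L + 2 * ?a t * ?b t)"
  have "(?\<epsilon> \<longlongrightarrow> sqrt (0\<^sup>2 / L + 2 * 0 * 0)) F"
    using cv L_pos by (intro tendsto_intros) (auto simp: cvL2_def)
  moreover have "AE x in M. cmod (u t x - u0 x) \<le> ?\<epsilon> t" for t
    using agmon[OF wd_diff[OF wd(1)[of t] wd(2)]] by eventually_elim (rule real_le_rsqrt)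
  ultimately show ?thesis
    unfolding cvB_def using wd L_pos by (auto intro: wd_Bd intro!: exI[of _ ?\<epsilon>])
qed

text \<open>By parts, the squared norm of a first derivative is at most the norm of the function
  times that of the second derivative. Applied to differences, this makes \<open>w1\<close>
  continuous in time once \<open>w\<close> and \<open>w2\<close> are.\<close>

lemma cvL2_interpolate:
  assumes wd: "\<And>t. wd (u t) (g t)" "wd u0 g0" "\<And>t. wd (g t) (h t)" "wd g0 h0"
    and cv: "cvL2 F u u0" "cvL2 F h h0"
  shows "cvL2 F g g0"
proof (rule cvL2_bound)
  let ?a = "\<lambda>t. nrm (\<lambda>x. u t x - u0 x)" and ?b = "\<lambda>t. nrm (\<lambda>x. h t x - h0 x)"
  show "nrm (\<lambda>x. g t x - g0 x) \<le> sqrt (?a t * ?b t)" for t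
  proof (rule real_le_rsqrt)
    have "(nrm (\<lambda>x. g t x - g0 x))\<^sup>2 = - ip (\<lambda>x. u t x - u0 x) (\<lambda>x. h t x - h0 x)"
      unfolding ip_self[symmetric] by (rule ip_by_parts) (intro wd_diff wd)+
    also have "\<dots> \<le> ?a t * ?b t"
      using abs_ip_le[of "\<lambda>x. u t x - u0 x" "\<lambda>x. h t x - h0 x"] cv by (simp add: cvL2_def L2_intros)
    finally show "(nrm (\<lambda>x. g t x - g0 x))\<^sup>2 \<le> ?a t * ?b t" .
  qed
  have "((\<lambda>t. sqrt (?a t * ?b t)) \<longlongrightarrow> sqrt (0 * 0)) F"
    using cv by (intro tendsto_intros) (auto simp: cvL2_def)
  then show "((\<lambda>t. sqrt (?a t * ?b t)) \<longlongrightarrow> 0) F" by simp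
qed (use wd in \<open>auto simp: wd_def\<close>)

section \<open>Differentiation in time\<close>

text \<open>At t = s division by zero makes the quotient the zero function; the family thus stays in
  \<open>L2\<close> for every t, as \<open>cvL2\<close> demands, and \<open>at s\<close> ignores
  this member.\<close>

definition Dt :: "(real \<Rightarrow> real \<Rightarrow> complex) \<Rightarrow> (real \<Rightarrow> complex) \<Rightarrow> real \<Rightarrow> bool" where
  "Dt w z s \<longleftrightarrow> (\<forall>t. w t \<in> L2) \<and> cvL2 (at s) (\<lambda>t x. (w t x - w s x) / complex_of_real (t - s)) z"

lemma Dt_const: "u \<in> L2 \<Longrightarrow> Dt (\<lambda>s. u) (\<lambda>x. 0) s"
  by (auto simp: Dt_def intro!: cv_intros L2_const)

lemma Dt_cmult:
  assumes "Dt w z s" shows "Dt (\<lambda>t x. c * w t x) (\<lambda>x. c * z x) s"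
proof -
  have "cvL2 (at s) (\<lambda>t x. c * ((w t x - w s x) / complex_of_real (t - s))) (\<lambda>x. c * z x)"
    using assms unfolding Dt_def by (intro cvL2_cmult) blast
  moreover have "(\<lambda>t x. c * ((w t x - w s x) / complex_of_real (t - s)))
      = (\<lambda>t x. (c * w t x - c * w s x) / complex_of_real (t - s))"
    by (simp add: fun_eq_iff right_diff_distrib diff_divide_distrib)
  ultimately show ?thesis using assms unfolding Dt_def by (auto intro: L2_intros)
qed

lemma Dt_diff:
  assumes "Dt w z s" "Dt v y s" shows "Dt (\<lambda>t x. w t x - v t x) (\<lambda>x. z x - y x) s"
proof -
  have "cvL2 (at s) (\<lambda>t x. (w t x - w s x) / complex_of_real (t - s) - (v t x - v s x) / complex_of_real (t - s))
      (\<lambda>x. z x - y x)"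
    using assms unfolding Dt_def by (intro cvL2_diff) blast+
  moreover have "(\<lambda>t x. (w t x - w s x) / complex_of_real (t - s) - (v t x - v s x) / complex_of_real (t - s))
      = (\<lambda>t x. (w t x - v t x - (w s x - v s x)) / complex_of_real (t - s))"
    by (simp add: fun_eq_iff diff_divide_distrib)
  ultimately show ?thesis using assms unfolding Dt_def by (auto intro: L2_intros)
qed

lemma Dt_cvL2:
  assumes "Dt w z s"
  shows "cvL2 (at s) w (w s)"
proof (rule cvL2_bound)
  let ?D = "\<lambda>t x. (w t x - w s x) / complex_of_real (t - s)"
  have D: "cvL2 (at s) ?D z" and w: "\<And>t. w t \<in> L2" using assms by (auto simp: Dt_def)
  have z: "z \<in> L2" using D by (simp add: cvL2_def)
  show "nrm (\<lambda>x. w t x - w s x) \<le> \<bar>t - s\<bar> * (nrm (\<lambda>x. ?D t x - z x) + nrm z)" for t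
  proof -
    have "nrm (\<lambda>x. w t x - w s x) = \<bar>t - s\<bar> * nrm (?D t)"
      by (cases "t = s") (simp_all add: nrm_divide flip: of_real_diff)
    also have "\<dots> \<le> \<bar>t - s\<bar> * (nrm (\<lambda>x. ?D t x - z x) + nrm z)"
      using nrm_triangle[of "\<lambda>x. ?D t x - z x" z] w z by (intro mult_left_mono) (simp_all add: L2_intros)
    finally show ?thesis .
  qed
  have "((\<lambda>t. \<bar>t - s\<bar> * (nrm (\<lambda>x. ?D t x - z x) + nrm z)) \<longlongrightarrow> \<bar>s - s\<bar> * (0 + nrm z)) (at s)"
    using D by (intro tendsto_intros) (auto simp: cvL2_def)
  then show "((\<lambda>t. \<bar>t - s\<bar> * (nrm (\<lambda>x. ?D t x - z x) + nrm z)) \<longlongrightarrow> 0) (at s)" by simp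
qed (use assms in \<open>auto simp: Dt_def\<close>)

text \<open>\<open>G\<close> acts as a discrete gradient of the functional \<open>J\<close>. Only
  increments of \<open>w\<close> itself occur, so norms of spatial derivatives can be differentiated
  in time once integration by parts has brought their increments into this form.\<close>

lemma Dt_functional:
  assumes w: "Dt w z s" and J: "\<And>t. J t - J s = ip (G t) (\<lambda>x. w t x - w s x)"
    and G: "cvL2 (at s) G G0"
  shows "(J has_real_derivative ip G0 z) (at s)"
proof -
  have "(J t - J s) / (t - s) = ip (G t) (\<lambda>x. (w t x - w s x) / complex_of_real (t - s))" for t
    using ip_cmult_right[of "G t" "inverse (t - s)" "\<lambda>x. w t x - w s x"]
    by (simp add: J divide_inverse mult.commute flip: of_real_diff of_real_inverse)
  moreover have "((\<lambda>t. ip (G t) (\<lambda>x. (w t x - w s x) / complex_of_real (t - s))) \<longlongrightarrow> ip G0 z) (at s)"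
    using w G by (intro cvL2_ip) (auto simp: Dt_def)
  ultimately show ?thesis by (simp add: has_field_derivative_iff)
qed

lemma Dt_ip:
  assumes w: "Dt w z s" and v: "Dt v y s"
  shows "((\<lambda>t. ip (w t) (v t)) has_real_derivative ip z (v s) + ip (w s) y) (at s)"
proof -
  have [simp]: "w t \<in> L2" "v t \<in> L2" for t using w v by (auto simp: Dt_def)
  have "((\<lambda>t. ip (w t) (v s)) has_real_derivative ip (v s) z) (at s)"
    by (rule Dt_functional[OF w, where G = "\<lambda>t. v s"])
      (simp_all add: ip_diff_right ip_commute[of _ "v s"] cvL2_const)
  moreover have "((\<lambda>t. ip (w t) (v t) - ip (w t) (v s)) has_real_derivative ip (w s) y) (at s)"
    by (rule Dt_functional[OF v, where G = w]) (simp_all add: ip_diff_right Dt_cvL2[OF w])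
  ultimately have "((\<lambda>t. ip (w t) (v s) + (ip (w t) (v t) - ip (w t) (v s))) has_real_derivative
      ip (v s) z + ip (w s) y) (at s)"
    by (rule DERIV_add)
  then show ?thesis by (simp add: ip_commute[of z])
qed

lemma Dt_nrm_square:
  "Dt w z s \<Longrightarrow> ((\<lambda>t. (nrm (w t))\<^sup>2) has_real_derivative 2 * ip (w s) z) (at s)"
  using Dt_ip[of w z s w z] by (simp add: ip_self ip_commute[of z])

lemma Dt_linear: "z \<in> L2 \<Longrightarrow> Dt (\<lambda>s x. complex_of_real s * z x) z s"
proof -
  assume z: "z \<in> L2"
  have "nrm (\<lambda>x. (complex_of_real t * z x - complex_of_real s * z x) / complex_of_real (t - s) - z x)
      = (if t = s then nrm z else 0)" for t
    by (auto simp: nrm_minus simp flip: left_diff_distrib of_real_diff)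
  then show ?thesis using z
    by (auto simp: Dt_def cvL2_def L2_intros eventually_at_filter intro!: tendsto_eventually)
qed

text \<open>Convergence jointly in base point and step is what
  \<open>has_real_derivative_limit\<close> consumes. The mean value theorem has no equality form for
  vector-valued functions, so it is applied to the scalar product with the error \<phi> itself; this
  gives |\<phi>|^2 \<le> |h| |z \<xi> - z s0| |\<phi>|, and one factor |\<phi>| is divided
  out.\<close>

lemma cvL2_difference_quotient:
  assumes w: "\<And>s. Dt w (z s) s" and z: "cvL2 (nhds s0) z (z s0)"
  shows "cvL2 (nhds s0 \<times>\<^sub>F at 0) (\<lambda>(s, h) x. (w (s + h) x - w s x) / complex_of_real h) (z s0)"
proof -
  have [simp]: "w t \<in> L2" "z t \<in> L2" for t using w[of t] by (auto simp: Dt_def cvL2_def)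
  let ?D = "\<lambda>(s, h) x. (w (s + h) x - w s x) / complex_of_real h"
  have "((\<lambda>p. nrm (\<lambda>x. ?D p x - z s0 x)) \<longlongrightarrow> 0) (nhds s0 \<times>\<^sub>F at 0)"
  proof (rule tendstoI)
    fix \<epsilon> :: real assume "\<epsilon> > 0"
    have "\<forall>\<^sub>F s in nhds s0. dist (nrm (\<lambda>x. z s x - z s0 x)) 0 < \<epsilon>"
      using z \<open>\<epsilon> > 0\<close> by (intro tendstoD) (auto simp: cvL2_def)
    then obtain d where d: "d > 0" "\<And>s. dist s s0 < d \<Longrightarrow> nrm (\<lambda>x. z s x - z s0 x) < \<epsilon>"
      by (auto simp: eventually_nhds_metric)
    have main: "nrm (\<lambda>x. ?D (s, h) x - z s0 x) < \<epsilon>" if sh: "dist s s0 < d / 2" "dist h 0 < d / 2" "h \<noteq> 0" for s h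
    proof -
      define \<phi> where "\<phi> x = w (s + h) x - w s x - complex_of_real h * z s0 x" for x
      have [simp]: "\<phi> \<in> L2" unfolding \<phi>_def by (simp add: L2_intros)
      define g where "g t = ip (\<lambda>x. w t x - complex_of_real t * z s0 x) \<phi>" for t
      have deriv: "(g has_real_derivative ip (\<lambda>x. z t x - z s0 x) \<phi>) (at t)" for t
        using Dt_ip[OF Dt_diff[OF w[of t] Dt_linear[of "z s0" t]] Dt_const[of \<phi> t]]
        unfolding g_def by (simp add: ip_def cip_def)
      then have "\<exists>\<xi>. dist \<xi> s0 < d \<and> g (s + h) - g s = h * ip (\<lambda>x. z \<xi> x - z s0 x) \<phi>"
      proof (cases "h > 0")
        case True
        obtain \<xi> where \<xi>: "s < \<xi>" "\<xi> < s + h" "g (s + h) - g s = h * ip (\<lambda>x. z \<xi> x - z s0 x) \<phi>"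
          using MVT2[of s "s + h" g "\<lambda>t. ip (\<lambda>x. z t x - z s0 x) \<phi>"] True deriv by auto
        moreover have "dist \<xi> s0 < d" using \<xi>(1,2) sh unfolding dist_real_def by linarith
        ultimately show ?thesis by blast
      next
        case False
        obtain \<xi> where \<xi>: "s + h < \<xi>" "\<xi> < s" "g s - g (s + h) = (s - (s + h)) * ip (\<lambda>x. z \<xi> x - z s0 x) \<phi>"
          using MVT2[of "s + h" s g "\<lambda>t. ip (\<lambda>x. z t x - z s0 x) \<phi>"] sh(3) False deriv by auto
        moreover have "dist \<xi> s0 < d" using \<xi>(1,2) sh unfolding dist_real_def by linarith
        moreover have "g (s + h) - g s = h * ip (\<lambda>x. z \<xi> x - z s0 x) \<phi>"
          using \<xi>(3) by (simp add: algebra_simps)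
        ultimately show ?thesis by blast
      qed
      then obtain \<xi> where \<xi>: "dist \<xi> s0 < d" "g (s + h) - g s = h * ip (\<lambda>x. z \<xi> x - z s0 x) \<phi>" by blast
      have "(nrm \<phi>)\<^sup>2 = g (s + h) - g s"
        unfolding ip_self[symmetric] g_def
        by (subst ip_diff_left[symmetric])
          (auto intro!: L2_intros arg_cong2[where f = ip] simp: \<phi>_def fun_eq_iff algebra_simps)
      also have "\<dots> \<le> \<bar>h\<bar> * \<bar>ip (\<lambda>x. z \<xi> x - z s0 x) \<phi>\<bar>"
        unfolding \<xi> by (metis abs_ge_self abs_mult)
      also have "\<dots> \<le> \<bar>h\<bar> * (nrm (\<lambda>x. z \<xi> x - z s0 x) * nrm \<phi>)"
        by (intro mult_left_mono abs_ip_le L2_intros) auto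
      finally have le: "(nrm \<phi>)\<^sup>2 \<le> (\<bar>h\<bar> * nrm (\<lambda>x. z \<xi> x - z s0 x)) * nrm \<phi>" by (simp add: mult.assoc)
      have "nrm \<phi> \<le> \<bar>h\<bar> * nrm (\<lambda>x. z \<xi> x - z s0 x)"
      proof (cases "nrm \<phi> = 0")
        case False
        then have "0 < nrm \<phi>" using nrm_ge0[of \<phi>] by linarith
        then show ?thesis using le by (simp add: power2_eq_square)
      qed simp
      also have "\<dots> < \<bar>h\<bar> * \<epsilon>" using d(2)[OF \<xi>(1)] sh(3) by simp
      finally have "nrm \<phi> / \<bar>h\<bar> < \<epsilon>" using sh(3) by (simp add: divide_less_eq mult.commute)
      moreover have "(\<lambda>x. ?D (s, h) x - z s0 x) = (\<lambda>x. \<phi> x / complex_of_real h)"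
        using sh(3) by (simp add: \<phi>_def field_simps)
      ultimately show ?thesis by (simp add: nrm_divide)
    qed
    have "\<forall>\<^sub>F s in nhds s0. dist s s0 < d / 2" "\<forall>\<^sub>F h in at 0. dist h 0 < d / 2 \<and> h \<noteq> (0::real)"
      using d(1) by (auto simp: eventually_nhds_metric eventually_at intro!: exI[of _ "d / 2"])
    then have "\<forall>\<^sub>F p in nhds s0 \<times>\<^sub>F at 0. nrm (\<lambda>x. ?D p x - z s0 x) < \<epsilon>"
      by (rule eventually_prodI[THEN eventually_mono]) (use main in \<open>auto simp: case_prod_unfold\<close>)
    then show "\<forall>\<^sub>F p in nhds s0 \<times>\<^sub>F at 0. dist (nrm (\<lambda>x. ?D p x - z s0 x)) 0 < \<epsilon>" by simp
  qed
  then show ?thesis unfolding cvL2_def by (auto simp: L2_intros)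
qed

lemma ip_cong_Re:
  assumes "AE x in M. Re (u x * cnj (v x)) = Re (u' x * cnj (v' x))" "u \<in> L2" "v \<in> L2" "u' \<in> L2" "v' \<in> L2"
  shows "ip u v = ip u' v'"
  unfolding ip_eq[OF assms(2,3)] ip_eq[OF assms(4,5)]
  by (rule integral_cong_AE) (use assms in \<open>auto intro!: borel_measurable_integrable ip_integrable\<close>)

lemma ip_eq_0:
  assumes "AE x in M. Re (u x * cnj (v x)) = 0" "u \<in> L2" "v \<in> L2"
  shows "ip u v = 0"
  using ip_cong_Re[of u v "\<lambda>x. 0" "\<lambda>x. 0"] assms L2_const[of 0] by (simp add: ip_def cip_def)

lemma ip_diff_eqI:
  assumes "\<And>x. Re (u x * cnj (u' x)) - Re (v x * cnj (v' x)) = Re (g x * cnj (d x))"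
    and "u \<in> L2" "u' \<in> L2" "v \<in> L2" "v' \<in> L2" "g \<in> L2" "d \<in> L2"
  shows "ip u u' - ip v v' = ip g d"
proof -
  have "ip u u' - ip v v' = (\<integral>x. Re (u x * cnj (u' x)) - Re (v x * cnj (v' x)) \<partial>M)"
    unfolding ip_eq[OF assms(2,3)] ip_eq[OF assms(4,5)]
    using assms by (intro Bochner_Integration.integral_diff[symmetric] ip_integrable)
  also have "\<dots> = ip g d" unfolding ip_eq[OF assms(6,7)] assms(1) ..
  finally show ?thesis .
qed

text \<open>The second identity is conservation of the norm by the free Schroedinger flow.\<close>

lemma ip_second_derivative:
  assumes "wd u u'" "wd u' u''"
  shows "ip u u'' = - (nrm u')\<^sup>2" "ip u (\<lambda>x. \<i> * u'' x) = 0"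
proof -
  show "ip u u'' = - (nrm u')\<^sup>2"
    using ip_by_parts[OF assms(2,1)] by (simp add: ip_self ip_commute[of u])
  have "ip (\<lambda>x. \<i> * u'' x) u = - ip (\<lambda>x. \<i> * u' x) u'"
    by (rule ip_by_parts[OF wd_cmult[OF assms(2)] assms(1)])
  then show "ip u (\<lambda>x. \<i> * u'' x) = 0" by (simp add: ip_commute[of u])
qed

lemma Dt_shift:
  assumes "Dt w z (s + h)"
  shows "Dt (\<lambda>t. w (t + h)) z s"
proof -
  have "filterlim (\<lambda>t. t + h) (at (s + h)) (at s)"
    by (auto simp: filterlim_at eventually_at_filter intro!: tendsto_intros)
  from cvL2_compose[OF _ this] assms show ?thesis
    by (fastforce simp: Dt_def)
qed

end

section \<open>The nudged equation\<close>

text \<open>\<open>w1\<close>, \<open>w2\<close> and \<open>z\<close> stand for w_x, w_xx and w_s;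
  as parameters they keep the choice operators in \<open>d1\<close>, \<open>d2\<close> and
  \<open>tderiv\<close> out of the estimates. \<open>evolution\<close> is the equation solved for
  w_s, and \<open>V\<close> bounds \<open>v\<close> and its time derivative at once, as
  \<open>Xnorm\<close> does. The assumption \<open>bounded\<close> is qualitative and serves to
  apply \<open>bounded_ancient_le\<close>.\<close>

locale nls = period +
  fixes \<gamma> \<mu> :: real and m :: nat and f :: "real \<Rightarrow> complex"
    and w w1 w2 z v v1 :: "real \<Rightarrow> real \<Rightarrow> complex" and V :: real
  assumes \<gamma>: "0 < \<gamma>" and \<mu>: "0 < \<mu>"
    and f: "f \<in> L2"
    and wd_w: "wd (w s) (w1 s)" and wd_w1: "wd (w1 s) (w2 s)"
    and w2_cont: "cvL2 (at s) w2 (w2 s)"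
    and bounded: "\<exists>B. \<forall>s. nrm (w s) \<le> B \<and> nrm (w2 s) \<le> B"
    and Dt_w: "Dt w (z s) s"
    and Dt_v: "Dt v (v1 s) s" and v1_cont: "cvL2 (at s) v1 (v1 s)"
    and P_v: "P m (v s) = v s"
    and v_le: "nrm (v s) \<le> V" and v1_le: "nrm (v1 s) \<le> V"
    and evolution: "AE x in M. z s x =
      \<i> * (w2 s x + w s x * cnj (w s x) * w s x)
      - (\<gamma> * w s x + \<mu> * P m (w s) x + (\<i> * f x - \<mu> * v s x))"
begin

definition "rho s x = w s x * cnj (w s x)"
definition "cubic s x = w s x * cnj (w s x) * w s x"
definition "potential s x = w2 s x + cubic s x"
definition "damping s x = \<gamma> * w s x + \<mu> * P m (w s) x"
definition "force s x = \<i> * f x - \<mu> * v s x"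
definition "lower s x = damping s x + force s x"

lemma L2_simps [simp]:
  "w s \<in> L2" "w1 s \<in> L2" "w2 s \<in> L2" "z s \<in> L2" "f \<in> L2" "v s \<in> L2" "v1 s \<in> L2"
  using wd_w[of s] wd_w1[of s] Dt_w[of s] Dt_v[of s] f by (auto simp: wd_def Dt_def cvL2_def)

lemma Bd_simps [simp]: "Bd (w s)" "Bd (w1 s)"
  using wd_w wd_w1 by (auto intro: wd_Bd)

lemma Bd_defs [simp]: "Bd (rho s)" "Bd (cubic s)"
proof -
  have *: "Bd (\<lambda>x. w s x * cnj (w s x))" by (rule Bd_mult[OF Bd_simps(1) Bd_cnj[OF Bd_simps(1)]])
  then show "Bd (rho s)" unfolding rho_def .
  show "Bd (cubic s)" unfolding cubic_def by (rule Bd_mult[OF * Bd_simps(1)])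
qed

lemma L2_defs [simp]:
  "cubic s \<in> L2" "potential s \<in> L2" "damping s \<in> L2" "force s \<in> L2" "lower s \<in> L2"
proof -
  show c: "cubic s \<in> L2" by (rule Bd_L2[OF Bd_defs(2)])
  show d: "damping s \<in> L2" and e: "force s \<in> L2"
    unfolding damping_def force_def by (intro L2_add L2_diff L2_cmult L2_P L2_simps)+
  show "potential s \<in> L2" "lower s \<in> L2"
    unfolding potential_def lower_def by (intro L2_add L2_simps c d e)+
qed

lemma V_ge0: "0 \<le> V"
  using v_le[of 0] nrm_ge0 order_trans by blast

lemma z_eq: "AE x in M. z s x = \<i> * potential s x - lower s x"
  using evolution[of s]
  by eventually_elim (simp add: potential_def lower_def cubic_def damping_def force_def)

lemma cv_w: "cvL2 (nhds s) w (w s)" "cvL2 (nhds s) w1 (w1 s)" "cvL2 (nhds s) w2 (w2 s)"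
  "cvB (nhds s) w (w s)" "cvB (nhds s) w1 (w1 s)"
proof -
  show w: "cvL2 (nhds s) w (w s)" by (rule cvL2_nhds[OF Dt_cvL2[OF Dt_w]])
  show w2: "cvL2 (nhds s) w2 (w2 s)" by (rule cvL2_nhds[OF w2_cont])
  show w1: "cvL2 (nhds s) w1 (w1 s)" by (rule cvL2_interpolate[OF wd_w wd_w wd_w1 wd_w1 w w2])
  show "cvB (nhds s) w (w s)" by (rule cvB_wd[OF wd_w wd_w w w1])
  show "cvB (nhds s) w1 (w1 s)" by (rule cvB_wd[OF wd_w1 wd_w1 w1 w2])
qed

lemma cv_at:
  "cvL2 (nhds s) u y \<Longrightarrow> cvL2 (at s) u y" "cvB (nhds s) u y \<Longrightarrow> cvB (at s) u y"
  by (auto simp: cvL2_def cvB_def intro: tendsto_mono[OF at_within_le_nhds])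

lemma ip_z: "u \<in> L2 \<Longrightarrow> ip u (z s) = ip u (\<lambda>x. \<i> * potential s x) - ip u (lower s)"
proof -
  assume u: "u \<in> L2"
  have "ip u (z s) = ip u (\<lambda>x. \<i> * potential s x - lower s x)"
    by (rule ip_cong_AE[OF _ z_eq]) (auto simp: u intro!: L2_intros)
  then show ?thesis using u by (simp add: ip_diff_right L2_intros)
qed

lemma ip_w_potential: "ip (w s) (\<lambda>x. \<i> * potential s x) = 0"
proof -
  have "ip (w s) (\<lambda>x. \<i> * cubic s x) = 0"
    by (rule ip_eq_0[OF AE_I2]) (simp_all add: L2_cmult, simp add: cubic_def algebra_simps)
  moreover have "(\<lambda>x. \<i> * potential s x) = (\<lambda>x. \<i> * w2 s x + \<i> * cubic s x)"
    by (simp add: potential_def ring_distribs)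
  ultimately show ?thesis
    by (simp add: ip_add_right L2_cmult ip_second_derivative(2)[OF wd_w wd_w1])
qed

lemma ip_damping: "u \<in> L2 \<Longrightarrow> ip (damping s) u = \<gamma> * ip (w s) u + \<mu> * ip (P m (w s)) u"
  unfolding damping_def by (simp add: ip_add_left ip_cmult_left L2_cmult L2_P)

lemma force_le: "nrm (force s) \<le> nrm f + \<mu> * V"
proof -
  have "nrm (force s) \<le> nrm (\<lambda>x. \<i> * f x) + nrm (\<lambda>x. \<mu> * v s x)"
    unfolding force_def by (intro nrm_triangle_diff L2_cmult L2_simps)
  also have "\<dots> \<le> nrm f + \<mu> * V"
    using \<mu> v_le[of s] by (simp add: nrm_cmult)
  finally show ?thesis .
qed

lemma damping_le:
  assumes "nrm (w s) \<le> a"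
  shows "nrm (damping s) \<le> (\<gamma> + \<mu>) * a"
proof -
  have "nrm (damping s) \<le> nrm (\<lambda>x. \<gamma> * w s x) + nrm (\<lambda>x. \<mu> * P m (w s) x)"
    unfolding damping_def by (intro nrm_triangle L2_cmult L2_simps L2_P)
  also have "\<dots> = \<gamma> * nrm (w s) + \<mu> * nrm (P m (w s))"
    using \<gamma> \<mu> by (simp add: nrm_cmult)
  also have "\<dots> \<le> \<gamma> * a + \<mu> * a"
    using \<gamma> \<mu> assms nrm_P_le[of "w s" m] by (intro add_mono mult_left_mono) auto
  finally show ?thesis by (simp add: ring_distribs)
qed

lemma lower_le: "nrm (w s) \<le> a \<Longrightarrow> nrm (lower s) \<le> (\<gamma> + \<mu>) * a + (nrm f + \<mu> * V)"
  using nrm_triangle[of "damping s" "force s"] damping_le[of s a] force_le[of s]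
  by (simp add: lower_def[abs_def])

subsection \<open>The energy estimate in the square integrable norm\<close>

lemma mass_derivative:
  "((\<lambda>s. (nrm (w s))\<^sup>2) has_real_derivative
    - 2 * \<gamma> * (nrm (w s))\<^sup>2 - 2 * \<mu> * (nrm (P m (w s)))\<^sup>2 - 2 * ip (w s) (force s)) (at s)"
proof -
  have "ip (w s) (z s) = - ip (w s) (lower s)"
    by (simp add: ip_z ip_w_potential)
  also have "ip (w s) (lower s) = \<gamma> * (nrm (w s))\<^sup>2 + \<mu> * (nrm (P m (w s)))\<^sup>2 + ip (w s) (force s)"
    using ip_damping[of "w s" s] ip_P_self[of "w s" m]
    by (simp add: lower_def[abs_def] ip_add_right ip_self ip_commute[of _ "w s"])
  finally show ?thesis
    by (intro DERIV_cong[OF Dt_nrm_square[OF Dt_w[of s]]]) (simp add: algebra_simps)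
qed

text \<open>By \<open>P_v\<close> the data \<open>v\<close> is paired with \<open>P m (w s)\<close>
  alone, exactly the part of \<open>w\<close> that the \<mu> term dissipates.\<close>

lemma force_ip_le:
  "- 2 * ip (w s) (force s) \<le> 2 * nrm (w s) * nrm f + 2 * \<mu> * (nrm (P m (w s)) * V)"
proof -
  have "ip (w s) (force s) = ip (w s) (\<lambda>x. \<i> * f x) - \<mu> * ip (w s) (v s)"
    unfolding force_def by (simp add: ip_diff_right ip_cmult_right L2_cmult)
  moreover have "\<mu> * ip (w s) (v s) \<le> \<mu> * (nrm (P m (w s)) * V)"
  proof (rule mult_left_mono)
    have "ip (w s) (v s) = ip (P m (w s)) (v s)"
      using ip_P_right[of "w s" "v s" m] by (simp add: P_v)
    also have "\<dots> \<le> nrm (P m (w s)) * nrm (v s)" by (intro ip_le L2_P L2_simps)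
    also have "\<dots> \<le> nrm (P m (w s)) * V" by (intro mult_left_mono v_le) auto
    finally show "ip (w s) (v s) \<le> nrm (P m (w s)) * V" .
  qed (use \<mu> in simp)
  moreover have "- ip (w s) (\<lambda>x. \<i> * f x) \<le> nrm (w s) * nrm f"
    using abs_ip_le[of "w s" "\<lambda>x. \<i> * f x"] by (simp add: L2_cmult nrm_cmult)
  ultimately show ?thesis by linarith
qed

lemma mass_bounded: "\<exists>B. \<forall>s. (nrm (w s))\<^sup>2 \<le> B"
  using bounded by (metis nrm_ge0 power_mono)

lemma mass_crude: "(nrm (w s))\<^sup>2 \<le> (nrm f)\<^sup>2 / \<gamma>\<^sup>2 + \<mu> * V\<^sup>2 / (2 * \<gamma>)"
proof -
  obtain B where B: "\<And>s. (nrm (w s))\<^sup>2 \<le> B" using mass_bounded by blast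
  let ?C = "(nrm f)\<^sup>2 / \<gamma> + \<mu> * V\<^sup>2 / 2"
  have "(nrm (w s))\<^sup>2 \<le> ?C / \<gamma>"
  proof (rule bounded_ancient_le[OF mass_derivative _ \<gamma> B])
    fix s
    let ?a = "nrm (w s)" and ?p = "nrm (P m (w s))"
    have "2 * ?a * nrm f \<le> \<gamma> * ?a\<^sup>2 + (nrm f)\<^sup>2 / \<gamma>"
      using \<gamma> sum_squares_bound[of "sqrt \<gamma> * ?a" "nrm f / sqrt \<gamma>"]
      by (simp add: power_mult_distrib power_divide)
    \<comment> \<open>This square spends the whole low mode dissipation on \<open>v\<close>: the
      rate is only \<gamma>, but the bound holds for every \<open>m\<close>.\<close>
    moreover have "0 \<le> 2 * \<mu> * (?p - V / 2)\<^sup>2" using \<mu> by simp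
    then have "2 * \<mu> * (?p * V) \<le> 2 * \<mu> * ?p\<^sup>2 + \<mu> * V\<^sup>2 / 2"
      by (simp add: power2_eq_square algebra_simps)
    ultimately show "- 2 * \<gamma> * ?a\<^sup>2 - 2 * \<mu> * ?p\<^sup>2 - 2 * ip (w s) (force s) \<le> ?C - \<gamma> * ?a\<^sup>2"
      using force_ip_le[of s] by linarith
  qed
  then show ?thesis using \<gamma> by (simp add: field_simps power2_eq_square)
qed

text \<open>Half of the low mode dissipation absorbs \<open>v\<close>; the tail hypothesis completes
  the other half to \<mu> times the full norm, so the rate rises to \<gamma> + \<mu>. The three
  summands of the bound are the roots of the three terms of \<open>?C / (\<gamma> + \<mu>)\<close>,
  and the last one pays for the high modes.\<close>

lemma mass_refined:
  assumes tail: "\<And>s. (nrm (\<lambda>x. w s x - P m (w s) x))\<^sup>2 \<le> 1 / 2"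
  shows "nrm (w s) \<le> nrm f / sqrt (\<gamma> * (\<gamma> + \<mu>)) + sqrt (\<mu> / (\<gamma> + \<mu>)) * V + sqrt (\<mu> / (\<gamma> + \<mu>))"
proof -
  obtain B where B: "\<And>s. (nrm (w s))\<^sup>2 \<le> B" using mass_bounded by blast
  let ?C = "(nrm f)\<^sup>2 / \<gamma> + \<mu> * V\<^sup>2 + \<mu>"
  have pos: "0 < \<gamma> + \<mu>" using \<gamma> \<mu> by simp
  have "(nrm (w s))\<^sup>2 \<le> ?C / (\<gamma> + \<mu>)"
  proof (rule bounded_ancient_le[OF mass_derivative _ pos B])
    fix s
    let ?a = "nrm (w s)" and ?p = "nrm (P m (w s))"
    have "2 * ?a * nrm f \<le> \<gamma> * ?a\<^sup>2 + (nrm f)\<^sup>2 / \<gamma>"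
      using \<gamma> sum_squares_bound[of "sqrt \<gamma> * ?a" "nrm f / sqrt \<gamma>"]
      by (simp add: power_mult_distrib power_divide)
    moreover have "0 \<le> \<mu> * (?p - V)\<^sup>2" using \<mu> by simp
    then have "2 * \<mu> * (?p * V) \<le> \<mu> * ?p\<^sup>2 + \<mu> * V\<^sup>2"
      by (simp add: power2_eq_square algebra_simps)
    moreover have "\<mu> * ?a\<^sup>2 \<le> \<mu> * (?p\<^sup>2 + 1 / 2)"
      using tail[of s] nrm_P_square[of "w s" m] \<mu> by (intro mult_left_mono) auto
    moreover have "?p \<le> ?a" by (intro nrm_P_le L2_simps)
    then have "\<mu> * ?p\<^sup>2 \<le> \<mu> * ?a\<^sup>2" using \<mu> by (intro mult_left_mono power_mono) auto
    ultimately show "- 2 * \<gamma> * ?a\<^sup>2 - 2 * \<mu> * ?p\<^sup>2 - 2 * ip (w s) (force s) \<le> ?C - (\<gamma> + \<mu>) * ?a\<^sup>2"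
      using force_ip_le[of s] by (simp add: ring_distribs)
  qed
  also have "?C / (\<gamma> + \<mu>) = (nrm f / sqrt (\<gamma> * (\<gamma> + \<mu>)))\<^sup>2 + (sqrt (\<mu> / (\<gamma> + \<mu>)) * V)\<^sup>2 + (sqrt (\<mu> / (\<gamma> + \<mu>)))\<^sup>2"
    using \<gamma> \<mu> by (simp add: power_divide power_mult_distrib add_divide_distrib)
  also have "\<dots> \<le> (nrm f / sqrt (\<gamma> * (\<gamma> + \<mu>)) + sqrt (\<mu> / (\<gamma> + \<mu>)) * V + sqrt (\<mu> / (\<gamma> + \<mu>)))\<^sup>2"
  proof -
    have *: "a\<^sup>2 + b\<^sup>2 + c\<^sup>2 \<le> (a + b + c)\<^sup>2" if "0 \<le> a" "0 \<le> b" "0 \<le> c" for a b c :: real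
    proof -
      have "(a + b + c)\<^sup>2 = a\<^sup>2 + b\<^sup>2 + c\<^sup>2 + 2 * (a * b + b * c + a * c)"
        by (simp add: power2_eq_square algebra_simps)
      then show ?thesis using that by simp
    qed
    show ?thesis by (rule *) (use \<gamma> \<mu> V_ge0 in simp_all)
  qed
  finally show ?thesis
    by (rule power2_le_imp_le) (use \<gamma> \<mu> V_ge0 in simp)
qed

subsection \<open>The energy functional of first order\<close>

text \<open>The fourth power of the L4 norm of \<open>w\<close>.\<close>

definition "quartic s = ip (cubic s) (w s)"

definition "energy s = (nrm (w1 s))\<^sup>2 - quartic s / 2 + 2 * ip (\<lambda>x. \<i> * w s x) (force s)"

text \<open>The increment of the square is the product of sum and difference of the two values of
  \<open>w1\<close>; integration by parts takes the derivative off the difference, which makes it an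
  increment of \<open>w\<close>.\<close>

lemma w1_square_derivative:
  "((\<lambda>s. (nrm (w1 s))\<^sup>2) has_real_derivative ip (\<lambda>x. - (w2 s x + w2 s x)) (z s)) (at s)"
proof (rule Dt_functional[OF Dt_w])
  show "cvL2 (at s) (\<lambda>t x. - (w2 t x + w2 s x)) (\<lambda>x. - (w2 s x + w2 s x))"
    by (intro cv_intros cv_at cv_w L2_simps)
  fix t
  have "(nrm (w1 t))\<^sup>2 - (nrm (w1 s))\<^sup>2 = ip (\<lambda>x. w1 t x + w1 s x) (\<lambda>x. w1 t x - w1 s x)"
    by (simp add: ip_add_left ip_diff_right L2_add L2_diff ip_self ip_commute[of "w1 s" "w1 t"])
  also have "\<dots> = - ip (\<lambda>x. w2 t x + w2 s x) (\<lambda>x. w t x - w s x)"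
    using ip_by_parts[OF wd_add[OF wd_w1[of t] wd_w1[of s]] wd_diff[OF wd_w[of t] wd_w[of s]]] by simp
  finally show "(nrm (w1 t))\<^sup>2 - (nrm (w1 s))\<^sup>2 = ip (\<lambda>x. - (w2 t x + w2 s x)) (\<lambda>x. w t x - w s x)"
    by (simp only: ip_minus_left)
qed

lemma quartic_derivative:
  "(quartic has_real_derivative ip (\<lambda>x. 4 * cubic s x) (z s)) (at s)"
proof -
  let ?G = "\<lambda>t x. (w t x * cnj (w t x) + w s x * cnj (w s x)) * (w t x + w s x)"
  have "cvL2 (at s) ?G (\<lambda>x. (w s x * cnj (w s x) + w s x * cnj (w s x)) * (w s x + w s x))"
    by (intro cv_intros cv_at cv_w L2_simps Bd_simps Bd_intros)
  moreover have "quartic t - quartic s = ip (?G t) (\<lambda>x. w t x - w s x)" for t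
  proof -
    have "Re (a * cnj a * a * cnj a) - Re (b * cnj b * b * cnj b)
        = Re ((a * cnj a + b * cnj b) * (a + b) * cnj (a - b))" for a b :: complex
      by (simp add: algebra_simps)
    then show ?thesis
      unfolding quartic_def
      by (intro ip_diff_eqI L2_simps L2_defs L2_diff L2_Bd_mult[OF Bd_add[OF Bd_defs(1)[unfolded rho_def] Bd_defs(1)[unfolded rho_def]]] L2_add)
        (simp only: cubic_def)
  qed
  ultimately have "(quartic has_real_derivative
      ip (\<lambda>x. (w s x * cnj (w s x) + w s x * cnj (w s x)) * (w s x + w s x)) (z s)) (at s)"
    by (intro Dt_functional[OF Dt_w])
  moreover have "(\<lambda>x. (w s x * cnj (w s x) + w s x * cnj (w s x)) * (w s x + w s x)) = (\<lambda>x. 4 * cubic s x)"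
    by (simp add: cubic_def algebra_simps)
  ultimately show ?thesis by simp
qed

lemma Dt_force: "Dt force (\<lambda>x. - \<mu> * v1 s x) s"
  using Dt_diff[OF Dt_const[OF L2_cmult[OF f, of \<i>]] Dt_cmult[OF Dt_v[of s], of \<mu>]]
  by (simp add: force_def[abs_def])

text \<open>The first two terms of the energy contribute -2 times the product of
  \<open>potential\<close> and \<open>z\<close>. As \<open>\<i> * potential\<close> is
  \<open>z + lower\<close> and \<open>z\<close> is orthogonal to \<open>\<i> * z\<close>, this is
  twice the product of \<open>\<i> * lower\<close> and \<open>z\<close>. Its part with
  \<open>force\<close> cancels against the derivative of \<open>w\<close> in the last term of the
  energy; what remains of the forcing is its product with \<open>damping\<close> and the term with
  \<open>v1\<close>.\<close>

lemma energy_derivative: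
  "(energy has_real_derivative
    2 * \<gamma> * (quartic s - (nrm (w1 s))\<^sup>2) + 2 * \<mu> * (ip (P m (w s)) (cubic s) - (nrm (P m (w1 s)))\<^sup>2)
    - 2 * ip (\<lambda>x. \<i> * damping s x) (force s) - 2 * \<mu> * ip (\<lambda>x. \<i> * w s x) (v1 s)) (at s)"
proof -
  let ?ip = "\<lambda>u v. ip (\<lambda>x. \<i> * u s x) (v s)"
  have L [simp]: "(\<lambda>x. \<i> * u s x) \<in> L2" if "u s \<in> L2" for u :: "real \<Rightarrow> real \<Rightarrow> complex"
    using that by (rule L2_cmult)
  have deriv: "(energy has_real_derivative
     ip (\<lambda>x. - (w2 s x + w2 s x)) (z s) - ip (\<lambda>x. 4 * cubic s x) (z s) / 2
     + 2 * (ip (\<lambda>x. \<i> * z s x) (force s) + ip (\<lambda>x. \<i> * w s x) (\<lambda>x. - \<mu> * v1 s x))) (at s)"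
    unfolding energy_def
    by (intro DERIV_add DERIV_diff DERIV_cdivide DERIV_cmult w1_square_derivative quartic_derivative
        Dt_ip Dt_cmult Dt_w Dt_force)
  have "ip (\<lambda>x. - (w2 s x + w2 s x)) (z s) - ip (\<lambda>x. 4 * cubic s x) (z s) / 2 = - 2 * ip (potential s) (z s)"
    using ip_cmult_left[of 4 "cubic s" "z s"] ip_cmult_left[of 2 "w2 s" "z s"]
    by (simp add: ip_minus_left ip_add_left potential_def[abs_def])
  moreover have "ip (\<lambda>x. \<i> * w s x) (\<lambda>x. - \<mu> * v1 s x) = - \<mu> * ?ip w v1"
    using ip_cmult_right[of _ "- \<mu>"] by simp
  moreover have "ip (\<lambda>x. \<i> * z s x) (force s) = - ?ip force z"
    by (simp add: ip_i_left ip_commute[of "z s"])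
  moreover have "ip (potential s) (z s) = - ?ip lower z"
  proof -
    have "ip (\<lambda>x. \<i> * potential s x) (\<lambda>x. \<i> * z s x) = ip (\<lambda>x. z s x + lower s x) (\<lambda>x. \<i> * z s x)"
      by (rule ip_cong_AE) (use z_eq[of s] in \<open>auto intro!: L2_intros\<close>)
    then have "ip (potential s) (z s) = ip (lower s) (\<lambda>x. \<i> * z s x)"
      by (simp add: ip_ii ip_add_left)
    then show ?thesis by (simp add: ip_i_left)
  qed
  moreover have "?ip lower z = ?ip damping z + ?ip force z"
    by (simp add: lower_def[abs_def] ring_distribs ip_add_left)
  moreover have "?ip damping z = ip (damping s) (potential s) - ?ip damping force"
    by (simp add: ip_z ip_ii lower_def[abs_def] ip_add_right)
  moreover have "ip (damping s) (potential s) = \<gamma> * (quartic s - (nrm (w1 s))\<^sup>2)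
      + \<mu> * (ip (P m (w s)) (cubic s) - (nrm (P m (w1 s)))\<^sup>2)"
  proof -
    have "ip (P m (w s)) (w2 s) = - (nrm (P m (w1 s)))\<^sup>2"
      using ip_by_parts[OF wd_w1[of s] wd_P[OF wd_w[of s]]] ip_P_self[of "w1 s" m]
      by (simp add: ip_commute[of "P m (w s)"])
    then show ?thesis
      using ip_second_derivative(1)[OF wd_w[of s] wd_w1[of s]]
      by (simp add: ip_damping potential_def[abs_def] ip_add_right L2_P quartic_def ip_commute[of "cubic s"] algebra_simps)
  qed
  ultimately show ?thesis by (intro DERIV_cong[OF deriv]) algebra
qed

section \<open>Sup bounds and the first order estimate\<close>

lemma w_sup:
  assumes "nrm (w s) \<le> a" "nrm (w1 s) \<le> X"
  shows "AE x in M. (cmod (w s x))\<^sup>2 \<le> a\<^sup>2 / L + 2 * a * X"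
proof -
  have a: "0 \<le> a" using assms(1) nrm_ge0 order_trans by blast
  have "(nrm (w s))\<^sup>2 / L + 2 * nrm (w s) * nrm (w1 s) \<le> a\<^sup>2 / L + 2 * a * X"
    using assms a L_pos by (intro add_mono divide_right_mono power_mono mult_mono) auto
  with agmon[OF wd_w[of s]] show ?thesis by (auto elim: eventually_mono)
qed

lemma cubic_le:
  assumes "nrm (w s) \<le> a" "AE x in M. (cmod (w s x))\<^sup>2 \<le> W" "0 \<le> W"
  shows "nrm (cubic s) \<le> W * a"
proof -
  have "nrm (\<lambda>x. rho s x * w s x) \<le> W * nrm (w s)"
  proof (rule nrm_mult_le[OF _ _ L2_simps(1) assms(3)])
    show "rho s \<in> borel_measurable M" using Bd_defs(1) by (simp add: Bd_def)
    show "AE x in M. cmod (rho s x) \<le> W"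
      using assms(2) by eventually_elim (simp add: rho_def norm_mult power2_eq_square)
  qed
  also have "\<dots> \<le> W * a" using assms by (intro mult_left_mono)
  finally show ?thesis by (simp add: rho_def cubic_def[abs_def])
qed

lemma quartic_ge0: "0 \<le> quartic s"
proof -
  have "Re (cubic s x * cnj (w s x)) = (cmod (w s x))\<^sup>2 * (cmod (w s x))\<^sup>2" for x
    by (simp add: cubic_def cmod_power2) (simp add: power2_eq_square algebra_simps)
  then show ?thesis unfolding quartic_def by (simp add: ip_eq)
qed

lemma w1_bounded: "\<exists>B. \<forall>s. nrm (w1 s) \<le> B"
proof -
  obtain B where B: "\<And>s. nrm (w s) \<le> B" "\<And>s. nrm (w2 s) \<le> B" using bounded by blast
  have "nrm (w1 s) \<le> B" for s
  proof (rule power2_le_imp_le)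
    have "(nrm (w1 s))\<^sup>2 \<le> nrm (w s) * nrm (w2 s)"
      using ip_second_derivative(1)[OF wd_w[of s] wd_w1[of s]] abs_ip_le[of "w s" "w2 s"] by simp
    also have "\<dots> \<le> B * B" using B[of s] order_trans[OF nrm_ge0 B(1)] by (intro mult_mono) auto
    finally show "(nrm (w1 s))\<^sup>2 \<le> B\<^sup>2" by (simp add: power2_eq_square)
    show "0 \<le> B" using B(1)[of s] nrm_ge0[of "w s"] by linarith
  qed
  then show ?thesis by blast
qed

text \<open>The parameters cover two situations: \<kappa> = \<gamma> with \<open>q\<close> = 0,
  where the nudging dissipation is discarded, and \<kappa> = \<gamma> + \<mu> with \<open>q\<close>
  = 1, where the high modes of \<open>w1\<close> are under control. Of the dissipation 2 \<kappa>
  |w_x|^2 one half reproduces \<kappa> times the energy and the other absorbs the term a^3 |w_x|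
  that the sup bound of \<open>w\<close> makes out of the nonlinearity.\<close>

lemma energy_estimate:
  fixes \<kappa> q a :: real
  assumes a: "\<And>s. nrm (w s) \<le> a" and q: "0 \<le> q" and \<kappa>: "0 < \<kappa>" "\<kappa> \<le> \<gamma> + \<mu>"
    and dissipation: "\<And>s. \<kappa> * (nrm (w1 s))\<^sup>2 - \<mu> * q \<le> \<gamma> * (nrm (w1 s))\<^sup>2 + \<mu> * (nrm (P m (w1 s)))\<^sup>2"
  defines "H \<equiv> nrm f + \<mu> * V" and "\<theta> \<equiv> (\<gamma> + \<mu>) / \<kappa>"
  shows "(nrm (w1 s))\<^sup>2 \<le> 4 * \<theta> * q + 5 * \<theta> * a^4 / L + 9 * \<theta>\<^sup>2 * a^6 + 12 * \<theta> * a * H + 4 * \<theta> * a * V"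
proof -
  have a0: "0 \<le> a" using a[of 0] nrm_ge0[of "w 0"] by linarith
  have H0: "0 \<le> H" using \<mu> V_ge0 by (simp add: H_def)
  let ?k = "\<gamma> + \<mu>"
  define K where "K = 2 * \<mu> * q + 2 * ?k * a^4 / L + 4 * ?k\<^sup>2 * a^6 / \<kappa> + 4 * ?k * a * H + 2 * \<mu> * a * V"
  define W where "W s = a\<^sup>2 / L + 2 * a * nrm (w1 s)" for s
  have W0: "0 \<le> W s" for s unfolding W_def using a0 L_pos by simp
  have Wa: "W s * a * a = a^4 / L + 2 * a^3 * nrm (w1 s)" for s
    unfolding W_def by (simp add: algebra_simps power4_eq_xxxx power3_eq_cube power2_eq_square)
  have cub: "nrm (cubic s) \<le> W s * a" for s
    unfolding W_def by (intro cubic_le a w_sup order_refl W0[unfolded W_def])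
  have I3: "\<bar>ip (\<lambda>x. \<i> * w s x) (force s)\<bar> \<le> a * H" for s
  proof -
    have "\<bar>ip (\<lambda>x. \<i> * w s x) (force s)\<bar> \<le> nrm (\<lambda>x. \<i> * w s x) * nrm (force s)"
      by (intro abs_ip_le L2_cmult) simp_all
    also have "\<dots> \<le> a * H"
      unfolding H_def using a a0 force_le by (intro mult_mono) (simp_all add: nrm_cmult)
    finally show ?thesis .
  qed
  obtain B where B: "\<And>s. nrm (w1 s) \<le> B" using w1_bounded by blast
  have bdd: "energy s \<le> B\<^sup>2 + 2 * a * H" for s
    using power_mono[OF B nrm_ge0, of s 2] I3[of s] quartic_ge0[of s] by (simp add: energy_def)
  have "energy s \<le> K / \<kappa>"
  proof (rule bounded_ancient_le[OF energy_derivative _ \<kappa>(1) bdd])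
    fix s
    let ?X = "nrm (w1 s)"
    have "quartic s \<le> W s * a * a"
      unfolding quartic_def
      by (rule order_trans[OF ip_le]) (auto intro!: mult_mono cub a mult_nonneg_nonneg W0 a0)
    then have "2 * \<gamma> * quartic s \<le> 2 * \<gamma> * (W s * a * a)" using \<gamma> by simp
    moreover have "ip (P m (w s)) (cubic s) \<le> a * (W s * a)"
      by (rule order_trans[OF ip_le[OF L2_P L2_defs(1)]])
        (intro mult_mono cub a0 nrm_ge0 order_trans[OF nrm_P_le[OF L2_simps(1)] a])
    then have "2 * \<mu> * ip (P m (w s)) (cubic s) \<le> 2 * \<mu> * (W s * a * a)" using \<mu> by (simp add: mult_ac)
    moreover have "\<bar>ip (\<lambda>x. \<i> * damping s x) (force s)\<bar> \<le> ?k * a * H"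
    proof -
      have "\<bar>ip (\<lambda>x. \<i> * damping s x) (force s)\<bar> \<le> nrm (\<lambda>x. \<i> * damping s x) * nrm (force s)"
        by (intro abs_ip_le L2_cmult) simp_all
      also have "\<dots> \<le> ?k * a * H"
        unfolding H_def using a0 \<gamma> \<mu> force_le damping_le[OF a] by (intro mult_mono) (simp_all add: nrm_cmult)
      finally show ?thesis .
    qed
    moreover have "\<bar>ip (\<lambda>x. \<i> * w s x) (v1 s)\<bar> \<le> a * V"
    proof -
      have "\<bar>ip (\<lambda>x. \<i> * w s x) (v1 s)\<bar> \<le> nrm (\<lambda>x. \<i> * w s x) * nrm (v1 s)"
        by (intro abs_ip_le L2_cmult) simp_all
      also have "\<dots> \<le> a * V"
        using a a0 v1_le by (intro mult_mono) (simp_all add: nrm_cmult)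
      finally show ?thesis .
    qed
    then have "2 * \<mu> * (- ip (\<lambda>x. \<i> * w s x) (v1 s)) \<le> 2 * \<mu> * (a * V)"
      using \<mu> by (intro mult_left_mono) linarith+
    moreover have "\<kappa> * energy s \<le> \<kappa> * ?X\<^sup>2 + 2 * ?k * a * H"
    proof -
      have "energy s \<le> ?X\<^sup>2 + 2 * (a * H)"
        using I3[of s] quartic_ge0[of s] by (simp add: energy_def)
      then have "\<kappa> * energy s \<le> \<kappa> * (?X\<^sup>2 + 2 * (a * H))"
        using \<kappa> by (intro mult_left_mono) auto
      moreover have "\<kappa> * (2 * (a * H)) \<le> ?k * (2 * (a * H))"
        using \<kappa> a0 H0 by (intro mult_right_mono) auto
      ultimately show ?thesis by (simp add: algebra_simps)
    qed
    moreover have "4 * ?k * a^3 * ?X \<le> \<kappa> * ?X\<^sup>2 + 4 * ?k\<^sup>2 * a^6 / \<kappa>"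
    proof -
      have "0 \<le> (\<kappa> * ?X - 2 * ?k * a^3)\<^sup>2 / \<kappa>" using \<kappa> by simp
      also have "\<dots> = \<kappa> * ?X\<^sup>2 + 4 * ?k\<^sup>2 * a^6 / \<kappa> - 4 * ?k * a^3 * ?X"
        using \<kappa> by (simp add: power2_diff power_mult_distrib field_simps power2_eq_square flip: power_mult)
      finally show ?thesis by simp
    qed
    moreover have "2 * \<gamma> * (W s * a * a) + 2 * \<mu> * (W s * a * a) = 2 * ?k * a^4 / L + 4 * ?k * a^3 * ?X"
      unfolding Wa by (simp add: algebra_simps add_divide_distrib)
    ultimately show "2 * \<gamma> * (quartic s - ?X\<^sup>2) + 2 * \<mu> * (ip (P m (w s)) (cubic s) - (nrm (P m (w1 s)))\<^sup>2)
        - 2 * ip (\<lambda>x. \<i> * damping s x) (force s) - 2 * \<mu> * ip (\<lambda>x. \<i> * w s x) (v1 s) \<le> K - \<kappa> * energy s"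
      using dissipation[of s] unfolding K_def right_diff_distrib by linarith
  qed
  moreover have "K / \<kappa> \<le> 2 * \<theta> * q + 2 * \<theta> * a^4 / L + 4 * \<theta>\<^sup>2 * a^6 + 4 * \<theta> * a * H + 2 * \<theta> * a * V"
  proof -
    have "\<mu> / \<kappa> \<le> \<theta>" using \<gamma> \<kappa> by (simp add: \<theta>_def divide_right_mono)
    then have "2 * (\<mu> / \<kappa>) * q \<le> 2 * \<theta> * q" "2 * (\<mu> / \<kappa>) * a * V \<le> 2 * \<theta> * a * V"
      using q a0 V_ge0 by (intro mult_right_mono mult_left_mono; simp)+
    moreover have *: "(2 * \<mu> * q + 2 * k * a^4 / L + 4 * k\<^sup>2 * a^6 / \<kappa> + 4 * k * a * H + 2 * \<mu> * a * V) / \<kappa>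
        = 2 * (\<mu> / \<kappa>) * q + 2 * (k / \<kappa>) * a^4 / L + 4 * (k / \<kappa>)\<^sup>2 * a^6 + 4 * (k / \<kappa>) * a * H
          + 2 * (\<mu> / \<kappa>) * a * V" for k
      by (simp add: add_divide_distrib power_divide power2_eq_square mult_ac)
    ultimately show ?thesis
      using *[of "\<gamma> + \<mu>", folded K_def, folded \<theta>_def] by linarith
  qed
  \<comment> \<open>Half of the squared norm is absorbed on the left, so everything else doubles:
    the coefficients of the statement are 4 = 2 * 2, 5 = 2 * 2 + 1, 9 = 2 * 4 + 1, 12 = 2 * 4 + 4
    and 4 = 2 * 2.\<close>
  moreover have "a^3 * nrm (w1 s) \<le> (nrm (w1 s))\<^sup>2 / 2 + a^6 / 2"
    using sum_squares_bound[of "a^3" "nrm (w1 s)"] by (simp flip: power_mult)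
  moreover have "quartic s \<le> a^4 / L + 2 * (a^3 * nrm (w1 s))"
  proof -
    have "quartic s \<le> W s * a * a"
      unfolding quartic_def
      by (rule order_trans[OF ip_le]) (auto intro!: mult_mono cub a mult_nonneg_nonneg W0 a0)
    then show ?thesis by (simp add: Wa)
  qed
  moreover have "1 \<le> \<theta>" using \<kappa> by (simp add: \<theta>_def)
  then have "a^4 / L \<le> \<theta> * (a^4 / L)" "a^6 \<le> \<theta>\<^sup>2 * a^6" "a * H \<le> \<theta> * (a * H)"
    using a0 H0 L_pos mult_right_mono[of 1 \<theta> "a^4 / L"] mult_right_mono[of 1 "\<theta>\<^sup>2" "a^6"]
      mult_right_mono[of 1 \<theta> "a * H"] by (simp_all add: one_le_power)
  moreover have "(nrm (w1 s))\<^sup>2 = energy s + quartic s / 2 - 2 * ip (\<lambda>x. \<i> * w s x) (force s)"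
    by (simp add: energy_def)
  ultimately show ?thesis using I3[of s]
    unfolding mult.assoc times_divide_eq_right[symmetric] by linarith
qed

subsection \<open>The energy functional of second order\<close>

lemma cv_z: "cvL2 (nhds s) z (z s)"
proof (rule cvL2_cong_AE)
  show "cvL2 (nhds s) (\<lambda>t x. \<i> * potential t x - lower t x) (\<lambda>x. \<i> * potential s x - lower s x)"
    unfolding potential_def cubic_def lower_def damping_def force_def
    by (intro cvL2_add cvL2_diff cvL2_cmult cvL2_P cvL2_Bd_mult cvB_mult cvB_cnj cv_w cvL2_const f
        cvL2_nhds[OF Dt_cvL2[OF Dt_v]])
qed (simp_all add: z_eq)

text \<open>The limit exists because the quotient of \<open>\<i> * w2\<close> is orthogonal to the
  quotient of \<open>w\<close>: before the limit, the derivative involves only quotients of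
  \<open>w\<close> and \<open>v\<close> and bounded factors, all of which converge jointly in time
  and step.\<close>

lemma velocity_derivative:
  "((\<lambda>s. (nrm (z s))\<^sup>2) has_real_derivative
    2 * (ip (z s) (\<lambda>x. \<i> * (cnj (w s x) * (w s x + w s x) * z s x + w s x * w s x * cnj (z s x)))
      - \<gamma> * (nrm (z s))\<^sup>2 - \<mu> * (nrm (P m (z s)))\<^sup>2 + \<mu> * ip (z s) (v1 s))) (at s)"
proof -
  define D where "D s h x = (w (s + h) x - w s x) / complex_of_real h" for s h x
  define Dv where "Dv s h x = (v (s + h) x - v s x) / complex_of_real h" for s h x
  \<comment> \<open>The difference quotient of |w|^2 w, from the splitting of |a|^2 a - |b|^2 b into
    \<open>cnj a * (a + b)\<close> times a - b plus \<open>b * b\<close> times the conjugate of a -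
    b.\<close>
  define E where "E s h x = cnj (w (s + h) x) * (w (s + h) x + w s x) * D s h x + w s x * w s x * cnj (D s h x)" for s h x
  have D_L2 [simp]: "D s h \<in> L2" "Dv s h \<in> L2" for s h
    unfolding D_def Dv_def by (intro L2_divide L2_diff L2_simps)+
  have E_L2 [simp]: "E s h \<in> L2" for s h
    unfolding E_def by (intro L2_add L2_Bd_mult Bd_mult Bd_add Bd_cnj Bd_simps L2_cnj D_L2)
  let ?F' = "\<lambda>h s. 2 * (ip (D s h) (\<lambda>x. \<i> * E s h x) - \<gamma> * (nrm (D s h))\<^sup>2
      - \<mu> * (nrm (P m (D s h)))\<^sup>2 + \<mu> * ip (D s h) (Dv s h))"
  show ?thesis
  proof (rule has_real_derivative_limit[where F = "\<lambda>h s. (nrm (D s h))\<^sup>2" and F' = ?F'])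
    fix s :: real
    have "isCont (\<lambda>h. s + h) 0" by (intro continuous_intros)
    then have "filterlim (\<lambda>h. s + h) (at s) (at 0)"
      by (simp add: isCont_def filterlim_at eventually_at_filter)
    then have "cvL2 (at 0) (\<lambda>h x. (w (s + h) x - w s x) / complex_of_real (s + h - s)) (z s)"
      using Dt_w[of s] unfolding Dt_def by (intro cvL2_compose[where p = "\<lambda>h. s + h"]) blast+
    then have "cvL2 (at 0) (D s) (z s)" by (simp add: D_def[abs_def])
    from cvL2_ip[OF this this] show "((\<lambda>h. (nrm (D s h))\<^sup>2) \<longlongrightarrow> (nrm (z s))\<^sup>2) (at 0)"
      by (simp add: ip_self)
  next
    fix h s :: real assume "h \<noteq> 0"
    let ?c = "complex_of_real (inverse h)"
    let ?Dz = "\<lambda>x. ?c * (z (s + h) x - z s x)"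
    let ?D2 = "\<lambda>x. ?c * (w2 (s + h) x - w2 s x)"
    have D_eq: "(\<lambda>s. D s h) = (\<lambda>s x. ?c * (w (s + h) x - w s x))"
      by (simp add: D_def[abs_def] divide_inverse mult.commute)
    have "Dt (\<lambda>s. D s h) ?Dz s"
      unfolding D_eq by (intro Dt_cmult Dt_diff Dt_shift Dt_w)
    then have deriv: "((\<lambda>s. (nrm (D s h))\<^sup>2) has_real_derivative 2 * ip (D s h) ?Dz) (at s)"
      by (rule Dt_nrm_square)
    have "ip (D s h) ?Dz = ip (D s h) (\<lambda>x. \<i> * ?D2 x) + ip (D s h) (\<lambda>x. \<i> * E s h x)
      - (\<gamma> * ip (D s h) (D s h) + \<mu> * ip (D s h) (P m (D s h)) - \<mu> * ip (D s h) (Dv s h))"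
    proof -
      have PD: "P m (D s h) x = ?c * (P m (w (s + h)) x - P m (w s) x)" for x
      proof -
        have "D s h = (\<lambda>x. ?c * (w (s + h) x - w s x))"
          by (simp add: D_def[abs_def] divide_inverse mult.commute)
        then show ?thesis by (simp add: P_cmult P_diff)
      qed
      have "ip (D s h) ?Dz = ip (D s h) (\<lambda>x. (\<i> * ?D2 x + \<i> * E s h x) - (\<gamma> * D s h x + \<mu> * P m (D s h) x - \<mu> * Dv s h x))"
      proof (rule ip_cong_AE)
        show "AE x in M. ?Dz x = (\<i> * ?D2 x + \<i> * E s h x) - (\<gamma> * D s h x + \<mu> * P m (D s h) x - \<mu> * Dv s h x)"
          using z_eq[of "s + h"] z_eq[of s]
        proof eventually_elim
          case (elim x)
          have E: "E s h x = ?c * (cubic (s + h) x - cubic s x)"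
            unfolding E_def D_def cubic_def using \<open>h \<noteq> 0\<close> by (simp add: field_simps)
          have "?Dz x = ?c * (\<i> * potential (s + h) x - lower (s + h) x - (\<i> * potential s x - lower s x))"
            using elim by simp
          also have "\<dots> = (\<i> * ?D2 x + \<i> * (?c * (cubic (s + h) x - cubic s x)))
              - (\<gamma> * (?c * (w (s + h) x - w s x)) + \<mu> * (?c * (P m (w (s + h)) x - P m (w s) x))
                - \<mu> * (?c * (v (s + h) x - v s x)))"
            unfolding potential_def lower_def damping_def force_def by (simp add: algebra_simps)
          also have "\<dots> = (\<i> * ?D2 x + \<i> * E s h x) - (\<gamma> * D s h x + \<mu> * P m (D s h) x - \<mu> * Dv s h x)"
            unfolding E PD D_def Dv_def by (simp add: divide_inverse mult_ac)
          finally show ?case .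
        qed
      qed (intro L2_cmult L2_diff L2_add L2_P D_L2 E_L2 L2_simps | simp)+
      also have "\<dots> = ip (D s h) (\<lambda>x. \<i> * ?D2 x) + ip (D s h) (\<lambda>x. \<i> * E s h x)
        - (\<gamma> * ip (D s h) (D s h) + \<mu> * ip (D s h) (P m (D s h)) - \<mu> * ip (D s h) (Dv s h))"
      proof -
        have [simp]: "?D2 \<in> L2" by (intro L2_cmult L2_diff L2_simps)
        show ?thesis
          by (simp add: ip_add_right ip_diff_right L2_add L2_diff L2_cmult L2_P del: mult_minus_right)
            (simp add: ip_cmult_right)
      qed
      finally show ?thesis .
    qed
    moreover have "ip (D s h) (\<lambda>x. \<i> * ?D2 x) = 0"
    proof (rule ip_second_derivative(2))
      have "wd (\<lambda>x. ?c * (w (s + h) x - w s x)) (\<lambda>x. ?c * (w1 (s + h) x - w1 s x))"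
        by (intro wd_cmult wd_diff wd_w)
      then show "wd (D s h) (\<lambda>x. ?c * (w1 (s + h) x - w1 s x))"
        by (simp add: D_def[abs_def] divide_inverse mult.commute)
      show "wd (\<lambda>x. ?c * (w1 (s + h) x - w1 s x)) ?D2"
        by (intro wd_cmult wd_diff wd_w1)
    qed
    moreover have "ip (D s h) (P m (D s h)) = (nrm (P m (D s h)))\<^sup>2" by (simp add: ip_P_self)
    ultimately have "ip (D s h) ?Dz = ip (D s h) (\<lambda>x. \<i> * E s h x) - \<gamma> * (nrm (D s h))\<^sup>2
        - \<mu> * (nrm (P m (D s h)))\<^sup>2 + \<mu> * ip (D s h) (Dv s h)"
      unfolding ip_self by algebra
    with deriv show "((\<lambda>s. (nrm (D s h))\<^sup>2) has_real_derivative ?F' h s) (at s)"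
      by (simp only:)
  next
    let ?N = "nhds s \<times>\<^sub>F at (0::real)"
    have fst: "filterlim fst (nhds s) ?N" by (rule filterlim_fst)
    have snd: "filterlim snd (nhds 0) ?N"
    proof (rule filterlim_mono)
      show "filterlim snd (at 0) ?N" by (rule filterlim_snd)
    qed (simp_all add: at_within_le_nhds)
    have sum: "filterlim (\<lambda>p. fst p + snd p) (nhds s) ?N"
      using tendsto_add[OF fst snd] by simp
    have D: "cvL2 ?N (\<lambda>p. D (fst p) (snd p)) (z s)"
      using cvL2_difference_quotient[OF Dt_w cv_z] by (simp add: D_def[abs_def] case_prod_unfold)
    have Dv: "cvL2 ?N (\<lambda>p. Dv (fst p) (snd p)) (v1 s)"
      using cvL2_difference_quotient[OF Dt_v cvL2_nhds[OF v1_cont]] by (simp add: Dv_def[abs_def] case_prod_unfold)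
    have wB: "cvB ?N (\<lambda>p. w (fst p)) (w s)" "cvB ?N (\<lambda>p. w (fst p + snd p)) (w s)"
    proof -
      show "cvB ?N (\<lambda>p. w (fst p)) (w s)"
        by (intro cvB_wd[OF wd_w wd_w] cvL2_compose[OF cv_w(1) fst] cvL2_compose[OF cv_w(2) fst])
      show "cvB ?N (\<lambda>p. w (fst p + snd p)) (w s)"
        by (intro cvB_wd[OF wd_w wd_w] cvL2_compose[OF cv_w(1) sum] cvL2_compose[OF cv_w(2) sum])
    qed
    have "((\<lambda>p. ?F' (snd p) (fst p)) \<longlongrightarrow>
       2 * (ip (z s) (\<lambda>x. \<i> * (cnj (w s x) * (w s x + w s x) * z s x + w s x * w s x * cnj (z s x)))
      - \<gamma> * (nrm (z s))\<^sup>2 - \<mu> * (nrm (P m (z s)))\<^sup>2 + \<mu> * ip (z s) (v1 s))) ?N"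
      unfolding E_def ip_self[symmetric]
      by (intro tendsto_mult tendsto_add tendsto_diff tendsto_const cvL2_ip D Dv cvL2_cmult cvL2_add
          cvL2_Bd_mult cvB_mult cvB_add cvB_cnj wB cvL2_cnj cvL2_P)
    then show "((\<lambda>(s, h). ?F' h s) \<longlongrightarrow>
       2 * (ip (z s) (\<lambda>x. \<i> * (cnj (w s x) * (w s x + w s x) * z s x + w s x * w s x * cnj (z s x)))
      - \<gamma> * (nrm (z s))\<^sup>2 - \<mu> * (nrm (P m (z s)))\<^sup>2 + \<mu> * ip (z s) (v1 s))) ?N"
      by (simp add: case_prod_unfold)
  qed
qed

end

text \<open>Here \<open>a\<close>, \<open>b\<close>, \<open>c\<close>, \<open>y\<close>,
  \<open>g\<close> are the values of \<open>w\<close>, \<open>w1\<close>, \<open>w2\<close>,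
  \<open>z\<close>, \<open>lower\<close> at one point, and \<open>c\<close> is eliminated by the
  equation. The four summands belong to the four terms of the energy, with weights 1, 1/2, 2 and
  -4/3. The dangerous part of the first is 2 Im((cnj a y)^2) = 4 Im(cnj a y) Re(cnj a y); the weight
  1/2 makes the part of \<open>r2\<close> with y cancel it. The weight 2 cancels the terms 4 |b|^2
  Re(cnj a y). The cubic part of \<open>c\<close> then leaves 8 |a|^4 Re(cnj a y), which fixes the
  weight 4/3.\<close>

lemma second_order_cancellation:
  fixes a b c y g :: complex
  assumes c: "c = - \<i> * y - \<i> * g - a * cnj a * a"
  defines "r1 \<equiv> b * cnj a + a * cnj b"
    and "r2 \<equiv> (c * cnj a + b * cnj b) + (b * cnj b + a * cnj c)"
  shows "2 * Re (y * cnj (\<i> * (cnj a * (a + a) * y + a * a * cnj y)))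
      + Re (- ((r2 + r2) * (a + a)) * cnj y) / 2
      + 2 * Re ((b * cnj b * (a + a) - (r1 * (b + b) + a * cnj a * (c + c))) * cnj y)
      - 4 / 3 * Re (((a * cnj a * (a * cnj a) + a * cnj a * (a * cnj a) + a * cnj a * (a * cnj a)) * (a + a)) * cnj y)
    = - 4 * Im (cnj a * g) * Re (cnj a * y) + 4 * (cmod a)\<^sup>2 * Re (\<i> * g * cnj y)
      - 8 * Re (cnj a * b) * Re (b * cnj y)"
proof -
  have c': "Re c = Im y + Im g - (cmod a)\<^sup>2 * Re a" "Im c = - Re y - Re g - (cmod a)\<^sup>2 * Im a"
    unfolding c cmod_power2 by (simp_all add: power2_eq_square algebra_simps)
  have e1: "Re (- ((r + r) * (a + a)) * cnj y) / 2 = - 2 * Re (r * a * cnj y)" for r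
  proof -
    have "- ((r + r) * (a + a)) * cnj y = complex_of_real (- 4) * (r * a * cnj y)" by (simp add: algebra_simps)
    then show ?thesis by (simp only: scaleR_conv_of_real[symmetric] scaleR_complex.sel)
  qed
  have e2: "4 / 3 * Re (((r + r + r) * (a + a)) * cnj y) = 8 * Re (r * a * cnj y)" for r
  proof -
    have "((r + r + r) * (a + a)) * cnj y = complex_of_real 6 * (r * a * cnj y)" by (simp add: algebra_simps)
    then show ?thesis by (simp only: scaleR_conv_of_real[symmetric] scaleR_complex.sel)
  qed
  have "2 * Re (y * cnj (\<i> * (cnj a * (a + a) * y + a * a * cnj y))) + - 2 * Re (r2 * a * cnj y)
      + 2 * Re ((b * cnj b * (a + a) - (r1 * (b + b) + a * cnj a * (c + c))) * cnj y)
      - 8 * Re (a * cnj a * (a * cnj a) * a * cnj y)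
    = - 4 * Im (cnj a * g) * Re (cnj a * y) + 4 * (cmod a)\<^sup>2 * Re (\<i> * g * cnj y)
      - 8 * Re (cnj a * b) * Re (b * cnj y)"
    using c' unfolding r1_def r2_def cmod_power2
    by (simp only: complex.sel plus_complex.sel minus_complex.sel times_complex.sel cnj.sel uminus_complex.sel
      imaginary_unit.sel power2_eq_square) (simp add: algebra_simps)
  then show ?thesis by (simp only: e1 e2)
qed

context nls
begin

section \<open>Time derivatives of the terms of the second order energy\<close>

definition "rho1 s x = w1 s x * cnj (w s x) + w s x * cnj (w1 s x)"
definition "rho2 s x = (w2 s x * cnj (w s x) + w1 s x * cnj (w1 s x)) + (w1 s x * cnj (w1 s x) + w s x * cnj (w2 s x))"

lemma wd_rho: "wd (rho s) (rho1 s)"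
  unfolding rho_def rho1_def by (intro wd_mult_Bd wd_w wd_cnj)

lemma wd_rho1: "wd (rho1 s) (rho2 s)"
  unfolding rho1_def rho2_def by (intro wd_add wd_mult_Bd wd_w wd_w1 wd_cnj)

lemma rho_L2 [simp]: "rho s \<in> L2" "rho1 s \<in> L2" "rho2 s \<in> L2" and Bd_rho1 [simp]: "Bd (rho1 s)"
  using wd_rho[of s] wd_rho1[of s] by (auto simp: wd_def intro: wd_Bd)

lemma cv_rho: "cvB (at s) rho (rho s)" "cvB (at s) rho1 (rho1 s)" "cvL2 (at s) rho2 (rho2 s)"
proof -
  note w = cv_at(2)[OF cv_w(4)] cv_at(2)[OF cv_w(5)]
  show "cvB (at s) rho (rho s)" unfolding rho_def by (intro cvB_mult cvB_cnj w)
  show "cvB (at s) rho1 (rho1 s)" unfolding rho1_def by (intro cvB_add cvB_mult cvB_cnj w)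
  have "cvL2 (at s) (\<lambda>t x. w1 t x * cnj (w1 t x)) (\<lambda>x. w1 s x * cnj (w1 s x))"
    by (intro cvB_imp_cvL2 cvB_mult cvB_cnj w)
  moreover have "cvL2 (at s) (\<lambda>t x. w2 t x * cnj (w t x)) (\<lambda>x. w2 s x * cnj (w s x))"
    by (intro cvL2_mult_Bd cvB_cnj w w2_cont)
  moreover have "cvL2 (at s) (\<lambda>t x. w t x * cnj (w2 t x)) (\<lambda>x. w s x * cnj (w2 s x))"
    by (intro cvL2_Bd_mult cvL2_cnj w w2_cont)
  ultimately show "cvL2 (at s) rho2 (rho2 s)" unfolding rho2_def by (intro cvL2_add)
qed

text \<open>After integration by parts the increment of \<open>rho\<close> stands against
  \<open>rho2\<close>, which is real. For a real factor the identity |a|^2 - |b|^2 = Re((a + b)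
  cnj(a - b)) turns it into an increment of \<open>w\<close>.\<close>

lemma rho1_square_derivative:
  "((\<lambda>s. (nrm (rho1 s))\<^sup>2) has_real_derivative ip (\<lambda>x. - ((rho2 s x + rho2 s x) * (w s x + w s x))) (z s)) (at s)"
proof (rule Dt_functional[OF Dt_w])
  show "cvL2 (at s) (\<lambda>t x. - ((rho2 t x + rho2 s x) * (w t x + w s x))) (\<lambda>x. - ((rho2 s x + rho2 s x) * (w s x + w s x)))"
    by (intro cvL2_minus cvL2_mult_Bd cvL2_add cvB_add cv_rho cv_at cv_w cvL2_const cvB_const rho_L2 Bd_simps)
  fix t
  have [simp]: "(\<lambda>x. (rho2 t x + rho2 s x) * (w t x + w s x)) \<in> L2"
    by (intro L2_mult_Bd L2_add Bd_add rho_L2 Bd_simps)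
  have "(nrm (rho1 t))\<^sup>2 - (nrm (rho1 s))\<^sup>2 = ip (\<lambda>x. rho1 t x + rho1 s x) (\<lambda>x. rho1 t x - rho1 s x)"
    by (simp add: ip_add_left ip_diff_right L2_add L2_diff ip_self ip_commute[of "rho1 s" "rho1 t"])
  also have "\<dots> = - ip (\<lambda>x. rho2 t x + rho2 s x) (\<lambda>x. rho t x - rho s x)"
    using ip_by_parts[OF wd_add[OF wd_rho1[of t] wd_rho1[of s]] wd_diff[OF wd_rho[of t] wd_rho[of s]]] by simp
  also have "ip (\<lambda>x. rho2 t x + rho2 s x) (\<lambda>x. rho t x - rho s x)
      = ip (\<lambda>x. (rho2 t x + rho2 s x) * (w t x + w s x)) (\<lambda>x. w t x - w s x)"
  proof (rule ip_cong_Re[OF AE_I2])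
    fix x
    have real: "Im (rho2 t x + rho2 s x) = 0" for t s by (simp add: rho2_def)
    have "Re (r * cnj (a * cnj a - b * cnj b)) = Re (r * (a + b) * cnj (a - b))" if "Im r = 0" for r a b
      using that by (simp add: algebra_simps)
    from this[OF real] show "Re ((rho2 t x + rho2 s x) * cnj (rho t x - rho s x))
        = Re ((rho2 t x + rho2 s x) * (w t x + w s x) * cnj (w t x - w s x))"
      by (simp only: rho_def)
  qed (auto intro!: L2_intros)
  finally show "(nrm (rho1 t))\<^sup>2 - (nrm (rho1 s))\<^sup>2
      = ip (\<lambda>x. - ((rho2 t x + rho2 s x) * (w t x + w s x))) (\<lambda>x. w t x - w s x)"
    by (simp only: ip_minus_left)
qed

text \<open>The increment is taken first in \<open>rho\<close>, with \<open>w1\<close> at time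
  \<open>t\<close>, then in \<open>w1\<close>, with \<open>rho\<close> at time \<open>s\<close>.
  Only the second part is integrated by parts, which differentiates \<open>rho\<close> and brings in
  \<open>rho1\<close> and \<open>w2\<close>.\<close>

lemma rho_w1_derivative:
  "((\<lambda>s. ip (\<lambda>x. rho s x * w1 s x) (w1 s)) has_real_derivative
    ip (\<lambda>x. w1 s x * cnj (w1 s x) * (w s x + w s x)
      - (rho1 s x * (w1 s x + w1 s x) + rho s x * (w2 s x + w2 s x))) (z s)) (at s)"
proof (rule Dt_functional[OF Dt_w])
  let ?G1 = "\<lambda>t x. w1 t x * cnj (w1 t x) * (w t x + w s x)"
  let ?G2 = "\<lambda>t x. rho1 s x * (w1 t x + w1 s x) + rho s x * (w2 t x + w2 s x)"
  show "cvL2 (at s) (\<lambda>t x. ?G1 t x - ?G2 t x) (\<lambda>x. w1 s x * cnj (w1 s x) * (w s x + w s x)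
      - (rho1 s x * (w1 s x + w1 s x) + rho s x * (w2 s x + w2 s x)))"
    by (intro cvL2_diff cvL2_add cvL2_Bd_mult cvB_mult cvB_cnj cv_at cv_w cvL2_const cvB_const
        L2_simps Bd_simps Bd_rho1 Bd_defs)
  fix t
  have [simp]: "?G1 t \<in> L2" "?G2 t \<in> L2" "(\<lambda>x. rho s x * (w1 t x + w1 s x)) \<in> L2"
    "(\<lambda>x. rho s x * w1 t' x) \<in> L2" "(\<lambda>x. rho t x * w1 t' x) \<in> L2" for t'
    by (intro L2_add L2_Bd_mult Bd_mult Bd_cnj L2_simps Bd_simps Bd_rho1 Bd_defs)+
  have d [simp]: "(\<lambda>x. w t x - w s x) \<in> L2" "(\<lambda>x. w1 t x - w1 s x) \<in> L2" by (intro L2_diff L2_simps)+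
  have "ip (\<lambda>x. rho t x * w1 t x) (w1 t) - ip (\<lambda>x. rho s x * w1 t x) (w1 t) = ip (?G1 t) (\<lambda>x. w t x - w s x)"
  proof (rule ip_diff_eqI)
    have "Re (a * cnj a * c * cnj c) - Re (b * cnj b * c * cnj c) = Re (c * cnj c * (a + b) * cnj (a - b))"
      for a b c :: complex by (simp add: algebra_simps)
    then show "Re (rho t x * w1 t x * cnj (w1 t x)) - Re (rho s x * w1 t x * cnj (w1 t x))
        = Re (?G1 t x * cnj (w t x - w s x))" for x
      by (simp only: rho_def)
  qed simp_all
  moreover have "ip (\<lambda>x. rho s x * w1 t x) (w1 t) - ip (\<lambda>x. rho s x * w1 s x) (w1 s)
      = ip (\<lambda>x. rho s x * (w1 t x + w1 s x)) (\<lambda>x. w1 t x - w1 s x)"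
  proof (rule ip_diff_eqI)
    have "Re (a * cnj a * b * cnj b) - Re (a * cnj a * c * cnj c) = Re (a * cnj a * (b + c) * cnj (b - c))"
      for a b c :: complex by (simp add: algebra_simps)
    then show "Re (rho s x * w1 t x * cnj (w1 t x)) - Re (rho s x * w1 s x * cnj (w1 s x))
        = Re (rho s x * (w1 t x + w1 s x) * cnj (w1 t x - w1 s x))" for x
      by (simp only: rho_def)
  qed simp_all
  moreover have "ip (\<lambda>x. rho s x * (w1 t x + w1 s x)) (\<lambda>x. w1 t x - w1 s x) = - ip (?G2 t) (\<lambda>x. w t x - w s x)"
    using ip_by_parts[OF wd_diff[OF wd_w[of t] wd_w[of s]] wd_mult_Bd[OF wd_rho[of s] wd_add[OF wd_w1[of t] wd_w1[of s]]]]
    by (simp add: ip_commute[of "\<lambda>x. w1 t x - w1 s x"] ip_commute[of "\<lambda>x. w t x - w s x"])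
  ultimately show "ip (\<lambda>x. rho t x * w1 t x) (w1 t) - ip (\<lambda>x. rho s x * w1 s x) (w1 s)
      = ip (\<lambda>x. ?G1 t x - ?G2 t x) (\<lambda>x. w t x - w s x)"
    by (simp add: ip_diff_left)
qed

lemma cubic_square_derivative:
  "((\<lambda>s. (nrm (cubic s))\<^sup>2) has_real_derivative
    ip (\<lambda>x. (rho s x * rho s x + rho s x * rho s x + rho s x * rho s x) * (w s x + w s x)) (z s)) (at s)"
proof (rule Dt_functional[OF Dt_w])
  let ?G = "\<lambda>t x. (rho t x * rho t x + rho t x * rho s x + rho s x * rho s x) * (w t x + w s x)"
  show "cvL2 (at s) ?G (\<lambda>x. (rho s x * rho s x + rho s x * rho s x + rho s x * rho s x) * (w s x + w s x))"
    by (intro cvL2_Bd_mult cvL2_add cvB_add cvB_mult cv_rho cv_at cv_w cvL2_const cvB_const L2_simps Bd_defs)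
  fix t
  show "(nrm (cubic t))\<^sup>2 - (nrm (cubic s))\<^sup>2 = ip (?G t) (\<lambda>x. w t x - w s x)"
    unfolding ip_self[symmetric]
  proof (rule ip_diff_eqI)
    have "Re (a * cnj a * a * cnj (a * cnj a * a)) - Re (b * cnj b * b * cnj (b * cnj b * b))
      = Re ((a * cnj a * (a * cnj a) + a * cnj a * (b * cnj b) + b * cnj b * (b * cnj b)) * (a + b) * cnj (a - b))"
      for a b :: complex by (simp add: algebra_simps)
    then show "Re (cubic t x * cnj (cubic t x)) - Re (cubic s x * cnj (cubic s x)) = Re (?G t x * cnj (w t x - w s x))" for x
      by (simp only: rho_def cubic_def)
    show "?G t \<in> L2" by (intro L2_Bd_mult Bd_add Bd_mult L2_add L2_simps Bd_defs)
  qed (auto intro: L2_diff)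
qed

definition "second s = (nrm (z s))\<^sup>2 + (nrm (rho1 s))\<^sup>2 / 2 + 2 * ip (\<lambda>x. rho s x * w1 s x) (w1 s)
  - 4 / 3 * (nrm (cubic s))\<^sup>2"

text \<open>The right side of \<open>second_order_cancellation\<close>: free of \<open>w2\<close>,
  and linear in \<open>z\<close> for given \<open>lower\<close>.\<close>

definition "remainder s x = - 4 * Im (cnj (w s x) * lower s x) * Re (cnj (w s x) * z s x)
  + 4 * (cmod (w s x))\<^sup>2 * Re (\<i> * lower s x * cnj (z s x)) - 8 * Re (cnj (w s x) * w1 s x) * Re (w1 s x * cnj (z s x))"

lemma second_derivative:
  "(second has_real_derivative integral\<^sup>L M (remainder s) - 2 * \<gamma> * (nrm (z s))\<^sup>2
    - 2 * \<mu> * (nrm (P m (z s)))\<^sup>2 + 2 * \<mu> * ip (z s) (v1 s)) (at s)"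
  and remainder_integrable: "integrable M (remainder s)"
proof -
  let ?E = "\<lambda>x. \<i> * (cnj (w s x) * (w s x + w s x) * z s x + w s x * w s x * cnj (z s x))"
  let ?G1 = "\<lambda>x. - ((rho2 s x + rho2 s x) * (w s x + w s x))"
  let ?G2 = "\<lambda>x. w1 s x * cnj (w1 s x) * (w s x + w s x)
      - (rho1 s x * (w1 s x + w1 s x) + rho s x * (w2 s x + w2 s x))"
  let ?G3 = "\<lambda>x. (rho s x * rho s x + rho s x * rho s x + rho s x * rho s x) * (w s x + w s x)"
  have deriv: "(second has_real_derivative
      2 * (ip (z s) ?E - \<gamma> * (nrm (z s))\<^sup>2 - \<mu> * (nrm (P m (z s)))\<^sup>2 + \<mu> * ip (z s) (v1 s))
      + ip ?G1 (z s) / 2 + 2 * ip ?G2 (z s) - 4 / 3 * ip ?G3 (z s)) (at s)"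
    unfolding second_def
    by (intro DERIV_add DERIV_diff DERIV_cdivide DERIV_cmult velocity_derivative rho1_square_derivative
        rho_w1_derivative cubic_square_derivative)
  have L: "?E \<in> L2" "?G1 \<in> L2" "?G2 \<in> L2" "?G3 \<in> L2"
    by (intro L2_cmult L2_minus L2_diff L2_add L2_Bd_mult L2_mult_Bd[OF L2_add[OF rho_L2(3) rho_L2(3)]]
        Bd_add Bd_mult Bd_cnj L2_cnj L2_simps Bd_simps Bd_rho1 Bd_defs)+
  let ?R = "\<lambda>x. 2 * Re (z s x * cnj (?E x)) + Re (?G1 x * cnj (z s x)) / 2
      + 2 * Re (?G2 x * cnj (z s x)) - 4 / 3 * Re (?G3 x * cnj (z s x))"
  have int: "integrable M ?R"
    by (intro Bochner_Integration.integrable_add Bochner_Integration.integrable_diff integrable_mult_right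
        integrable_divide ip_integrable L L2_simps)
  have AE: "AE x in M. ?R x = remainder s x"
    using z_eq[of s]
  proof eventually_elim
    case (elim x)
    then have "- \<i> * z s x - \<i> * lower s x = w2 s x + w s x * cnj (w s x) * w s x"
      by (simp add: potential_def cubic_def right_diff_distrib)
    then have "w2 s x = - \<i> * z s x - \<i> * lower s x - w s x * cnj (w s x) * w s x"
      by (simp only: add_diff_cancel_right')
    from second_order_cancellation[OF this, of "w1 s x"] show ?case
      unfolding remainder_def rho_def rho1_def rho2_def by blast
  qed
  have meas: "remainder s \<in> borel_measurable M"
  proof -
    have [measurable]: "w s \<in> borel_measurable M" "w1 s \<in> borel_measurable M"
      "z s \<in> borel_measurable M" "lower s \<in> borel_measurable M"
      by (simp_all add: L2_measurable)
    show ?thesis unfolding remainder_def[abs_def] by measurable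
  qed
  show "integrable M (remainder s)"
    using integrable_cong_AE[OF _ meas AE] int by auto
  have "integral\<^sup>L M (remainder s) = integral\<^sup>L M ?R"
    by (rule integral_cong_AE[OF meas]) (use int AE in \<open>auto elim: eventually_mono\<close>)
  also have "\<dots> = 2 * ip (z s) ?E + ip ?G1 (z s) / 2 + 2 * ip ?G2 (z s) - 4 / 3 * ip ?G3 (z s)"
  proof -
    have *: "(\<integral>x. 2 * A x + B x / 2 + 2 * C x - 4 / 3 * D x \<partial>M)
        = 2 * integral\<^sup>L M A + integral\<^sup>L M B / 2 + 2 * integral\<^sup>L M C - 4 / 3 * integral\<^sup>L M D"
      if "integrable M A" "integrable M B" "integrable M C" "integrable M D" for A B C D :: "real \<Rightarrow> real"
      using that by simp
    show ?thesis
      unfolding ip_eq[OF L2_simps(4) L(1)] ip_eq[OF L(2) L2_simps(4)] ip_eq[OF L(3) L2_simps(4)] ip_eq[OF L(4) L2_simps(4)]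
      by (rule *[OF ip_integrable[OF L2_simps(4) L(1)] ip_integrable[OF L(2) L2_simps(4)]
          ip_integrable[OF L(3) L2_simps(4)] ip_integrable[OF L(4) L2_simps(4)]])
  qed
  finally show "(second has_real_derivative integral\<^sup>L M (remainder s) - 2 * \<gamma> * (nrm (z s))\<^sup>2
    - 2 * \<mu> * (nrm (P m (z s)))\<^sup>2 + 2 * \<mu> * ip (z s) (v1 s)) (at s)"
    by (intro DERIV_cong[OF deriv]) (simp add: algebra_simps)
qed

lemma remainder_le:
  assumes W: "AE x in M. (cmod (w s x))\<^sup>2 \<le> W" "0 \<le> W"
    and Y: "AE x in M. (cmod (w1 s x))\<^sup>2 \<le> Y" "0 \<le> Y"
  shows "integral\<^sup>L M (remainder s)
    \<le> 8 * W * nrm (lower s) * nrm (z s) + 8 * sqrt W * sqrt Y * nrm (w1 s) * nrm (z s)"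
proof -
  have "integral\<^sup>L M (remainder s) \<le> (\<integral>x. 8 * W * (cmod (lower s x) * cmod (z s x))
      + 8 * sqrt W * sqrt Y * (cmod (w1 s x) * cmod (z s x)) \<partial>M)"
  proof (rule integral_mono_AE[OF remainder_integrable])
    show "AE x in M. remainder s x \<le> 8 * W * (cmod (lower s x) * cmod (z s x))
      + 8 * sqrt W * sqrt Y * (cmod (w1 s x) * cmod (z s x))"
      using W(1) Y(1)
    proof eventually_elim
      case (elim x)
      let ?a = "w s x" and ?b = "w1 s x" and ?g = "lower s x" and ?y = "z s x"
      have a: "cmod ?a \<le> sqrt W" "cmod ?b \<le> sqrt Y" using elim by (auto intro: real_le_rsqrt)
      have "- 4 * Im (cnj ?a * ?g) * Re (cnj ?a * ?y) \<le> 4 * ((cmod ?a * cmod ?g) * (cmod ?a * cmod ?y))"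
      proof -
        have "\<bar>Im (cnj ?a * ?g) * Re (cnj ?a * ?y)\<bar> \<le> (cmod ?a * cmod ?g) * (cmod ?a * cmod ?y)"
          unfolding abs_mult
          using abs_Im_le_cmod[of "cnj ?a * ?g"] abs_Re_le_cmod[of "cnj ?a * ?y"]
          by (intro mult_mono) (simp_all only: norm_mult complex_mod_cnj abs_ge_zero mult_nonneg_nonneg norm_ge_zero)
        then show ?thesis by linarith
      qed
      also have "\<dots> = 4 * (cmod ?a)\<^sup>2 * (cmod ?g * cmod ?y)" by (simp add: power2_eq_square)
      also have "\<dots> \<le> 4 * W * (cmod ?g * cmod ?y)" using elim by (intro mult_right_mono) auto
      finally have 1: "- 4 * Im (cnj ?a * ?g) * Re (cnj ?a * ?y) \<le> 4 * W * (cmod ?g * cmod ?y)" .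
      have "4 * (cmod ?a)\<^sup>2 * Re (\<i> * ?g * cnj ?y) \<le> 4 * (cmod ?a)\<^sup>2 * (cmod ?g * cmod ?y)"
        using complex_Re_le_cmod[of "\<i> * ?g * cnj ?y"] by (intro mult_left_mono) (simp_all add: norm_mult)
      also have "\<dots> \<le> 4 * W * (cmod ?g * cmod ?y)" using elim by (intro mult_right_mono) auto
      finally have 2: "4 * (cmod ?a)\<^sup>2 * Re (\<i> * ?g * cnj ?y) \<le> 4 * W * (cmod ?g * cmod ?y)" .
      have "- (Re (cnj ?a * ?b) * Re (?b * cnj ?y)) \<le> (cmod ?a * cmod ?b) * (cmod ?b * cmod ?y)"
      proof -
        have "\<bar>Re (cnj ?a * ?b) * Re (?b * cnj ?y)\<bar> \<le> (cmod ?a * cmod ?b) * (cmod ?b * cmod ?y)"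
          unfolding abs_mult
          using abs_Re_le_cmod[of "cnj ?a * ?b"] abs_Re_le_cmod[of "?b * cnj ?y"]
          by (intro mult_mono) (simp_all only: norm_mult complex_mod_cnj abs_ge_zero mult_nonneg_nonneg norm_ge_zero)
        then show ?thesis by linarith
      qed
      also have "\<dots> \<le> (sqrt W * sqrt Y) * (cmod ?b * cmod ?y)"
        using a W(2) by (intro mult_right_mono mult_mono) auto
      finally have 3: "- (Re (cnj ?a * ?b) * Re (?b * cnj ?y)) \<le> (sqrt W * sqrt Y) * (cmod ?b * cmod ?y)" .
      show ?case using 1 2 3 unfolding remainder_def mult.assoc by linarith
    qed
  qed simp
  also have "\<dots> = 8 * W * (\<integral>x. cmod (lower s x) * cmod (z s x) \<partial>M)
      + 8 * sqrt W * sqrt Y * (\<integral>x. cmod (w1 s x) * cmod (z s x) \<partial>M)"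
    by (simp add: mult.assoc)
  also have "\<dots> \<le> 8 * W * (nrm (lower s) * nrm (z s)) + 8 * sqrt W * sqrt Y * (nrm (w1 s) * nrm (z s))"
    using W(2) Y(2) by (intro add_mono mult_left_mono integral_norm_mult_le) simp_all
  finally show ?thesis by (simp add: mult.assoc)
qed

text \<open>The equation allows \<open>w2\<close> and \<open>z\<close> to be exchanged at the cost
  of lower order terms.\<close>

lemma w2_le: "nrm (w2 s) \<le> nrm (z s) + nrm (lower s) + nrm (cubic s)"
  and z_le: "nrm (z s) \<le> nrm (w2 s) + nrm (cubic s) + nrm (lower s)"
proof -
  have "nrm (\<lambda>x. \<i> * w2 s x) = nrm (\<lambda>x. z s x + lower s x - \<i> * cubic s x)"
    by (rule nrm_cong_AE) (use z_eq[of s] in \<open>auto elim!: eventually_mono intro!: L2_intros simp: potential_def algebra_simps\<close>)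
  also have "\<dots> \<le> nrm (\<lambda>x. z s x + lower s x) + nrm (\<lambda>x. \<i> * cubic s x)"
    by (intro nrm_triangle_diff L2_add L2_cmult) simp_all
  also have "\<dots> \<le> nrm (z s) + nrm (lower s) + nrm (cubic s)"
    using nrm_triangle[of "z s" "lower s"] by (simp add: nrm_cmult)
  finally show "nrm (w2 s) \<le> nrm (z s) + nrm (lower s) + nrm (cubic s)" by (simp add: nrm_cmult)
  have "nrm (z s) = nrm (\<lambda>x. \<i> * potential s x - lower s x)"
    by (rule nrm_cong_AE[OF z_eq]) (auto intro!: L2_intros)
  also have "\<dots> \<le> nrm (\<lambda>x. \<i> * potential s x) + nrm (lower s)"
    by (intro nrm_triangle_diff L2_cmult) simp_all
  also have "\<dots> \<le> nrm (w2 s) + nrm (cubic s) + nrm (lower s)"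
    using nrm_triangle[of "w2 s" "cubic s"] by (simp add: nrm_cmult potential_def[abs_def])
  finally show "nrm (z s) \<le> nrm (w2 s) + nrm (cubic s) + nrm (lower s)" .
qed

text \<open>Of the dissipation 2 \<gamma> |z|^2 one half reproduces \<gamma> times the energy, and
  three quarters of the other half pay for the Young inequalities \<open>y1\<close>,
  \<open>y2\<close>, \<open>y3\<close>. The sup bound of \<open>w1\<close> involves |w2| and hence
  |z| itself, so the last part of the remainder grows like |z|^(3/2) and takes two of them.\<close>

lemma second_estimate:
  fixes a X :: real
  assumes a: "\<And>s. nrm (w s) \<le> a" and X: "\<And>s. nrm (w1 s) \<le> X"
  defines "W \<equiv> a\<^sup>2 / L + 2 * a * X" and "g \<equiv> (\<gamma> + \<mu>) * a + (nrm f + \<mu> * V)"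
  shows "(nrm (z s))\<^sup>2 \<le> ((2 * \<mu> * V + 8 * W * g)\<^sup>2 / \<gamma> + 64 / \<gamma> * (W * X\<^sup>2 * (X\<^sup>2 / L + 2 * X * (g + W * a)))
      + 16384 / \<gamma>^3 * (W\<^sup>2 * X^6) + 4 * \<gamma> * (W * X\<^sup>2)) / \<gamma> + 4 / 3 * (W * a)\<^sup>2"
proof -
  have a0: "0 \<le> a" using order_trans[OF nrm_ge0 a] .
  have X0: "0 \<le> X" using order_trans[OF nrm_ge0 X] .
  have W0: "0 \<le> W" using a0 X0 L_pos by (simp add: W_def)
  have lower: "nrm (lower s) \<le> g" for s unfolding g_def by (rule lower_le[OF a])
  have g0: "0 \<le> g" using order_trans[OF nrm_ge0 lower] .
  have sup: "AE x in M. (cmod (w s x))\<^sup>2 \<le> W" for s unfolding W_def by (rule w_sup[OF a X])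
  have cub: "nrm (cubic s) \<le> W * a" for s by (rule cubic_le[OF a sup W0])
  define R where "R = g + W * a"
  have R0: "0 \<le> R" using g0 W0 a0 by (simp add: R_def)
  define K where "K = (2 * \<mu> * V + 8 * W * g)\<^sup>2 / \<gamma> + 64 / \<gamma> * (W * X\<^sup>2 * (X\<^sup>2 / L + 2 * X * R))
      + 16384 / \<gamma>^3 * (W\<^sup>2 * X^6) + 4 * \<gamma> * (W * X\<^sup>2)"
  have cubsq: "(nrm (cubic s))\<^sup>2 \<le> (W * a)\<^sup>2" for s by (intro power_mono cub) simp
  have upper: "second s \<le> (nrm (z s))\<^sup>2 + 4 * (W * X\<^sup>2)" for s
  proof -
    have s: "AE x in M. cmod (w s x) \<le> sqrt W" using sup[of s] by eventually_elim (rule real_le_rsqrt)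
    have "nrm (rho1 s) \<le> nrm (\<lambda>x. w1 s x * cnj (w s x)) + nrm (\<lambda>x. w s x * cnj (w1 s x))"
      unfolding rho1_def by (intro nrm_triangle L2_mult_Bd L2_Bd_mult L2_cnj Bd_cnj L2_simps Bd_simps)
    moreover have "nrm (\<lambda>x. w s x * cnj (w1 s x)) \<le> sqrt W * nrm (w1 s)"
    proof -
      have "nrm (\<lambda>x. w s x * cnj (w1 s x)) \<le> sqrt W * nrm (\<lambda>x. cnj (w1 s x))"
        using W0 by (intro nrm_mult_le[OF _ s] L2_cnj) (simp_all add: L2_measurable)
      also have "nrm (\<lambda>x. cnj (w1 s x)) = nrm (w1 s)" unfolding nrm_def by simp
      finally show ?thesis .
    qed
    moreover have "nrm (\<lambda>x. w1 s x * cnj (w s x)) = nrm (\<lambda>x. w s x * cnj (w1 s x))"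
      unfolding nrm_def by (simp add: norm_mult mult.commute)
    moreover have "sqrt W * nrm (w1 s) \<le> sqrt W * X" using X W0 by (intro mult_left_mono) auto
    ultimately have "nrm (rho1 s) \<le> 2 * (sqrt W * X)" by linarith
    then have "(nrm (rho1 s))\<^sup>2 \<le> (2 * (sqrt W * X))\<^sup>2" by (intro power_mono) auto
    also have "\<dots> = 4 * (W * X\<^sup>2)" using W0 by (simp add: power_mult_distrib)
    finally have 1: "(nrm (rho1 s))\<^sup>2 \<le> 4 * (W * X\<^sup>2)" .
    have "ip (\<lambda>x. rho s x * w1 s x) (w1 s) \<le> nrm (\<lambda>x. rho s x * w1 s x) * nrm (w1 s)"
      by (intro ip_le L2_Bd_mult) simp_all
    also have "\<dots> \<le> (W * nrm (w1 s)) * nrm (w1 s)"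
    proof (intro mult_right_mono nrm_mult_le)
      show "AE x in M. cmod (rho s x) \<le> W"
        using sup[of s] by eventually_elim (simp add: rho_def norm_mult power2_eq_square)
    qed (simp_all add: W0 L2_measurable)
    also have "\<dots> = W * (nrm (w1 s))\<^sup>2" by (simp add: power2_eq_square)
    also have "\<dots> \<le> W * X\<^sup>2" using W0 X by (intro mult_left_mono power_mono) auto
    finally show ?thesis using 1 zero_le_power2[of "nrm (cubic s)"] unfolding second_def by linarith
  qed
  have zb: "\<exists>B. \<forall>s. nrm (z s) \<le> B"
  proof -
    obtain B where "\<And>s. nrm (w2 s) \<le> B" using bounded by blast
    then have "nrm (z s) \<le> B + W * a + g" for s using z_le[of s] cub[of s] lower[of s] by (meson add_mono order_trans)
    then show ?thesis by blast
  qed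
  then obtain B where B: "\<And>s. nrm (z s) \<le> B" by blast
  have bdd: "second s \<le> B\<^sup>2 + 4 * (W * X\<^sup>2)" for s
    using upper[of s] power_mono[OF B nrm_ge0, of s 2] by linarith
  have "second s \<le> K / \<gamma>"
  proof (rule bounded_ancient_le[OF second_derivative _ \<gamma> bdd])
    fix s
    let ?\<zeta> = "nrm (z s)"
    define Y where "Y = X\<^sup>2 / L + 2 * X * (?\<zeta> + R)"
    have Y0: "0 \<le> Y" using X0 R0 L_pos by (simp add: Y_def)
    have "AE x in M. (cmod (w1 s x))\<^sup>2 \<le> Y"
    proof -
      have "nrm (w2 s) \<le> ?\<zeta> + R" using w2_le[of s] lower[of s] cub[of s] by (simp add: R_def)
      then have "(nrm (w1 s))\<^sup>2 / L + 2 * nrm (w1 s) * nrm (w2 s) \<le> Y"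
        unfolding Y_def using X X0 L_pos
        by (intro add_mono divide_right_mono power_mono mult_mono) auto
      with agmon[OF wd_w1[of s]] show ?thesis by (auto elim: eventually_mono)
    qed
    from remainder_le[OF sup W0 this Y0]
    have "integral\<^sup>L M (remainder s) \<le> 8 * W * nrm (lower s) * ?\<zeta> + 8 * sqrt W * sqrt Y * nrm (w1 s) * ?\<zeta>" .
    also have "\<dots> \<le> 8 * W * g * ?\<zeta> + 8 * sqrt W * sqrt Y * X * ?\<zeta>"
      using W0 Y0 lower X by (intro add_mono mult_right_mono mult_left_mono) auto
    finally have rem: "integral\<^sup>L M (remainder s) \<le> 8 * W * g * ?\<zeta> + 8 * (sqrt W * sqrt Y * X * ?\<zeta>)" by simp
    have "ip (z s) (v1 s) \<le> ?\<zeta> * V"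
      by (rule order_trans[OF ip_le]) (auto intro!: mult_left_mono v1_le)
    then have v1: "2 * \<mu> * ip (z s) (v1 s) \<le> 2 * \<mu> * (?\<zeta> * V)" using \<mu> by simp
    have young: "2 * p * q \<le> \<gamma> / 4 * q\<^sup>2 + 4 / \<gamma> * p\<^sup>2" for p q
    proof -
      have "0 \<le> (sqrt \<gamma> / 2 * q - 2 / sqrt \<gamma> * p)\<^sup>2" by simp
      also have "\<dots> = \<gamma> / 4 * q\<^sup>2 + 4 / \<gamma> * p\<^sup>2 - 2 * p * q"
        using \<gamma> by (simp add: power2_diff power_mult_distrib power_divide)
      finally show ?thesis by simp
    qed
    have y1: "(2 * \<mu> * V + 8 * W * g) * ?\<zeta> \<le> \<gamma> / 4 * ?\<zeta>\<^sup>2 + (2 * \<mu> * V + 8 * W * g)\<^sup>2 / \<gamma>"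
    proof -
      have "p * q \<le> \<gamma> / 4 * q\<^sup>2 + p\<^sup>2 / \<gamma>" for p q
        using young[of "p / 2" q] by (simp add: power_divide)
      then show ?thesis .
    qed
    have y2: "8 * (sqrt W * sqrt Y * X * ?\<zeta>) \<le> \<gamma> / 4 * ?\<zeta>\<^sup>2 + 64 / \<gamma> * (W * X\<^sup>2 * Y)"
      using young[of "4 * (sqrt W * sqrt Y * X)" ?\<zeta>] W0 Y0 by (simp add: power_mult_distrib mult_ac)
    \<comment> \<open>Only the part of \<open>Y\<close> that is linear in |z| needs Young again;
      16384 = 4 * 64^2.\<close>
    have y3: "64 / \<gamma> * (W * X\<^sup>2 * Y) \<le> 64 / \<gamma> * (W * X\<^sup>2 * (X\<^sup>2 / L + 2 * X * R)) + \<gamma> / 4 * ?\<zeta>\<^sup>2 + 16384 / \<gamma>^3 * (W\<^sup>2 * X^6)"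
    proof -
      have "64 / \<gamma> * (W * X\<^sup>2 * Y) = 64 / \<gamma> * (W * X\<^sup>2 * (X\<^sup>2 / L + 2 * X * R)) + 2 * (64 / \<gamma> * (W * X^3)) * ?\<zeta>"
        unfolding Y_def by (simp add: algebra_simps power2_eq_square power3_eq_cube)
      moreover have "4 / \<gamma> * (64 / \<gamma> * (W * X^3))\<^sup>2 = 16384 / \<gamma>^3 * (W\<^sup>2 * X^6)"
        by (simp add: power_mult_distrib power_divide power3_eq_cube[of \<gamma>] power2_eq_square[of \<gamma>] flip: power_mult)
      ultimately show ?thesis using young[of "64 / \<gamma> * (W * X^3)" ?\<zeta>] by simp
    qed
    have "0 \<le> 2 * \<mu> * (nrm (P m (z s)))\<^sup>2" using \<mu> by simp
    moreover have "\<gamma> * second s \<le> \<gamma> * (?\<zeta>\<^sup>2 + 4 * (W * X\<^sup>2))" using \<gamma> upper[of s] by (intro mult_left_mono) auto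
    moreover have "0 \<le> \<gamma> * ?\<zeta>\<^sup>2" using \<gamma> by simp
    ultimately show "integral\<^sup>L M (remainder s) - 2 * \<gamma> * ?\<zeta>\<^sup>2 - 2 * \<mu> * (nrm (P m (z s)))\<^sup>2 + 2 * \<mu> * ip (z s) (v1 s)
        \<le> K - \<gamma> * second s"
      using rem v1 y1 y2 y3 unfolding K_def by (simp add: algebra_simps)
  qed
  moreover have "0 \<le> ip (\<lambda>x. rho s x * w1 s x) (w1 s)"
  proof -
    have "Re (rho s x * w1 s x * cnj (w1 s x)) = (cmod (w s x))\<^sup>2 * (cmod (w1 s x))\<^sup>2" for x
      by (simp add: rho_def cmod_power2) (simp add: power2_eq_square algebra_simps)
    then show ?thesis by (simp add: ip_eq L2_Bd_mult)
  qed
  ultimately have "(nrm (z s))\<^sup>2 \<le> K / \<gamma> + 4 / 3 * (nrm (cubic s))\<^sup>2"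
    unfolding second_def using zero_le_power2[of "nrm (rho1 s)"] by linarith
  then show ?thesis using cubsq[of s] unfolding K_def R_def by linarith
qed

section \<open>Powers of 1 + \<mu> in the two estimates\<close>

text \<open>One constant \<open>c\<close> majorises the parameters, so that only powers of 1 + \<mu>
  and 1 + a remain visible. A factor (\<gamma> + \<mu>) / \<kappa> is kept: it is of order \<mu> for
  \<kappa> = \<gamma> and equals 1 for \<kappa> = \<gamma> + \<mu>, which is the gain of the second
  round. The number 34 is 4 + 5 + 9 + 12 + 4.\<close>

lemma first_bound:
  fixes a c \<kappa> :: real
  assumes a: "\<And>s. nrm (w s) \<le> a" and \<kappa>: "0 < \<kappa>" "\<kappa> \<le> \<gamma> + \<mu>" and q: "0 \<le> q" "q \<le> 1"
    and dissipation: "\<And>s. \<kappa> * (nrm (w1 s))\<^sup>2 - \<mu> * q \<le> \<gamma> * (nrm (w1 s))\<^sup>2 + \<mu> * (nrm (P m (w1 s)))\<^sup>2"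
    and c: "1 \<le> c" "1 / L \<le> c" "nrm f \<le> c" "V \<le> c"
    and \<theta>: "(\<gamma> + \<mu>) / \<kappa> \<le> c * (1 + \<mu>)"
  shows "(nrm (w1 s))\<^sup>2 \<le> 34 * c * ((\<gamma> + \<mu>) / \<kappa>) * (1 + \<mu>) * (1 + a)^6"
proof -
  define \<theta> where "\<theta> = (\<gamma> + \<mu>) / \<kappa>"
  define T where "T = 1 + \<mu>"
  define b where "b = 1 + a"
  have a0: "0 \<le> a" using order_trans[OF nrm_ge0 a] .
  have ab: "a \<le> b" and b1: "1 \<le> b" and T1: "1 \<le> T" using a0 \<mu> by (auto simp: b_def T_def)
  have \<theta>1: "1 \<le> \<theta>" using \<kappa> by (simp add: \<theta>_def)
  have \<theta>T: "\<theta> \<le> c * T" using \<theta> by (simp add: \<theta>_def T_def)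
  have H: "nrm f + \<mu> * V \<le> c * T"
  proof -
    have "nrm f + \<mu> * V \<le> c + \<mu> * c" using c \<mu> by (intro add_mono mult_left_mono) auto
    then show ?thesis by (simp add: T_def algebra_simps)
  qed
  have H0: "0 \<le> nrm f + \<mu> * V" using \<mu> V_ge0 by simp
  have cT: "1 \<le> c * T" using c(1) T1 mult_mono[of 1 c 1 T] by simp
  have b6: "1 \<le> b^6" "b \<le> b^6" "b^4 \<le> b^6"
    using b1 power_increasing[of 1 6 b] power_increasing[of 4 6 b] by (auto simp: one_le_power)
  have 1: "\<theta> * q \<le> \<theta> * (c * T * b^6)"
    using \<theta>1 q cT b6(1) mult_mono[of 1 "c * T" 1 "b^6"] by (intro mult_left_mono) auto
  have 2: "\<theta> * a^4 / L \<le> \<theta> * (c * T * b^6)"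
  proof -
    have "a^4 * (1 / L) \<le> b^6 * (c * T)"
    proof (rule mult_mono)
      show "a^4 \<le> b^6" using power_mono[OF ab a0, of 4] b6(3) by simp
      show "1 / L \<le> c * T" using c(1,2) T1 mult_left_mono[of 1 T c] by linarith
    qed (use L_pos b6(1) in auto)
    then have "\<theta> * (a^4 * (1 / L)) \<le> \<theta> * (b^6 * (c * T))" using \<theta>1 by (intro mult_left_mono) auto
    then show ?thesis by (simp add: mult_ac)
  qed
  have 3: "\<theta>\<^sup>2 * a^6 \<le> \<theta> * (c * T * b^6)"
  proof -
    have "\<theta> * a^6 \<le> (c * T) * b^6"
      using \<theta>T \<theta>1 power_mono[OF ab a0, of 6] cT by (intro mult_mono) auto
    then have "\<theta> * (\<theta> * a^6) \<le> \<theta> * (c * T * b^6)" using \<theta>1 by (intro mult_left_mono) auto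
    then show ?thesis by (simp add: power2_eq_square mult.assoc)
  qed
  have 4: "\<theta> * a * (nrm f + \<mu> * V) \<le> \<theta> * (c * T * b^6)"
  proof -
    have "a * (nrm f + \<mu> * V) \<le> b^6 * (c * T)"
      using ab b6(2) H H0 a0 b1 by (intro mult_mono) auto
    then have "\<theta> * (a * (nrm f + \<mu> * V)) \<le> \<theta> * (b^6 * (c * T))" using \<theta>1 by (intro mult_left_mono) auto
    then show ?thesis by (simp only: mult_ac)
  qed
  have 5: "\<theta> * a * V \<le> \<theta> * (c * T * b^6)"
  proof -
    have "V \<le> c * T" using c(1,4) T1 mult_left_mono[of 1 T c] by linarith
    then have "a * V \<le> b^6 * (c * T)"
      using ab b6(2) V_ge0 a0 b1 by (intro mult_mono) auto
    then have "\<theta> * (a * V) \<le> \<theta> * (b^6 * (c * T))" using \<theta>1 by (intro mult_left_mono) auto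
    then show ?thesis by (simp only: mult_ac)
  qed
  have "(nrm (w1 s))\<^sup>2 \<le> 4 * \<theta> * q + 5 * \<theta> * a^4 / L + 9 * \<theta>\<^sup>2 * a^6
      + 12 * \<theta> * a * (nrm f + \<mu> * V) + 4 * \<theta> * a * V"
    unfolding \<theta>_def by (rule energy_estimate[OF a q(1) \<kappa> dissipation])
  also have "\<dots> = 4 * (\<theta> * q) + 5 * (\<theta> * a^4 / L) + 9 * (\<theta>\<^sup>2 * a^6)
      + 12 * (\<theta> * a * (nrm f + \<mu> * V)) + 4 * (\<theta> * a * V)" by simp
  also have "\<dots> \<le> 34 * (\<theta> * (c * T * b^6))" using 1 2 3 4 5 by linarith
  also have "\<dots> = 34 * c * \<theta> * T * b^6" by simp
  finally show ?thesis unfolding \<theta>_def T_def b_def .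
qed

text \<open>The number \<open>x\<close> records the size of \<open>w1\<close>: it is 1 + \<mu> in
  the first round and the square root of 1 + \<mu> in the second. Every term is majorised by a
  monomial d^i x^j, and monomials are compared by raising exponents.\<close>

lemma second_bound:
  fixes d x :: real
  assumes d: "1 \<le> d" "1 / L \<le> d" "\<gamma> \<le> d" "1 / \<gamma> \<le> d" "nrm f \<le> d" "V \<le> d"
    and x: "1 \<le> x" "1 + \<mu> \<le> x\<^sup>2"
    and a: "\<And>s. nrm (w s) \<le> d" and X: "\<And>s. nrm (w1 s) \<le> d * x"
  shows "nrm (z s) \<le> 390 * d^8 * x^4" "nrm (w2 s) \<le> 395 * d^8 * x^4"
proof -
  define X where "X = d * x"
  define W where "W = d\<^sup>2 / L + 2 * d * X"
  define g where "g = (\<gamma> + \<mu>) * d + (nrm f + \<mu> * V)"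
  have d0: "0 \<le> d" and x0: "0 \<le> x" using d x by auto
  have X0: "0 \<le> X" using d0 x0 by (simp add: X_def)
  have W0: "0 \<le> W" using d0 X0 L_pos by (simp add: W_def)
  have g0: "0 \<le> g" using d0 \<gamma> \<mu> V_ge0 by (simp add: g_def)
  have mon: "d^i * x^j \<le> d^k * x^l" if "i \<le> k" "j \<le> l" for i j k l
    using that d x by (intro mult_mono power_increasing) auto
  have pos: "0 \<le> d^i * x^j" for i j using d0 x0 by simp
  have W: "W \<le> 3 * (d^3 * x^1)"
  proof -
    have "d\<^sup>2 * (1 / L) \<le> d\<^sup>2 * d" using d by (intro mult_left_mono) auto
    also have "\<dots> = d^3 * x^0" by (simp add: power2_eq_square power3_eq_cube)
    also have "\<dots> \<le> d^3 * x^1" by (rule mon) auto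
    finally have "d\<^sup>2 / L \<le> d^3 * x^1" by simp
    moreover have "2 * d * X = 2 * (d^2 * x^1)" by (simp add: X_def power2_eq_square)
    moreover have "d^2 * x^1 \<le> d^3 * x^1" by (rule mon) auto
    ultimately show ?thesis unfolding W_def by linarith
  qed
  have \<mu>x: "\<mu> \<le> x\<^sup>2" using x by linarith
  have g: "g \<le> 2 * (d^2 * x^2)"
  proof -
    have "\<gamma> + \<mu> \<le> d * x\<^sup>2"
    proof -
      have "\<gamma> + \<mu> \<le> d + \<mu>" using d by simp
      also have "\<dots> \<le> d * (1 + \<mu>)" using d \<mu> by (simp add: algebra_simps)
      also have "\<dots> \<le> d * x\<^sup>2" using d x by (intro mult_left_mono) auto
      finally show ?thesis .
    qed
    then have "(\<gamma> + \<mu>) * d \<le> (d * x\<^sup>2) * d" using d0 by (rule mult_right_mono)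
    moreover have "nrm f + \<mu> * V \<le> d * x\<^sup>2"
    proof -
      have "nrm f + \<mu> * V \<le> d + \<mu> * d" using d \<mu> by (intro add_mono mult_left_mono) auto
      also have "\<dots> = d * (1 + \<mu>)" by (simp add: algebra_simps)
      also have "\<dots> \<le> d * x\<^sup>2" using d x by (intro mult_left_mono) auto
      finally show ?thesis .
    qed
    moreover have "d^1 * x^2 \<le> d^2 * x^2" by (rule mon) auto
    ultimately show ?thesis unfolding g_def by (simp add: power2_eq_square mult_ac)
  qed
  have cub: "g + W * d \<le> 5 * (d^4 * x^2)"
  proof -
    have "W * d \<le> 3 * (d^3 * x^1) * d" using W d0 by (rule mult_right_mono)
    also have "\<dots> = 3 * (d^4 * x^1)" by (simp add: power3_eq_cube power4_eq_xxxx)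
    finally have "W * d \<le> 3 * (d^4 * x^1)" .
    moreover have "d^2 * x^2 \<le> d^4 * x^2" "d^4 * x^1 \<le> d^4 * x^2" by (rule mon; simp)+
    ultimately show ?thesis using g by linarith
  qed
  have WX: "W * X\<^sup>2 \<le> 3 * (d^5 * x^3)"
  proof -
    have "W * X\<^sup>2 \<le> 3 * (d^3 * x^1) * X\<^sup>2" using W by (rule mult_right_mono) simp
    also have "\<dots> = 3 * (d^5 * x^3)" by (simp add: X_def power_mult_distrib flip: power_add)
        (simp add: power2_eq_square power3_eq_cube eval_nat_numeral mult_ac)
    finally show ?thesis .
  qed
  have t1: "(2 * \<mu> * V + 8 * W * g)\<^sup>2 / \<gamma> \<le> 2500 * (d^15 * x^8)"
  proof -
    have "\<mu> * V \<le> x\<^sup>2 * d" using \<mu> \<mu>x d V_ge0 by (intro mult_mono) auto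
    also have "\<dots> = d^1 * x^2" by simp
    also have "\<dots> \<le> d^5 * x^3" by (rule mon) auto
    finally have "\<mu> * V \<le> d^5 * x^3" .
    moreover have "W * g \<le> (3 * (d^3 * x^1)) * (2 * (d^2 * x^2))"
      using W g W0 g0 pos[of 3 1] by (intro mult_mono) auto
    moreover have "(3 * (d^3 * x^1)) * (2 * (d^2 * x^2)) = 6 * (d^5 * x^3)"
      by (simp add: eval_nat_numeral mult_ac)
    ultimately have "2 * \<mu> * V + 8 * W * g \<le> 50 * (d^5 * x^3)" by linarith
    then have "(2 * \<mu> * V + 8 * W * g)\<^sup>2 \<le> (50 * (d^5 * x^3))\<^sup>2"
      using \<mu> V_ge0 W0 g0 by (intro power_mono) auto
    also have "\<dots> = 2500 * (d^10 * x^6)" by (simp add: power_mult_distrib flip: power_mult)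
    finally have "(2 * \<mu> * V + 8 * W * g)\<^sup>2 * (1 / \<gamma>) \<le> 2500 * (d^10 * x^6) * d"
      using d \<gamma> pos[of 10 6] by (intro mult_mono) auto
    also have "\<dots> = 2500 * (d^11 * x^6)" by (simp add: eval_nat_numeral mult_ac)
    also have "\<dots> \<le> 2500 * (d^15 * x^8)" using mon[of 11 15 6 8] by simp
    finally show ?thesis by simp
  qed
  have t2: "64 / \<gamma> * (W * X\<^sup>2 * (X\<^sup>2 / L + 2 * X * (g + W * d))) \<le> 2112 * (d^15 * x^8)"
  proof -
    have "X\<^sup>2 / L + 2 * X * (g + W * d) \<le> 11 * (d^5 * x^3)"
    proof -
      have "X\<^sup>2 * (1 / L) \<le> X\<^sup>2 * d" using d by (intro mult_left_mono) auto
      also have "\<dots> = d^3 * x^2" by (simp add: X_def power_mult_distrib eval_nat_numeral mult_ac)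
      also have "\<dots> \<le> d^5 * x^3" by (rule mon) auto
      finally have "X\<^sup>2 / L \<le> d^5 * x^3" by simp
      moreover have "X * (g + W * d) \<le> X * (5 * (d^4 * x^2))" using cub X0 by (rule mult_left_mono)
      moreover have "X * (5 * (d^4 * x^2)) = 5 * (d^5 * x^3)" by (simp add: X_def eval_nat_numeral mult_ac)
      ultimately show ?thesis by linarith
    qed
    then have "W * X\<^sup>2 * (X\<^sup>2 / L + 2 * X * (g + W * d)) \<le> 3 * (d^5 * x^3) * (11 * (d^5 * x^3))"
      using W0 X0 g0 d0 L_pos pos[of 5 3] by (intro mult_mono[OF WX]) auto
    also have "\<dots> = 33 * (d^10 * x^6)" by (simp add: eval_nat_numeral mult_ac)
    finally have "(1 / \<gamma>) * (W * X\<^sup>2 * (X\<^sup>2 / L + 2 * X * (g + W * d))) \<le> d * (33 * (d^10 * x^6))"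
      using W0 X0 g0 d0 L_pos \<gamma> by (intro mult_mono[OF d(4)]) auto
    also have "\<dots> = 33 * (d^11 * x^6)" by (simp add: eval_nat_numeral mult_ac)
    also have "\<dots> \<le> 33 * (d^15 * x^8)" using mon[of 11 15 6 8] by simp
    finally show ?thesis by simp
  qed
  \<comment> \<open>The only term that attains x^8 before exponents are raised; it determines the
    power x^4 of the result.\<close>
  have t3: "16384 / \<gamma>^3 * (W\<^sup>2 * X^6) \<le> 147456 * (d^15 * x^8)"
  proof -
    have "W\<^sup>2 * X^6 \<le> (3 * (d^3 * x^1))\<^sup>2 * X^6" using W W0 X0 by (intro mult_right_mono power_mono) auto
    also have "\<dots> = 9 * (d^12 * x^8)" by (simp add: X_def power_mult_distrib eval_nat_numeral mult_ac)
    finally have "(1 / \<gamma>)^3 * (W\<^sup>2 * X^6) \<le> d^3 * (9 * (d^12 * x^8))"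
      using d(4) \<gamma> W0 X0 d0 by (intro mult_mono[OF power_mono[OF d(4)]]) auto
    also have "\<dots> = 9 * (d^15 * x^8)" by (simp add: eval_nat_numeral mult_ac)
    finally show ?thesis by (simp add: power_divide)
  qed
  have t4: "4 * \<gamma> * (W * X\<^sup>2) \<le> 12 * (d^15 * x^8)"
  proof -
    have "\<gamma> * (W * X\<^sup>2) \<le> d * (3 * (d^5 * x^3))" using d(3) \<gamma> W0 d0 by (intro mult_mono[OF d(3) WX]) auto
    also have "\<dots> = 3 * (d^6 * x^3)" by (simp add: eval_nat_numeral mult_ac)
    also have "\<dots> \<le> 3 * (d^15 * x^8)" using mon[of 6 15 3 8] by simp
    finally show ?thesis unfolding mult.assoc by linarith
  qed
  have t5: "(W * d)\<^sup>2 \<le> 9 * (d^16 * x^8)"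
  proof -
    have "(W * d)\<^sup>2 \<le> (3 * (d^3 * x^1) * d)\<^sup>2" using W W0 d0 by (intro power_mono mult_right_mono) auto
    also have "\<dots> = 9 * (d^8 * x^2)" by (simp add: power_mult_distrib eval_nat_numeral mult_ac)
    also have "\<dots> \<le> 9 * (d^16 * x^8)" using mon[of 8 16 2 8] by simp
    finally show ?thesis .
  qed
  have \<zeta>: "nrm (z s) \<le> 390 * (d^8 * x^4)" for s
  proof (rule power2_le_imp_le)
    \<comment> \<open>The constants of \<open>t1\<close> to \<open>t4\<close> add up to 152080, and
      with 4/3 * 9 from \<open>t5\<close> the total stays below 152100 = 390^2.\<close>
    define K where "K = (2 * \<mu> * V + 8 * W * g)\<^sup>2 / \<gamma> + 64 / \<gamma> * (W * X\<^sup>2 * (X\<^sup>2 / L + 2 * X * (g + W * d)))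
      + 16384 / \<gamma>^3 * (W\<^sup>2 * X^6) + 4 * \<gamma> * (W * X\<^sup>2)"
    have "(nrm (z s))\<^sup>2 \<le> K / \<gamma> + 4 / 3 * (W * d)\<^sup>2"
      unfolding K_def W_def g_def by (rule second_estimate[OF a X[folded X_def]])
    moreover have "K * (1 / \<gamma>) \<le> 152080 * (d^15 * x^8) * d"
    proof (rule mult_mono)
      show "K \<le> 152080 * (d^15 * x^8)" unfolding K_def using t1 t2 t3 t4 by linarith
    qed (use d \<gamma> d0 x0 in auto)
    moreover have "152080 * (d^15 * x^8) * d = 152080 * (d^16 * x^8)" by (simp add: eval_nat_numeral mult_ac)
    moreover have "K * (1 / \<gamma>) = K / \<gamma>" by simp
    ultimately have "(nrm (z s))\<^sup>2 \<le> 152100 * (d^16 * x^8)" using t5 pos[of 16 8] by linarith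
    also have "\<dots> = (390 * (d^8 * x^4))\<^sup>2" by (simp add: power_mult_distrib flip: power_mult)
    finally show "(nrm (z s))\<^sup>2 \<le> (390 * (d^8 * x^4))\<^sup>2" .
  qed (use pos[of 8 4] in simp)
  then show "nrm (z s) \<le> 390 * d^8 * x^4" by (simp add: mult.assoc)
  have "nrm (cubic s) \<le> W * d"
    by (rule cubic_le[OF a _ W0]) (unfold W_def, rule w_sup[OF a X[folded X_def]])
  moreover have "nrm (lower s) \<le> g" unfolding g_def by (rule lower_le[OF a])
  moreover have "d^4 * x^2 \<le> d^8 * x^4" by (rule mon) auto
  \<comment> \<open>395 = 390 + 5, where 5 is the constant of \<open>cub\<close> for the lower order
    terms.\<close>
  ultimately have "nrm (w2 s) \<le> 395 * (d^8 * x^4)"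
    using w2_le[of s] \<zeta>[of s] cub by linarith
  then show "nrm (w2 s) \<le> 395 * d^8 * x^4" by (simp add: mult.assoc)
qed

text \<open>Turns a bound on a derivative into a lower bound on \<open>m\<close>, with 2 \<pi> in
  \<open>nrm_tail_le\<close> estimated by 1.\<close>

lemma tail_le:
  assumes "wd u u'" "nrm u' \<le> B" "L * B \<le> \<epsilon> * real m" "0 < B"
  shows "nrm (\<lambda>x. u x - P m u x) \<le> \<epsilon>"
proof -
  have m: "0 < \<epsilon> * real m" using assms(3,4) L_pos mult_pos_pos[of L B] by linarith
  then have m0: "0 < real m" by (simp add: zero_less_mult_iff)
  have "real m / L * nrm (\<lambda>x. u x - P m u x) \<le> 2 * pi * real m / L * nrm (\<lambda>x. u x - P m u x)"
  proof (intro mult_right_mono divide_right_mono)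
    show "real m \<le> 2 * pi * real m" using pi_gt3 mult_right_mono[of 1 "2 * pi" "real m"] by simp
  qed (use L_pos in auto)
  also have "\<dots> \<le> B" using nrm_tail_le[OF assms(1), of m] assms(2) by (rule order_trans)
  also have "B \<le> \<epsilon> * real m / L" using assms(3) L_pos by (simp add: field_simps)
  finally have "(real m / L) * nrm (\<lambda>x. u x - P m u x) \<le> (real m / L) * \<epsilon>" by (simp add: mult_ac)
  then show ?thesis
    by (rule mult_left_le_imp_le) (use m0 L_pos in simp)
qed

text \<open>The inner constant 400 c^8, called \<open>d\<close> below, majorises the constants of
  the first order estimates. \<open>C\<close> = 400 d^9 does so one level higher: d^8 is the factor
  from \<open>second_bound\<close>, and the ninth \<open>d\<close> accounts for \<open>L\<close> in
  the tail condition on \<open>w1\<close>.\<close>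

theorem uniform_bounds:
  fixes c :: real
  assumes c: "1 \<le> c" "L \<le> c" "1 / L \<le> c" "\<gamma> \<le> c" "1 / \<gamma> \<le> c" "nrm f \<le> c" "V \<le> c"
  defines "C \<equiv> 400 * (400 * c^8)^9"
  assumes m: "C * (1 + \<mu>)^4 \<le> real m"
  shows "nrm (w s) \<le> nrm f / sqrt (\<gamma> * (\<gamma> + \<mu>)) + sqrt (\<mu> / (\<gamma> + \<mu>)) * V + sqrt (\<mu> / (\<gamma> + \<mu>))"
    and "nrm (w s) + nrm (w1 s) \<le> C * sqrt (1 + \<mu>)"
    and "nrm (w s) + nrm (w2 s) \<le> C * (1 + \<mu>)\<^sup>2"
    and "nrm (z s) \<le> C * (1 + \<mu>)\<^sup>2"
proof -
  define T where "T = 1 + \<mu>"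
  define d where "d = 400 * c^8"
  have T1: "1 \<le> T" using \<mu> by (simp add: T_def)
  have c0: "0 < c" using c(1) by simp
  have d1: "1 \<le> d" using one_le_power[OF c(1), of 8] by (simp add: d_def)
  have cd: "k * c^i \<le> d" if "i \<le> 8" "k \<le> 400" "0 \<le> k" for k i
    unfolding d_def using that c(1) by (intro mult_mono power_increasing) auto
  have dC: "k * d^i \<le> C" if "i \<le> 9" "k \<le> 400" "0 \<le> k" for k i
    unfolding C_def d_def[symmetric] using that d1 by (intro mult_mono power_increasing) auto
  have c_le_d: "c \<le> d" using cd[of 1 1] by simp
  have mT: "C * T^4 \<le> real m" using m by (simp add: T_def)
  have \<theta>\<gamma>: "(\<gamma> + \<mu>) / \<gamma> \<le> c * T"
  proof -
    have "(\<gamma> + \<mu>) / \<gamma> = 1 + \<mu> * (1 / \<gamma>)" using \<gamma> by (simp add: add_divide_distrib)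
    also have "\<dots> \<le> c + \<mu> * c" using c \<mu> by (intro add_mono mult_left_mono) auto
    finally show ?thesis by (simp add: T_def algebra_simps)
  qed
  have diss: "\<gamma> * (nrm (w1 s))\<^sup>2 - \<mu> * 0 \<le> \<gamma> * (nrm (w1 s))\<^sup>2 + \<mu> * (nrm (P m (w1 s)))\<^sup>2" for s
    using \<mu> by simp
  have crude: "nrm (w s) \<le> c^2 * T" for s
  proof (rule power2_le_imp_le)
    have "(nrm (w s))\<^sup>2 \<le> (nrm f)\<^sup>2 * (1 / \<gamma>)\<^sup>2 + \<mu> * (V\<^sup>2 * (1 / \<gamma>))"
    proof -
      have "\<mu> * V\<^sup>2 / (2 * \<gamma>) \<le> \<mu> * V\<^sup>2 / \<gamma>" using \<gamma> \<mu> by (intro divide_left_mono) auto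
      then show ?thesis using mass_crude[of s] by (simp add: power_divide)
    qed
    also have "\<dots> \<le> c\<^sup>2 * c\<^sup>2 + \<mu> * (c\<^sup>2 * c)"
      using c \<gamma> \<mu> V_ge0 by (intro add_mono mult_mono power_mono order_refl) auto
    also have "\<dots> \<le> c\<^sup>2 * c\<^sup>2 + \<mu> * (c\<^sup>2 * c\<^sup>2)"
      using c \<mu> by (intro add_left_mono mult_left_mono) (auto simp: self_le_power)
    also have "\<dots> = (c\<^sup>2 * c\<^sup>2) * T" by (simp add: T_def algebra_simps)
    also have "\<dots> \<le> (c\<^sup>2 * c\<^sup>2) * T\<^sup>2" using T1 by (intro mult_left_mono) (auto simp: self_le_power)
    also have "\<dots> = (c^2 * T)\<^sup>2" by (simp add: power2_eq_square mult_ac)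
    finally show "(nrm (w s))\<^sup>2 \<le> (c^2 * T)\<^sup>2" .
  qed (use T1 in simp)
  \<comment> \<open>The sixth power of 1 + a gives T^6, and \<theta> and 1 + \<mu> give one T each,
    so the square has order T^8. The constant comes from 34 * 2^6 = 2176 \<le> 47^2.\<close>
  have crude1: "nrm (w1 s) \<le> 47 * c^7 * T^4" for s
  proof (rule power2_le_imp_le)
    have "(nrm (w1 s))\<^sup>2 \<le> 34 * c * ((\<gamma> + \<mu>) / \<gamma>) * T * (1 + c^2 * T)^6"
      unfolding T_def by (rule first_bound[OF crude[unfolded T_def] \<gamma> _ _ _ diss])
        (use \<mu> c \<theta>\<gamma> in \<open>auto simp: T_def\<close>)
    also have "\<dots> \<le> 34 * c * (c * T) * T * (2 * (c^2 * T))^6"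
    proof -
      have "1 \<le> c^2 * T" using mult_mono[of 1 "c^2" 1 T] c(1) T1 by (simp add: one_le_power mult.commute)
      then have "1 + c^2 * T \<le> 2 * (c^2 * T)" by linarith
      then show ?thesis using \<theta>\<gamma> c0 T1 \<gamma> \<mu> by (intro mult_mono mult_left_mono mult_right_mono power_mono) auto
    qed
    also have "\<dots> = 2176 * (c^14 * T^8)" by (simp add: power_mult_distrib flip: power_mult) (simp add: eval_nat_numeral mult_ac)
    also have "\<dots> \<le> 2209 * (c^14 * T^8)" using c0 T1 by (intro mult_right_mono) auto
    also have "\<dots> = (47 * c^7 * T^4)\<^sup>2" by (simp add: power_mult_distrib flip: power_mult)
    finally show "(nrm (w1 s))\<^sup>2 \<le> (47 * c^7 * T^4)\<^sup>2" .
  qed (use c0 T1 in simp)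
  \<comment> \<open>First demand of order T^4 on \<open>m\<close>; 94 = 2 * 47 because the tail is
    to be at most 1/2.\<close>
  have tail0: "nrm (\<lambda>x. w s x - P m (w s) x) \<le> 1 / 2" for s
  proof (rule tail_le[OF wd_w crude1])
    have "L * (47 * c^7 * T^4) \<le> c * (47 * c^7 * T^4)" using c c0 T1 by (intro mult_right_mono) auto
    also have "\<dots> = 1 / 2 * ((94 * c^8) * T^4)" by (simp add: eval_nat_numeral mult_ac)
    also have "\<dots> \<le> 1 / 2 * (C * T^4)"
      using cd[of 8 94] dC[of 1 1] T1 by (intro mult_left_mono mult_right_mono) auto
    also have "\<dots> \<le> 1 / 2 * real m" using mT by simp
    finally show "L * (47 * c^7 * T^4) \<le> 1 / 2 * real m" .
  qed (use c0 T1 in simp)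
  have R0: "nrm (w s) \<le> nrm f / sqrt (\<gamma> * (\<gamma> + \<mu>)) + sqrt (\<mu> / (\<gamma> + \<mu>)) * V + sqrt (\<mu> / (\<gamma> + \<mu>))" for s
  proof (rule mass_refined)
    show "(nrm (\<lambda>x. w s x - P m (w s) x))\<^sup>2 \<le> 1 / 2" for s
      using power_mono[OF tail0 nrm_ge0, of s 2] by (simp add: power2_eq_square)
  qed
  then show "nrm (w s) \<le> nrm f / sqrt (\<gamma> * (\<gamma> + \<mu>)) + sqrt (\<mu> / (\<gamma> + \<mu>)) * V + sqrt (\<mu> / (\<gamma> + \<mu>))" .
  have a: "nrm (w s) \<le> 3 * c\<^sup>2" for s
  proof -
    have "\<gamma> \<le> sqrt (\<gamma> * (\<gamma> + \<mu>))"
      using \<gamma> \<mu> by (intro real_le_rsqrt) (simp add: power2_eq_square)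
    then have "nrm f / sqrt (\<gamma> * (\<gamma> + \<mu>)) \<le> nrm f / \<gamma>" using \<gamma> \<mu> by (intro divide_left_mono) auto
    also have "\<dots> = nrm f * (1 / \<gamma>)" by simp
    also have "\<dots> \<le> c * c" using c \<gamma> by (intro mult_mono) auto
    finally have "nrm f / sqrt (\<gamma> * (\<gamma> + \<mu>)) \<le> c\<^sup>2" by (simp add: power2_eq_square)
    moreover have r: "sqrt (\<mu> / (\<gamma> + \<mu>)) \<le> 1" using \<gamma> \<mu> by simp
    have "sqrt (\<mu> / (\<gamma> + \<mu>)) * V \<le> 1 * c" using r c \<gamma> \<mu> V_ge0 by (intro mult_mono) auto
    then have "sqrt (\<mu> / (\<gamma> + \<mu>)) * V \<le> c\<^sup>2" using self_le_power[OF c(1), of 2] by simp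
    moreover have "sqrt (\<mu> / (\<gamma> + \<mu>)) \<le> c\<^sup>2" using r one_le_power[OF c(1), of 2] by linarith
    ultimately show ?thesis using R0[of s] by linarith
  qed
  have b: "(1 + 3 * c\<^sup>2)^6 \<le> 4096 * c^12"
  proof -
    have "(1 + 3 * c\<^sup>2)^6 \<le> (4 * c\<^sup>2)^6" using one_le_power[OF c(1), of 2] by (intro power_mono) auto
    also have "\<dots> = 4096 * c^12" by (simp add: power_mult_distrib flip: power_mult)
    finally show ?thesis .
  qed
  \<comment> \<open>The bound of \<open>w\<close> no longer depends on \<mu>, so only \<theta> and 1
    + \<mu> contribute powers of T. The constant comes from 34 * 4096 = 139264 \<le> 374^2.\<close>
  have linear1: "nrm (w1 s) \<le> 374 * c^7 * T" for s
  proof (rule power2_le_imp_le)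
    have "(nrm (w1 s))\<^sup>2 \<le> 34 * c * ((\<gamma> + \<mu>) / \<gamma>) * T * (1 + 3 * c\<^sup>2)^6"
      unfolding T_def by (rule first_bound[OF a \<gamma> _ _ _ diss])
        (use \<mu> c \<theta>\<gamma> in \<open>auto simp: T_def\<close>)
    also have "\<dots> \<le> 34 * c * (c * T) * T * (4096 * c^12)"
      using \<theta>\<gamma> c0 T1 b \<gamma> \<mu> by (intro mult_mono mult_left_mono mult_right_mono) auto
    also have "\<dots> = 139264 * (c^14 * T\<^sup>2)" by (simp add: eval_nat_numeral mult_ac)
    also have "\<dots> \<le> 139876 * (c^14 * T\<^sup>2)" using c0 T1 by (intro mult_right_mono) auto
    also have "\<dots> = (374 * c^7 * T)\<^sup>2" by (simp add: power_mult_distrib flip: power_mult)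
    finally show "(nrm (w1 s))\<^sup>2 \<le> (374 * c^7 * T)\<^sup>2" .
  qed (use c0 T1 in simp)
  have ad: "nrm (w s) \<le> d" for s using a[of s] cd[of 2 3] by simp
  have c7: "374 * c^7 \<le> d" using cd[of 7 374] by simp
  have w2_crude: "nrm (w2 s) \<le> 395 * d^8 * T^4" for s
  proof (rule second_bound[OF d1 _ _ _ _ _ T1 _ ad])
    show "1 + \<mu> \<le> T\<^sup>2" using self_le_power[OF T1, of 2] by (simp add: T_def)
    show "nrm (w1 s) \<le> d * T" for s
      using linear1[of s] mult_right_mono[OF c7, of T] T1 by linarith
  qed (use c c_le_d in auto)
  \<comment> \<open>Second demand of order T^4 on \<open>m\<close>, now through the first-round
    bound of \<open>w2\<close>; it is the one that dictates the size of \<open>C\<close>.\<close>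
  have tail1: "nrm (\<lambda>x. w1 s x - P m (w1 s) x) \<le> 1" for s
  proof (rule tail_le[OF wd_w1 w2_crude])
    have "L * (395 * d^8 * T^4) \<le> d * (395 * d^8 * T^4)" using c c_le_d d1 T1 by (intro mult_right_mono) auto
    also have "\<dots> = (395 * d^9) * T^4" by (simp add: eval_nat_numeral mult_ac)
    also have "\<dots> \<le> C * T^4" using dC[of 9 395] T1 by (intro mult_right_mono) auto
    finally show "L * (395 * d^8 * T^4) \<le> 1 * real m" using mT by simp
  qed (use d1 T1 in simp)
  \<comment> \<open>The tail bound makes the rate \<kappa> = \<gamma> + \<mu> available at the price
    \<open>q\<close> = 1. With \<theta> = 1 one power of T disappears from the square.\<close>
  have X: "nrm (w1 s) \<le> 374 * c^7 * sqrt T" for s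
  proof (rule power2_le_imp_le)
    have "(nrm (w1 s))\<^sup>2 \<le> 34 * c * ((\<gamma> + \<mu>) / (\<gamma> + \<mu>)) * T * (1 + 3 * c\<^sup>2)^6"
      unfolding T_def
    proof (rule first_bound[OF a, of _ 1])
      fix s
      have "(nrm (\<lambda>x. w1 s x - P m (w1 s) x))\<^sup>2 \<le> 1" by (rule power_le_one[OF nrm_ge0 tail1])
      then have "\<mu> * (nrm (w1 s))\<^sup>2 \<le> \<mu> * ((nrm (P m (w1 s)))\<^sup>2 + 1)"
        using nrm_P_square[of "w1 s" m] \<mu> by (intro mult_left_mono) auto
      then show "(\<gamma> + \<mu>) * (nrm (w1 s))\<^sup>2 - \<mu> * 1 \<le> \<gamma> * (nrm (w1 s))\<^sup>2 + \<mu> * (nrm (P m (w1 s)))\<^sup>2"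
        by (simp add: ring_distribs)
      have "1 \<le> c * T" using mult_mono[of 1 c 1 T] c T1 by simp
      then show "(\<gamma> + \<mu>) / (\<gamma> + \<mu>) \<le> c * (1 + \<mu>)" using \<gamma> \<mu> by (simp add: T_def)
    qed (use \<gamma> \<mu> c in auto)
    also have "\<dots> \<le> 34 * c * 1 * T * (4096 * c^12)"
      using c0 T1 b \<gamma> \<mu> by (intro mult_mono) auto
    also have "\<dots> = 139264 * (c^13 * T)" by (simp add: eval_nat_numeral mult_ac)
    also have "\<dots> \<le> 139876 * (c^14 * T)"
      using c0 c(1) T1 by (intro mult_mono power_increasing) auto
    also have "\<dots> = (374 * c^7 * sqrt T)\<^sup>2" using T1 by (simp add: power_mult_distrib flip: power_mult)
    finally show "(nrm (w1 s))\<^sup>2 \<le> (374 * c^7 * sqrt T)\<^sup>2" .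
  qed (use c0 T1 in simp)
  have sT: "1 \<le> sqrt T" "(sqrt T)\<^sup>2 = T" using T1 by auto
  have sT4: "sqrt T ^ 4 = T\<^sup>2" using power_mult[of "sqrt T" 2 2] sT(2) by simp
  have fin: "nrm (z s) \<le> 390 * d^8 * T\<^sup>2" "nrm (w2 s) \<le> 395 * d^8 * T\<^sup>2"
  proof -
    have X': "nrm (w1 s) \<le> d * sqrt T" for s
      using X[of s] mult_right_mono[OF c7, of "sqrt T"] sT by linarith
    note sb = second_bound[OF d1 _ _ _ _ _ sT(1) _ ad X', of s]
    show "nrm (z s) \<le> 390 * d^8 * T\<^sup>2" "nrm (w2 s) \<le> 395 * d^8 * T\<^sup>2"
      using sb c c_le_d sT unfolding sT4 by (auto simp: T_def)
  qed
  have T2: "1 \<le> T\<^sup>2" using T1 by (simp add: one_le_power)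
  have c2: "3 * c\<^sup>2 \<le> d^8"
    using cd[of 2 3] self_le_power[OF d1, of 8] by simp
  have "nrm (w s) + nrm (w1 s) \<le> 3 * c\<^sup>2 * sqrt T + 374 * c^7 * sqrt T"
    using a[of s] X[of s] mult_left_mono[OF sT(1), of "3 * c\<^sup>2"] by simp
  also have "\<dots> = (3 * c\<^sup>2 + 374 * c^7) * sqrt T" by (simp add: ring_distribs)
  also have "\<dots> \<le> C * sqrt T"
    using c7 cd[of 2 3] dC[of 1 2] sT by (intro mult_right_mono) auto
  finally show "nrm (w s) + nrm (w1 s) \<le> C * sqrt (1 + \<mu>)" by (simp add: T_def)
  have "3 * c\<^sup>2 \<le> d^8 * T\<^sup>2" using mult_mono[OF c2 T2] d1 by simp
  then have "nrm (w s) + nrm (w2 s) \<le> 396 * d^8 * T\<^sup>2"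
    using a[of s] fin(2) by simp
  also have "\<dots> \<le> C * T\<^sup>2" using dC[of 8 396] T2 by (intro mult_right_mono) auto
  finally show "nrm (w s) + nrm (w2 s) \<le> C * (1 + \<mu>)\<^sup>2" by (simp add: T_def)
  have "390 * d^8 * T\<^sup>2 \<le> C * T\<^sup>2" using dC[of 8 390] T2 by (intro mult_right_mono) auto
  then show "nrm (z s) \<le> C * (1 + \<mu>)\<^sup>2" using fin(1) by (simp add: T_def)
qed

end

section \<open>From the definitions to the analytic setting\<close>

context period
begin

text \<open>Limits in the mean are determined almost everywhere only, so equality is claimed for
  norms; this is enough to compare a chosen derivative with any other one.\<close>

lemma cvL2_unique:
  assumes "cvL2 F u a" "cvL2 F u b" "F \<noteq> bot"
  shows "nrm a = nrm b"
proof -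
  have [simp]: "a \<in> L2" "b \<in> L2" "u t \<in> L2" for t using assms by (auto simp: cvL2_def)
  have "nrm (\<lambda>x. a x - b x) \<le> nrm (\<lambda>x. u t x - a x) + nrm (\<lambda>x. u t x - b x)" for t
    using nrm_triangle_between[of a "u t" b] by (simp add: nrm_minus_commute[of a])
  moreover have "((\<lambda>t. nrm (\<lambda>x. u t x - a x) + nrm (\<lambda>x. u t x - b x)) \<longlongrightarrow> 0 + 0) F"
    using assms by (intro tendsto_add) (simp_all add: cvL2_def)
  ultimately have "nrm (\<lambda>x. a x - b x) \<le> 0 + 0"
    using assms(3) by (intro tendsto_lowerbound) auto
  then show ?thesis using nrm_diff_ge[of a b] by simp
qed

lemma Dt_l2_has_deriv:
  assumes "\<And>t. w t \<in> L2" "l2_has_deriv L w g s"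
  shows "Dt w g s"
proof -
  let ?d = "\<lambda>t. nrm (\<lambda>x. (w t x - w s x) / complex_of_real (t - s) - g x)"
  have g: "g \<in> L2" using assms(2) L2per_subset by (auto simp: l2_has_deriv_def)
  have "(\<lambda>h. ?d (s + h)) \<midarrow>0\<rightarrow> 0"
    using assms(2) by (simp add: l2_has_deriv_def l2norm_eq)
  then have "(?d \<longlongrightarrow> 0) (at s)" by (rule LIM_offset_zero_cancel)
  then show ?thesis
    using assms(1) g by (auto simp: Dt_def cvL2_def simp del: of_real_diff intro!: L2_divide L2_diff)
qed

lemma L2per_diff: "u \<in> L2per L \<Longrightarrow> v \<in> L2per L \<Longrightarrow> (\<lambda>x. u x - v x) \<in> L2per L"
proof -
  assume uv: "u \<in> L2per L" "v \<in> L2per L"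
  then have "(\<lambda>x. u x - v x) \<in> L2" using L2per_subset by (intro L2_diff) auto
  then show ?thesis using uv by (auto simp: L2per_def L2_def per_def set_integrable_M intro: borel_measurable_diff)
qed

lemma wderiv_diff:
  assumes "wderiv L u g" "wderiv L v h"
  shows "wderiv L (\<lambda>x. u x - v x) (\<lambda>x. g x - h x)"
  using assms wderiv_imp_wd[OF assms(1)] wderiv_imp_wd[OF assms(2)]
  by (auto simp: wderiv_def L2per_diff fcoef_diff wd_def right_diff_distrib)

text \<open>\<open>d1\<close> and \<open>d2\<close> are chosen independently, so
  \<open>d2 L u\<close> could belong to another first derivative. All first derivatives have the
  same Fourier coefficients, and beyond membership in \<open>L2per\<close> these are all that
  \<open>wderiv\<close> looks at.\<close>

lemma H2per_wderiv:
  assumes "u \<in> H2per L"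
  shows "wderiv L u (d1 L u)" "wderiv L (d1 L u) (d2 L u)"
proof -
  obtain g h where gh: "wderiv L u g" "wderiv L g h" using assms by (auto simp: H2per_def)
  show d1: "wderiv L u (d1 L u)" unfolding d1_def by (rule someI[of "\<lambda>g. wderiv L u g", OF gh(1)])
  have "\<exists>g. wderiv L u g \<and> wderiv L g (d2 L u)" unfolding d2_def
    by (rule someI[of "\<lambda>h. \<exists>g. wderiv L u g \<and> wderiv L g h" h]) (use gh in blast)
  then obtain g' where "wderiv L u g'" "wderiv L g' (d2 L u)" by blast
  with d1 show "wderiv L (d1 L u) (d2 L u)" by (simp add: wderiv_def)
qed

text \<open>\<open>d2\<close> of a difference is a fresh choice, not the difference of the chosen
  \<open>d2\<close>. By completeness the two agree almost everywhere, so continuity in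
  \<open>h2norm\<close> passes to \<open>w2\<close>.\<close>

lemma nrm_second_derivative_unique:
  assumes "wderiv L u g" "wderiv L g h" "wderiv L u g'" "wderiv L g' h'"
  shows "nrm h = nrm h'"
proof -
  have [simp]: "h \<in> L2" "h' \<in> L2" using assms[THEN wderiv_imp_wd] by (simp_all add: wd_def)
  have "AE x in M. h x = h' x"
    using assms by (intro fcoef_eqD) (simp_all add: wderiv_def)
  then show ?thesis by (rule nrm_cong_AE) simp_all
qed

lemma nls_solution:
  assumes "0 < \<gamma>" "0 < \<mu>" and f: "f \<in> L2per L" and v: "v \<in> Xspace L m" and sol: "is_sol L \<gamma> f \<mu> m v w"
  shows "\<exists>v1. nls L \<gamma> \<mu> m f w (\<lambda>s. d1 L (w s)) (\<lambda>s. d2 L (w s)) (tderiv L w) v v1 (Xnorm L v)"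
proof -
  obtain v1 B where Hm: "\<And>s. v s \<in> Hm L m" and v1: "\<And>s. l2_has_deriv L v (v1 s) s"
    and v1_cont: "\<And>s. ((\<lambda>t. l2norm L (\<lambda>x. v1 t x - v1 s x)) \<longlongrightarrow> 0) (at s)"
    and B: "\<And>s. l2norm L (v s) \<le> B" "\<And>s. l2norm L (v1 s) \<le> B"
    using v unfolding Xspace_def by blast
  have P_v: "P m (v s) = v s" for s by (rule P_Hm[OF Hm])
  have v_L2: "v s \<in> L2" for s using L2_P[of m "v s"] P_v by simp
  have v1_L2: "v1 s \<in> L2" for s using v1[of s] L2per_subset by (auto simp: l2_has_deriv_def)
  have Dt_v: "Dt v (v1 s) s" for s by (rule Dt_l2_has_deriv[OF v_L2 v1])
  \<comment> \<open>\<open>Xnorm\<close> is built from the chosen derivative \<open>tderiv\<close>,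
    whereas \<open>Xspace\<close> grants continuity and boundedness for the witness
    \<open>v1\<close>.\<close>
  have tderiv_v: "l2norm L (tderiv L v s) = l2norm L (v1 s)" for s
  proof -
    have "l2_has_deriv L v (tderiv L v s) s" unfolding tderiv_def by (rule someI[of "\<lambda>g. l2_has_deriv L v g s", OF v1])
    then have "Dt v (tderiv L v s) s" by (rule Dt_l2_has_deriv[OF v_L2])
    then show ?thesis
      using Dt_v[of s] unfolding l2norm_eq by (intro cvL2_unique[where F = "at s"]) (auto simp: Dt_def)
  qed
  \<comment> \<open>Only for sets bounded above do the suprema in \<open>Xnorm\<close> dominate
    their members.\<close>
  have bdd: "bdd_above (range (\<lambda>s. l2norm L (v s)))" "bdd_above (range (\<lambda>s. l2norm L (tderiv L v s)))"
    using B tderiv_v by (auto intro!: bdd_aboveI[of _ B])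
  have sup: "l2norm L (v s) \<le> (SUP s. l2norm L (v s))" "l2norm L (v1 s) \<le> (SUP s. l2norm L (tderiv L v s))" for s
    using cSUP_upper[OF UNIV_I bdd(1), of s] cSUP_upper[OF UNIV_I bdd(2), of s] by (simp_all add: tderiv_v)
  have X: "nrm (v s) \<le> Xnorm L v" "nrm (v1 s) \<le> Xnorm L v" for s
    using sup[of s] nrm_ge0[of "v s"] nrm_ge0[of "v1 s"] unfolding Xnorm_def l2norm_eq by linarith+
  have H2: "w s \<in> H2per L" for s using sol by (simp add: is_sol_def Yspace_def)
  obtain C where C: "\<And>s. h2norm L (w s) \<le> C" using sol by (auto simp: is_sol_def Yspace_def)
  note W = H2per_wderiv[OF H2]
  note wd = W(1)[THEN wderiv_imp_wd] W(2)[THEN wderiv_imp_wd]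
  have h2: "nrm u \<le> h2norm L u" "nrm (d2 L u) \<le> h2norm L u" for u
    unfolding h2norm_def l2norm_eq by (simp_all add: real_le_rsqrt)
  have w2_cont: "cvL2 (at s) (\<lambda>s. d2 L (w s)) (d2 L (w s))" for s
  proof (rule cvL2_bound)
    show "((\<lambda>t. h2norm L (\<lambda>x. w t x - w s x)) \<longlongrightarrow> 0) (at s)"
      using sol by (simp add: is_sol_def Yspace_def)
    fix t
    have "(\<lambda>x. w t x - w s x) \<in> H2per L"
      unfolding H2per_def using wderiv_diff[OF W(1) W(1)] wderiv_diff[OF W(2) W(2)] by blast
    note D = H2per_wderiv[OF this]
    have "nrm (\<lambda>x. d2 L (w t) x - d2 L (w s) x) = nrm (d2 L (\<lambda>x. w t x - w s x))"
      by (rule nrm_second_derivative_unique[OF wderiv_diff[OF W(1) W(1)] wderiv_diff[OF W(2) W(2)] D])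
    also have "\<dots> \<le> h2norm L (\<lambda>x. w t x - w s x)" by (rule h2)
    finally show "nrm (\<lambda>x. d2 L (w t) x - d2 L (w s) x) \<le> h2norm L (\<lambda>x. w t x - w s x)" .
  qed (use wd in \<open>auto simp: wd_def\<close>)
  have Dt_w: "Dt w (tderiv L w s) s" for s
  proof (rule Dt_l2_has_deriv)
    show "l2_has_deriv L w (tderiv L w s) s"
      using sol unfolding is_sol_def tderiv_def by (metis someI_ex)
  qed (use wd in \<open>auto simp: wd_def\<close>)
  have evolution: "AE x in M. tderiv L w s x =
      \<i> * (d2 L (w s) x + w s x * cnj (w s x) * w s x)
      - (\<gamma> * w s x + \<mu> * P m (w s) x + (\<i> * f x - \<mu> * v s x))" for s
  proof -
    have "AE x in M. \<i> * tderiv L w s x + d2 L (w s) x + complex_of_real ((cmod (w s x))\<^sup>2) * w s x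
          + \<i> * complex_of_real \<gamma> * w s x
        = f x - \<i> * complex_of_real \<mu> * (P m (w s) x - v s x)"
      using sol by (simp add: is_sol_def AE_M)
    then show ?thesis
    proof eventually_elim
      case (elim x)
      have "z = \<i> * (c + n) - (g * a + p + (\<i> * y - q))" if "\<i> * z + c + n + \<i> * g * a = y - \<i> * (p - q)"
        for z c n g a y p q :: complex
      proof -
        have "z = - \<i> * (\<i> * z)" by simp
        also have "\<i> * z = y - \<i> * (p - q) - c - n - \<i> * g * a" using that by (simp add: algebra_simps)
        finally show ?thesis by (simp add: algebra_simps)
      qed
      from this[of "tderiv L w s x" "d2 L (w s) x" "w s x * cnj (w s x) * w s x" \<gamma> "w s x" "f x"
          "\<mu> * P m (w s) x" "\<mu> * v s x"] elim
      show ?case unfolding complex_norm_square by (simp add: algebra_simps)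
    qed
  qed
  have "nls L \<gamma> \<mu> m f w (\<lambda>s. d1 L (w s)) (\<lambda>s. d2 L (w s)) (tderiv L w) v v1 (Xnorm L v)"
  proof unfold_locales
    show "f \<in> L2" using f L2per_subset by auto
    show "\<exists>B. \<forall>s. nrm (w s) \<le> B \<and> nrm (d2 L (w s)) \<le> B"
      using h2 C order_trans by blast
    show "cvL2 (at s) v1 (v1 s)" for s
      using v1_cont v1_L2 by (simp add: cvL2_def l2norm_eq)
  qed (rule assms wd w2_cont Dt_w Dt_v P_v X evolution)+
  then show ?thesis by blast
qed

end

section \<open>Explicit constants and their growth in \<mu>\<close>

text \<open>The constant \<open>C\<close> of \<open>uniform_bounds\<close>, with the sum of all
  parameters as common majorant. The absolute values make it positive for all real \<open>nf\<close>
  and \<open>V\<close>, and \<mu> does not occur in it.\<close>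

definition parameter_bound :: "real \<Rightarrow> real \<Rightarrow> real \<Rightarrow> real \<Rightarrow> real" where
  "parameter_bound L \<gamma> nf V = 400 * (400 * (1 + L + 1 / L + \<gamma> + 1 / \<gamma> + \<bar>nf\<bar> + \<bar>V\<bar>)^8)^9"

lemma parameter_bound_pos:
  assumes "0 < L" "0 < \<gamma>"
  shows "0 < parameter_bound L \<gamma> nf V"
proof -
  have "0 < 1 + L + 1 / L + \<gamma> + 1 / \<gamma> + \<bar>nf\<bar> + \<bar>V\<bar>"
    using assms by (intro add_pos_nonneg) auto
  then show ?thesis by (simp add: parameter_bound_def)
qed

lemma solution_bounds:
  assumes "0 < L" "0 < \<gamma>" "0 < \<mu>" "f \<in> L2per L" "v \<in> Xspace L m" "is_sol L \<gamma> f \<mu> m v w"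
  defines "C \<equiv> parameter_bound L \<gamma> (l2norm L f) (Xnorm L v)"
  assumes m: "C * (1 + \<mu>)^4 \<le> real m"
  shows "l2norm L (w s) \<le> l2norm L f / sqrt (\<gamma> * (\<gamma> + \<mu>)) + sqrt (\<mu> / (\<gamma> + \<mu>)) * Xnorm L v + sqrt (\<mu> / (\<gamma> + \<mu>))"
    and "h1norm L (w s) \<le> C * sqrt (1 + \<mu>)" "h2norm L (w s) \<le> C * (1 + \<mu>)\<^sup>2"
    and "l2norm L (tderiv L w s) \<le> C * (1 + \<mu>)\<^sup>2"
proof -
  interpret period L by standard (rule assms)
  obtain v1 where "nls L \<gamma> \<mu> m f w (\<lambda>s. d1 L (w s)) (\<lambda>s. d2 L (w s)) (tderiv L w) v v1 (Xnorm L v)"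
    using nls_solution[OF assms(2-6)] by blast
  then interpret nls L \<gamma> \<mu> m f w "\<lambda>s. d1 L (w s)" "\<lambda>s. d2 L (w s)" "tderiv L w" v v1 "Xnorm L v" .
  let ?c = "1 + L + 1 / L + \<gamma> + 1 / \<gamma> + \<bar>nrm f\<bar> + \<bar>Xnorm L v\<bar>"
  have inv: "0 < 1 / L" "0 < 1 / \<gamma>" using assms by simp_all
  have c: "1 \<le> ?c" "L \<le> ?c" "1 / L \<le> ?c" "\<gamma> \<le> ?c" "1 / \<gamma> \<le> ?c" "nrm f \<le> ?c" "Xnorm L v \<le> ?c"
    using assms(1,2) inv abs_ge_self[of "nrm f"] abs_ge_self[of "Xnorm L v"] by linarith+
  have C: "400 * (400 * ?c^8)^9 = C" by (simp add: C_def parameter_bound_def l2norm_eq)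
  note b = uniform_bounds[OF c, unfolded C, OF m]
  have sum: "sqrt (p\<^sup>2 + q\<^sup>2) \<le> p + q" if "0 \<le> p" "0 \<le> q" for p q
    using sqrt_add_le_add_sqrt[of "p\<^sup>2" "q\<^sup>2"] that by simp
  show "l2norm L (w s) \<le> l2norm L f / sqrt (\<gamma> * (\<gamma> + \<mu>)) + sqrt (\<mu> / (\<gamma> + \<mu>)) * Xnorm L v + sqrt (\<mu> / (\<gamma> + \<mu>))"
    unfolding l2norm_eq by (rule b)
  show "h1norm L (w s) \<le> C * sqrt (1 + \<mu>)"
    unfolding h1norm_def l2norm_eq by (rule order_trans[OF sum b(2)]) simp_all
  show "h2norm L (w s) \<le> C * (1 + \<mu>)\<^sup>2"
    unfolding h2norm_def l2norm_eq by (rule order_trans[OF sum b(3)]) simp_all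
  show "l2norm L (tderiv L w s) \<le> C * (1 + \<mu>)\<^sup>2"
    unfolding l2norm_eq by (rule b)
qed

lemma bigo_at_top_real:
  fixes g h :: "real \<Rightarrow> real"
  assumes "\<And>x. 1 \<le> x \<Longrightarrow> 0 \<le> g x \<and> g x \<le> K * h x" "\<And>x. 1 \<le> x \<Longrightarrow> 0 \<le> h x"
  shows "g \<in> O[at_top](h)"
  by (rule bigoI[of _ K], rule eventually_at_top_linorderI[of 1]) (use assms in auto)

theorem theorem4p2:
  fixes L \<gamma> :: real
  assumes "0 < L" and "0 < \<gamma>"
  shows "\<exists>(R1 :: real \<Rightarrow> real \<Rightarrow> real \<Rightarrow> real) (R2 :: real \<Rightarrow> real \<Rightarrow> real \<Rightarrow> real)
           (R' :: real \<Rightarrow> real \<Rightarrow> real \<Rightarrow> real) (m0 :: real \<Rightarrow> real \<Rightarrow> real \<Rightarrow> nat).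
     (\<forall>\<mu> nf V. 0 < \<mu> \<longrightarrow> 0 < nf \<longrightarrow> 0 \<le> V \<longrightarrow>
         0 < R1 \<mu> nf V \<and> 0 < R2 \<mu> nf V \<and> 0 < R' \<mu> nf V) \<and>
     (\<forall>f \<mu> m v w.
        0 < \<mu> \<longrightarrow> f \<in> L2per L \<longrightarrow> l2norm L f \<noteq> 0 \<longrightarrow> v \<in> Xspace L m \<longrightarrow>
        m0 \<mu> (l2norm L f) (Xnorm L v) \<le> m \<longrightarrow> is_sol L \<gamma> f \<mu> m v w \<longrightarrow>
        (\<forall>s. l2norm L (w s) \<le> l2norm L f / sqrt (\<gamma> * (\<gamma> + \<mu>))
                 + sqrt (\<mu> / (\<gamma> + \<mu>)) * Xnorm L v + sqrt (\<mu> / (\<gamma> + \<mu>))) \<and>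
        (\<forall>s. h1norm L (w s) \<le> R1 \<mu> (l2norm L f) (Xnorm L v)) \<and>
        (\<forall>s. h2norm L (w s) \<le> R2 \<mu> (l2norm L f) (Xnorm L v)) \<and>
        (\<forall>s. l2norm L (tderiv L w s) \<le> R' \<mu> (l2norm L f) (Xnorm L v))) \<and>
     (\<forall>nf V. 0 < nf \<longrightarrow> 0 \<le> V \<longrightarrow>
        (\<lambda>\<mu>. R1 \<mu> nf V) \<in> O[at_top](\<lambda>\<mu>. sqrt \<mu>) \<and>
        (\<lambda>\<mu>. R2 \<mu> nf V) \<in> O[at_top](\<lambda>\<mu>. \<mu>\<^sup>2) \<and>
        (\<lambda>\<mu>. R' \<mu> nf V) \<in> O[at_top](\<lambda>\<mu>. \<mu>\<^sup>2) \<and>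
        (\<lambda>\<mu>. real (m0 \<mu> nf V)) \<in> O[at_top](\<lambda>\<mu>. \<mu> ^ 4))"
proof -
  let ?C = "parameter_bound L \<gamma>"
  \<comment> \<open>Powers of 1 + \<mu> give bounds for every \<mu> > 0, not only for large ones.
    The function \<open>?R2\<close> serves both for the H2 norm and for w_s.\<close>
  let ?R1 = "\<lambda>\<mu> nf V. ?C nf V * sqrt (1 + \<mu>)" and ?R2 = "\<lambda>\<mu> nf V. ?C nf V * (1 + \<mu>)\<^sup>2"
    and ?m0 = "\<lambda>\<mu> nf V. nat \<lceil>?C nf V * (1 + \<mu>)^4\<rceil>"
  have C: "0 < ?C nf V" for nf V by (rule parameter_bound_pos[OF assms])
  have pos: "0 < ?R1 \<mu> nf V" "0 < ?R2 \<mu> nf V" if "0 < \<mu>" for \<mu> nf V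
    using that C[of nf V] by simp_all
  have bounds: "(\<forall>s. l2norm L (w s) \<le> l2norm L f / sqrt (\<gamma> * (\<gamma> + \<mu>))
                 + sqrt (\<mu> / (\<gamma> + \<mu>)) * Xnorm L v + sqrt (\<mu> / (\<gamma> + \<mu>))) \<and>
        (\<forall>s. h1norm L (w s) \<le> ?R1 \<mu> (l2norm L f) (Xnorm L v)) \<and>
        (\<forall>s. h2norm L (w s) \<le> ?R2 \<mu> (l2norm L f) (Xnorm L v)) \<and>
        (\<forall>s. l2norm L (tderiv L w s) \<le> ?R2 \<mu> (l2norm L f) (Xnorm L v))"
    if "0 < \<mu>" "f \<in> L2per L" "v \<in> Xspace L m" "?m0 \<mu> (l2norm L f) (Xnorm L v) \<le> m" "is_sol L \<gamma> f \<mu> m v w"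
    for f \<mu> m v w
  proof -
    have "?C (l2norm L f) (Xnorm L v) * (1 + \<mu>)^4 \<le> real m" using that(4) by (simp add: nat_le_iff ceiling_le_iff)
    then show ?thesis using solution_bounds[OF assms that(1,2,3,5)] by blast
  qed
  have O1: "(\<lambda>\<mu>. ?R1 \<mu> nf V) \<in> O[at_top](\<lambda>\<mu>. sqrt \<mu>)" for nf V
  proof (rule bigo_at_top_real[where K = "?C nf V * sqrt 2"])
    fix x :: real assume x: "1 \<le> x"
    have "sqrt (1 + x) \<le> sqrt (2 * x)" using x by simp
    then show "0 \<le> ?R1 x nf V \<and> ?R1 x nf V \<le> ?C nf V * sqrt 2 * sqrt x"
      using C[of nf V] x by (simp add: real_sqrt_mult)
  qed simp
  have O2: "(\<lambda>\<mu>. ?R2 \<mu> nf V) \<in> O[at_top](\<lambda>\<mu>. \<mu>\<^sup>2)" for nf V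
  proof (rule bigo_at_top_real[where K = "?C nf V * 4"])
    fix x :: real assume x: "1 \<le> x"
    have "(1 + x)\<^sup>2 \<le> (2 * x)\<^sup>2" using x by (intro power_mono) auto
    then show "0 \<le> ?R2 x nf V \<and> ?R2 x nf V \<le> ?C nf V * 4 * x\<^sup>2"
      using C[of nf V] by (simp add: power_mult_distrib)
  qed simp
  \<comment> \<open>In the constant below, 16 is 2^4 from 1 + x \<le> 2 x, and the summand 1 pays
    for the ceiling because 1 \<le> x^4.\<close>
  have O4: "(\<lambda>\<mu>. real (?m0 \<mu> nf V)) \<in> O[at_top](\<lambda>\<mu>. \<mu> ^ 4)" for nf V
  proof (rule bigo_at_top_real[where K = "?C nf V * 16 + 1"])
    fix x :: real assume x: "1 \<le> x"
    have "(1 + x)^4 \<le> (2 * x)^4" using x by (intro power_mono) auto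
    then have "?C nf V * (1 + x)^4 \<le> ?C nf V * (16 * x^4)"
      using C[of nf V] by (intro mult_left_mono) (auto simp: power_mult_distrib)
    moreover have "0 \<le> ?C nf V * (1 + x)^4" using C[of nf V] by simp
    then have "real (?m0 x nf V) \<le> ?C nf V * (1 + x)^4 + 1"
      by (simp add: of_nat_nat)
    moreover have "1 \<le> x^4" using x by (simp add: one_le_power)
    ultimately show "0 \<le> real (?m0 x nf V) \<and> real (?m0 x nf V) \<le> (?C nf V * 16 + 1) * x^4"
      by (simp add: ring_distribs)
  qed simp
  show ?thesis
  proof (rule exI[of _ ?R1], rule exI[of _ ?R2], rule exI[of _ ?R2], rule exI[of _ ?m0], intro conjI, goal_cases)
    case 1
    then show ?case by (intro allI impI conjI pos)
  next
    case 2
    then show ?case by (rule allI impI)+ (rule bounds)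
  next
    case 3
    then show ?case by (intro allI impI conjI O1 O2 O4)
  qed
qed

end
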